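(* For all terms $M$ and $N$ of the (restricted) call-by-value $\lambda\Box$-calculus, $M =_{v} N$ holds if and only if $[\![M]\!] =_{n} [\![N]\!]$ holds.
   Context: Types: $\sigma ::= p \mid \sigma\supset\sigma \mid \Box\sigma$, where $p$ ranges over type constants. $\vec{x}$ denotes a (possibly empty) sequence $x_1,\dots,x_n$ and $|\vec x|$ its length. We write $\mathbf{box}_{x_1,\dots,x_n}(N_1,\dots,N_n;\,M)$ ($n\ge 0$) for the box construct. In it the $x_i$ (annotated with types $\sigma_i$) are bound in the body $M$, and the free variables of the box term are exactly those of $N_1,\dots,N_n$. Terms are taken up to $\alpha$-equivalence, and substitution $M[x:=N]$ is capture-avoiding. $\vec N(\lambda\vec x.M)$ abbreviates $N_1(\lambda x_1.\cdots N_n(\lambda x_n.M)\cdots)$. Call-by-name calculus (target). Terms: $M ::= c \mid x \mid \lambda x^{\sigma}.M \mid MM \mid \mathbf{box}_{x_1^{\sigma_1},\dots,x_n^{\sigma_n}}(M_1,\dots,M_n;M)$, where $c$ ranges over constants (each with a fixed type) and $x$ over variables. Its one-step reduction $\to_n$ is the closure under arbitrary term contexts of the following rules: - $(\lambda x.M)N \to M[x:=N]$; - $\lambda x.Mx\to M$ if $x\notin FV(M)$; - $\mathbf{box}_{x}(M;x)\to M$; - $\mathbf{box}_{\vec w,x,\vec z}(\vec P,\mathbf{box}_{\vec y}(\vec L;N),\vec Q;M)\to \mathbf{box}_{\vec w,\vec y,\vec z}(\vec P,\vec L,\vec Q;M[x:=N])$ with $|\vec w|=|\vec P|$. $=_n$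 is the reflexive, symmetric, transitive closure of $\to_n$. Call-by-value calculus (source). It has the same types and typing rules, but terms are restricted so that the body of every box is a value: $M ::= c\mid x\mid \lambda x^\sigma.M\mid MM\mid \mathbf{box}_{\vec x}(M_1,\dots,M_n;V)$. Values: $V ::= c\mid x\mid \lambda x.M\mid \mathbf{box}_{\vec x}(V_1,\dots,V_n;M)$. Simple evaluation contexts: $C ::= [\,]M \mid V[\,] \mid \mathbf{box}_{\vec x}(V_1,\dots,V_k,[\,],M_1,\dots,M_m;M)$. Evaluation contexts: $E ::= [\,]\mid C[E]$. Its one-step reduction $\to_v$ is the closure under term contexts of the following rules, where $y$ is a variable and bound variables introduced on the right are fresh: - $(\lambda x.x)M\to M$; - $(\lambda x.M)V\to M[x:=V]$; - $\lambda x.Vx\to V$ if $x\notin FV(V)$; - (lift) $C[(\lambda x.M)N]\to(\lambda x.C[M])N$; - (flat) $C[yM]\to(\lambda x.C[x])(yM)$ if $C$ is not of the form $V[\,]$; - $(\lambda x.E[yx])M\to E[yM]$ if $x\notin FV(E[y])$; - $\mathbf{box}_x(M;x)\to M$; - $\mathbf{box}_{\vec w,x,\vec z}(\vec W,\mathbf{box}_{\vec y}(\vec N;V),\vec P;M)\to\mathbf{box}_{\vec w,\vec y,\vec z}(\vec W,\vec N,\vec P;M[x:=V])$, with $\vec W$ values and $|\vec w|=|\vec W|$. $=_v$ is the reflexive, symmetric, transitive closure of $\to_v$. CPS transformation. $R$ is a fixed type constant and $k,y$ are fresh variables. Value transformation $\Phi$: - $\Phi(x)=x$, $\Phi(c)=c$;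 - $\Phi(\lambda x.M)=\lambda k.\lambda x.[\![M]\!]k$; - $\Phi(\mathbf{box}_{\vec x}(\vec U;V))=\mathbf{box}_{\vec x}(\Phi(\vec U);\Phi(V))$. Term transformation $[\![\cdot]\!]$: - $[\![x]\!]=\lambda k.kx$, $[\![c]\!]=\lambda k.kc$; - $[\![\lambda x.M]\!]=\lambda k.k\,\Phi(\lambda x.M)$; - $[\![MN]\!]=\lambda k.[\![M]\!](\lambda y.[\![N]\!](yk))$; - $[\![\mathbf{box}_{\vec x}(\vec M;V)]\!]=\lambda k.[\![\vec M]\!](\lambda\vec y.k\,\mathbf{box}_{\vec x}(\vec y;\Phi(V)))$. *)

theory Defs
  imports Main
begin

section \<open>Types, terms and typing\<close>

text \<open>
  \<open>'p\<close> is the type of type constants, \<open>'c\<close> the type of term constants.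
  Terms are represented up to \<open>\<alpha>\<close>-equivalence by de Bruijn indices.
  In \<open>Box ts Ns M\<close>, which stands for
  \<open>box\<^sub>x\<^sub>1\<^sub>,\<^sub>.\<^sub>.\<^sub>.\<^sub>,\<^sub>x\<^sub>n (N\<^sub>1,...,N\<^sub>n; M)\<close>, the list \<open>ts\<close> holds the type annotations of
  \<open>x\<^sub>1,...,x\<^sub>n\<close>, and in the body \<open>M\<close> the variable \<open>x\<^sub>1\<close> is index \<open>0\<close>, \<open>x\<^sub>2\<close> is index \<open>1\<close>, etc.
  The body has no other free variables (this is enforced by typing), so renaming and
  substitution only act on \<open>Ns\<close>.
\<close>

datatype 'p ty = TConst 'p | Imp "'p ty" "'p ty" (infixr "\<rightarrow>" 65) | Nec "'p ty"

datatype ('p, 'c) tm =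
    Con 'c
  | Var nat
  | Lam "'p ty" "('p, 'c) tm"
  | App "('p, 'c) tm" "('p, 'c) tm"
  | Box "'p ty list" "('p, 'c) tm list" "('p, 'c) tm"

text \<open>\<open>Sig\<close> gives each constant its fixed type.\<close>

inductive typing :: "('c \<Rightarrow> 'p ty) \<Rightarrow> 'p ty list \<Rightarrow> ('p, 'c) tm \<Rightarrow> 'p ty \<Rightarrow> bool"
  for Sig :: "'c \<Rightarrow> 'p ty" where
  Con: "typing Sig \<Gamma> (Con c) (Sig c)"
| Var: "i < length \<Gamma> \<Longrightarrow> typing Sig \<Gamma> (Var i) (\<Gamma> ! i)"
| Lam: "typing Sig (\<sigma> # \<Gamma>) M \<tau> \<Longrightarrow> typing Sig \<Gamma> (Lam \<sigma> M) (\<sigma> \<rightarrow> \<tau>)"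
| App: "typing Sig \<Gamma> M (\<sigma> \<rightarrow> \<tau>) \<Longrightarrow> typing Sig \<Gamma> N \<sigma> \<Longrightarrow> typing Sig \<Gamma> (App M N) \<tau>"
| Box: "list_all2 (\<lambda>N \<sigma>. typing Sig \<Gamma> N (Nec \<sigma>)) Ns ts \<Longrightarrow> typing Sig ts M \<tau>
        \<Longrightarrow> typing Sig \<Gamma> (Box ts Ns M) (Nec \<tau>)"

text \<open>The type of a well-typed term, as a function of the term and its context.\<close>

primrec codom :: "'p ty \<Rightarrow> 'p ty" where
  "codom (TConst p) = undefined"
| "codom (\<sigma> \<rightarrow> \<tau>) = \<tau>"
| "codom (Nec \<sigma>) = undefined"

primrec ty_of :: "('c \<Rightarrow> 'p ty) \<Rightarrow> 'p ty list \<Rightarrow> ('p, 'c) tm \<Rightarrow> 'p ty" where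
  "ty_of Sig \<Gamma> (Con c) = Sig c"
| "ty_of Sig \<Gamma> (Var i) = \<Gamma> ! i"
| "ty_of Sig \<Gamma> (Lam \<sigma> M) = \<sigma> \<rightarrow> ty_of Sig (\<sigma> # \<Gamma>) M"
| "ty_of Sig \<Gamma> (App M N) = codom (ty_of Sig \<Gamma> M)"
| "ty_of Sig \<Gamma> (Box ts Ns M) = Nec (ty_of Sig ts M)"

lemma ty_of_typing: "typing Sig \<Gamma> M \<tau> \<Longrightarrow> ty_of Sig \<Gamma> M = \<tau>"
  by (induction rule: typing.induct) simp_all


section \<open>Renaming and substitution\<close>

primrec up_ren :: "(nat \<Rightarrow> nat) \<Rightarrow> nat \<Rightarrow> nat" where
  "up_ren f 0 = 0"
| "up_ren f (Suc i) = Suc (f i)"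

primrec ren :: "(nat \<Rightarrow> nat) \<Rightarrow> ('p, 'c) tm \<Rightarrow> ('p, 'c) tm" where
  "ren f (Con c) = Con c"
| "ren f (Var i) = Var (f i)"
| "ren f (Lam \<sigma> M) = Lam \<sigma> (ren (up_ren f) M)"
| "ren f (App M N) = App (ren f M) (ren f N)"
| "ren f (Box ts Ns M) = Box ts (map (ren f) Ns) M"

abbreviation lift :: "('p, 'c) tm \<Rightarrow> ('p, 'c) tm" where
  "lift \<equiv> ren Suc"

primrec up_sub :: "(nat \<Rightarrow> ('p, 'c) tm) \<Rightarrow> nat \<Rightarrow> ('p, 'c) tm" where
  "up_sub s 0 = Var 0"
| "up_sub s (Suc i) = lift (s i)"

primrec sub :: "(nat \<Rightarrow> ('p, 'c) tm) \<Rightarrow> ('p, 'c) tm \<Rightarrow> ('p, 'c) tm" where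
  "sub s (Con c) = Con c"
| "sub s (Var i) = s i"
| "sub s (Lam \<sigma> M) = Lam \<sigma> (sub (up_sub s) M)"
| "sub s (App M N) = App (sub s M) (sub s N)"
| "sub s (Box ts Ns M) = Box ts (map (sub s) Ns) M"

text \<open>\<open>M[x:=N]\<close> where \<open>x\<close> is index \<open>0\<close>.\<close>

definition sub0 :: "('p, 'c) tm \<Rightarrow> ('p, 'c) tm \<Rightarrow> ('p, 'c) tm" where
  "sub0 N M = sub (case_nat N Var) M"

text \<open>
  The substitution \<open>M[x:=N]\<close> used when a nested box is flattened: \<open>M\<close> lives in the context
  \<open>w\<^sub>1,...,w\<^sub>n,x,z\<^sub>1,...\<close>, \<open>N\<close> in the context \<open>y\<^sub>1,...,y\<^sub>m\<close>, and the result in the context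
  \<open>w\<^sub>1,...,w\<^sub>n,y\<^sub>1,...,y\<^sub>m,z\<^sub>1,...\<close>.
\<close>

definition flat_sub :: "nat \<Rightarrow> nat \<Rightarrow> ('p, 'c) tm \<Rightarrow> ('p, 'c) tm \<Rightarrow> ('p, 'c) tm" where
  "flat_sub n m N M =
     sub (\<lambda>i. if i < n then Var i
              else if i = n then ren (\<lambda>j. n + j) N
              else Var (i - 1 + m)) M"


section \<open>Reduction and equality\<close>

inductive compat :: "(('p, 'c) tm \<Rightarrow> ('p, 'c) tm \<Rightarrow> bool) \<Rightarrow> ('p, 'c) tm \<Rightarrow> ('p, 'c) tm \<Rightarrow> bool"
  for r :: "('p, 'c) tm \<Rightarrow> ('p, 'c) tm \<Rightarrow> bool" where
  root: "r M M' \<Longrightarrow> compat r M M'"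
| lam: "compat r M M' \<Longrightarrow> compat r (Lam \<sigma> M) (Lam \<sigma> M')"
| appL: "compat r M M' \<Longrightarrow> compat r (App M N) (App M' N)"
| appR: "compat r N N' \<Longrightarrow> compat r (App M N) (App M N')"
| boxArg: "compat r N N' \<Longrightarrow> compat r (Box ts (Ps @ N # Qs) M) (Box ts (Ps @ N' # Qs) M)"
| boxBody: "compat r M M' \<Longrightarrow> compat r (Box ts Ns M) (Box ts Ns M')"

subsection \<open>Call-by-name\<close>

inductive cbn_root :: "('p, 'c) tm \<Rightarrow> ('p, 'c) tm \<Rightarrow> bool" where
  beta: "cbn_root (App (Lam \<sigma> M) N) (sub0 N M)"
| eta: "cbn_root (Lam \<sigma> (App (lift M) (Var 0))) M"
| box_id: "cbn_root (Box [\<sigma>] [M] (Var 0)) M"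
| box_flat: "length ws = length Ps \<Longrightarrow> length ys = length Ls \<Longrightarrow>
    cbn_root (Box (ws @ \<sigma> # zs) (Ps @ Box ys Ls N # Qs) M)
             (Box (ws @ ys @ zs) (Ps @ Ls @ Qs) (flat_sub (length ws) (length ys) N M))"

definition cbn_red :: "('p, 'c) tm \<Rightarrow> ('p, 'c) tm \<Rightarrow> bool" where
  "cbn_red = compat cbn_root"

text \<open>
  Equality is the equivalence closure of one-step reduction on the set of terms of type \<open>\<tau>\<close>
  in context \<open>\<Gamma>\<close>; in particular all intermediate terms are well-typed.
\<close>

definition cbn_eq ::
    "('c \<Rightarrow> 'p ty) \<Rightarrow> 'p ty list \<Rightarrow> 'p ty \<Rightarrow> ('p, 'c) tm \<Rightarrow> ('p, 'c) tm \<Rightarrow> bool" where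
  "cbn_eq Sig \<Gamma> \<tau> =
     equivclp (\<lambda>M N. typing Sig \<Gamma> M \<tau> \<and> typing Sig \<Gamma> N \<tau> \<and> cbn_red M N)"

subsection \<open>Call-by-value\<close>

fun is_val :: "('p, 'c) tm \<Rightarrow> bool" where
  "is_val (Con c) = True"
| "is_val (Var i) = True"
| "is_val (Lam \<sigma> M) = True"
| "is_val (App M N) = False"
| "is_val (Box ts Ns M) = (\<forall>N \<in> set Ns. is_val N)"

fun restricted :: "('p, 'c) tm \<Rightarrow> bool" where
  "restricted (Con c) = True"
| "restricted (Var i) = True"
| "restricted (Lam \<sigma> M) = restricted M"
| "restricted (App M N) = (restricted M \<and> restricted N)"
| "restricted (Box ts Ns M) = ((\<forall>N \<in> set Ns. restricted N) \<and> restricted M \<and> is_val M)"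

definition cbv_typing :: "('c \<Rightarrow> 'p ty) \<Rightarrow> 'p ty list \<Rightarrow> ('p, 'c) tm \<Rightarrow> 'p ty \<Rightarrow> bool" where
  "cbv_typing Sig \<Gamma> M \<tau> \<longleftrightarrow> typing Sig \<Gamma> M \<tau> \<and> restricted M"

text \<open>
  Simple evaluation contexts \<open>[ ] M\<close>, \<open>V [ ]\<close> and \<open>box\<^sub>x (V\<^sub>1,...,V\<^sub>k,[ ],M\<^sub>1,...,M\<^sub>m; M)\<close>.
  An evaluation context \<open>C\<^sub>1[C\<^sub>2[...[ ]...]]\<close> is the list \<open>[C\<^sub>1,C\<^sub>2,...]\<close>.
  Holes are never under a binder of the context.
\<close>

datatype ('p, 'c) sctx =
    CFun "('p, 'c) tm"
  | CArg "('p, 'c) tm"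
  | CBox "'p ty list" "('p, 'c) tm list" "('p, 'c) tm list" "('p, 'c) tm"

type_synonym ('p, 'c) ectx = "('p, 'c) sctx list"

primrec sctx_ok :: "('p, 'c) sctx \<Rightarrow> bool" where
  "sctx_ok (CFun M) = True"
| "sctx_ok (CArg V) = is_val V"
| "sctx_ok (CBox ts Vs Ms M) = (\<forall>V \<in> set Vs. is_val V)"

primrec plug :: "('p, 'c) sctx \<Rightarrow> ('p, 'c) tm \<Rightarrow> ('p, 'c) tm" where
  "plug (CFun M) H = App H M"
| "plug (CArg V) H = App V H"
| "plug (CBox ts Vs Ms M) H = Box ts (Vs @ H # Ms) M"

primrec lift_sctx :: "('p, 'c) sctx \<Rightarrow> ('p, 'c) sctx" where
  "lift_sctx (CFun M) = CFun (lift M)"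
| "lift_sctx (CArg V) = CArg (lift V)"
| "lift_sctx (CBox ts Vs Ms M) = CBox ts (map lift Vs) (map lift Ms) M"

definition plugs :: "('p, 'c) ectx \<Rightarrow> ('p, 'c) tm \<Rightarrow> ('p, 'c) tm" where
  "plugs E H = foldr plug E H"

text \<open>
  Freshness side conditions are expressed by \<open>lift\<close>. In \<open>flat\<close> the annotation \<open>\<sigma>\<close> of the new
  binder is arbitrary here; the restriction to well-typed terms in \<open>cbv_eq\<close> forces it to be the
  type of \<open>y M\<close>.
\<close>

inductive cbv_root :: "('p, 'c) tm \<Rightarrow> ('p, 'c) tm \<Rightarrow> bool" where
  ident: "cbv_root (App (Lam \<sigma> (Var 0)) M) M"
| beta_v: "is_val V \<Longrightarrow> cbv_root (App (Lam \<sigma> M) V) (sub0 V M)"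
| eta_v: "is_val V \<Longrightarrow> cbv_root (Lam \<sigma> (App (lift V) (Var 0))) V"
| lift: "sctx_ok C \<Longrightarrow>
    cbv_root (plug C (App (Lam \<sigma> M) N)) (App (Lam \<sigma> (plug (lift_sctx C) M)) N)"
| flat: "sctx_ok C \<Longrightarrow> (\<forall>V. C \<noteq> CArg V) \<Longrightarrow>
    cbv_root (plug C (App (Var y) M))
             (App (Lam \<sigma> (plug (lift_sctx C) (Var 0))) (App (Var y) M))"
| eval: "(\<forall>C \<in> set E. sctx_ok C) \<Longrightarrow>
    cbv_root (App (Lam \<sigma> (plugs (map lift_sctx E) (App (Var (Suc y)) (Var 0)))) M)
             (plugs E (App (Var y) M))"
| box_id_v: "cbv_root (Box [\<sigma>] [M] (Var 0)) M"
| box_flat_v: "length ws = length Ws \<Longrightarrow> length ys = length Ns \<Longrightarrow> (\<forall>W \<in> set Ws. is_val W) \<Longrightarrow>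
    is_val V \<Longrightarrow>
    cbv_root (Box (ws @ \<sigma> # zs) (Ws @ Box ys Ns V # Ps) M)
             (Box (ws @ ys @ zs) (Ws @ Ns @ Ps) (flat_sub (length ws) (length ys) V M))"

definition cbv_red :: "('p, 'c) tm \<Rightarrow> ('p, 'c) tm \<Rightarrow> bool" where
  "cbv_red = compat cbv_root"

definition cbv_eq ::
    "('c \<Rightarrow> 'p ty) \<Rightarrow> 'p ty list \<Rightarrow> 'p ty \<Rightarrow> ('p, 'c) tm \<Rightarrow> ('p, 'c) tm \<Rightarrow> bool" where
  "cbv_eq Sig \<Gamma> \<tau> =
     equivclp (\<lambda>M N. cbv_typing Sig \<Gamma> M \<tau> \<and> cbv_typing Sig \<Gamma> N \<tau> \<and> cbv_red M N)"


section \<open>CPS transformation\<close>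

text \<open>
  A value of type \<open>\<sigma>\<close> in context \<open>\<Gamma>\<close> is sent to a term of type \<open>cps_ty R \<sigma>\<close> in context
  \<open>map (cps_ty R) \<Gamma>\<close>, where a constant \<open>c\<close> has type \<open>cps_ty R (Sig c)\<close>; a term of type \<open>\<sigma>\<close>
  is sent to a term of type \<open>cps_cty R \<sigma>\<close>.
\<close>

primrec cps_ty :: "'p \<Rightarrow> 'p ty \<Rightarrow> 'p ty" where
  "cps_ty R (TConst p) = TConst p"
| "cps_ty R (\<sigma> \<rightarrow> \<tau>) = (cps_ty R \<tau> \<rightarrow> TConst R) \<rightarrow> (cps_ty R \<sigma> \<rightarrow> TConst R)"
| "cps_ty R (Nec \<sigma>) = Nec (cps_ty R \<sigma>)"

abbreviation cont_ty :: "'p \<Rightarrow> 'p ty \<Rightarrow> 'p ty" where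
  "cont_ty R \<sigma> \<equiv> cps_ty R \<sigma> \<rightarrow> TConst R"

definition cps_cty :: "'p \<Rightarrow> 'p ty \<Rightarrow> 'p ty" where
  "cps_cty R \<sigma> = cont_ty R \<sigma> \<rightarrow> TConst R"

text \<open>
  \<open>cps_seq d [(\<sigma>\<^sub>1,N\<^sub>1),...,(\<sigma>\<^sub>n,N\<^sub>n)] B\<close> is \<open>N\<^sub>1 (\<lambda>y\<^sub>1. ... N\<^sub>n (\<lambda>y\<^sub>n. B) ...)\<close>, where \<open>d\<close> is the number
  of binders that lie between the context of the \<open>N\<^sub>i\<close> and the result; \<open>B\<close> is already
  in the inner scope, where \<open>y\<^sub>i\<close> has index \<open>n - i\<close>.
\<close>

primrec cps_seq :: "nat \<Rightarrow> ('p ty \<times> ('p, 'c) tm) list \<Rightarrow> ('p, 'c) tm \<Rightarrow> ('p, 'c) tm" where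
  "cps_seq d [] B = B"
| "cps_seq d (p # ps) B =
     App (ren (\<lambda>i. i + d) (snd p)) (Lam (fst p) (cps_seq (Suc d) ps B))"

text \<open>
  \<open>cps_val\<close> is \<open>\<Phi>\<close> (it is only meaningful on values) and \<open>cps\<close> is the transformation of terms.
  In \<open>\<Phi>(\<lambda>x.M) = \<lambda>k.\<lambda>x.[M]k\<close> the renaming \<open>up_ren Suc\<close> keeps \<open>x\<close> as index \<open>0\<close> and makes
  room for \<open>k\<close> at index \<open>1\<close>.
\<close>

function (sequential)
  cps_val :: "'p \<Rightarrow> ('c \<Rightarrow> 'p ty) \<Rightarrow> 'p ty list \<Rightarrow> ('p, 'c) tm \<Rightarrow> ('p, 'c) tm" and
  cps :: "'p \<Rightarrow> ('c \<Rightarrow> 'p ty) \<Rightarrow> 'p ty list \<Rightarrow> ('p, 'c) tm \<Rightarrow> ('p, 'c) tm" where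
  "cps_val R Sig \<Gamma> (Con c) = Con c"
| "cps_val R Sig \<Gamma> (Var i) = Var i"
| "cps_val R Sig \<Gamma> (Lam \<sigma> M) =
     Lam (cont_ty R (ty_of Sig (\<sigma> # \<Gamma>) M))
       (Lam (cps_ty R \<sigma>) (App (ren (up_ren Suc) (cps R Sig (\<sigma> # \<Gamma>) M)) (Var 1)))"
| "cps_val R Sig \<Gamma> (Box ts Us V) =
     Box (map (cps_ty R) ts) (map (cps_val R Sig \<Gamma>) Us) (cps_val R Sig ts V)"
| "cps_val R Sig \<Gamma> (App M N) = undefined"
| "cps R Sig \<Gamma> (Con c) = Lam (cont_ty R (Sig c)) (App (Var 0) (Con c))"
| "cps R Sig \<Gamma> (Var i) = Lam (cont_ty R (\<Gamma> ! i)) (App (Var 0) (Var (Suc i)))"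
| "cps R Sig \<Gamma> (Lam \<sigma> M) =
     Lam (cont_ty R (ty_of Sig \<Gamma> (Lam \<sigma> M))) (App (Var 0) (lift (cps_val R Sig \<Gamma> (Lam \<sigma> M))))"
| "cps R Sig \<Gamma> (App M N) =
     Lam (cont_ty R (ty_of Sig \<Gamma> (App M N)))
       (App (lift (cps R Sig \<Gamma> M))
         (Lam (cps_ty R (ty_of Sig \<Gamma> M))
           (App (lift (lift (cps R Sig \<Gamma> N))) (App (Var 0) (Var 1)))))"
| "cps R Sig \<Gamma> (Box ts Ms V) =
     (let n = length Ms in
      Lam (cont_ty R (ty_of Sig \<Gamma> (Box ts Ms V)))
        (cps_seq 1 (zip (map (\<lambda>\<sigma>. cps_ty R (Nec \<sigma>)) ts) (map (cps R Sig \<Gamma>) Ms))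
          (App (Var n)
            (Box (map (cps_ty R) ts) (map Var (rev [0..<n])) (cps_val R Sig ts V)))))"
  by pat_completeness auto
termination
  by (relation "measure (\<lambda>x. case x of Inl (R, Sig, \<Gamma>, M) \<Rightarrow> 2 * size M
                                      | Inr (R, Sig, \<Gamma>, M) \<Rightarrow> 2 * size M + 1)")
     (auto dest!: size_list_estimation'[where f = size, OF _ order_refl] simp: less_Suc_eq_le)

end

theory Submission
  imports Defs
begin

text \<open>
  Soundness is a computation: the CPS transforms of the two sides of a call-by-value rule have a
  common reduct. For completeness, the CPS transforms and all their reducts lie in a grammar of
  values, continuations, answers and terms in which every continuation variable is used exactly
  once. Such a term can be decoded: a continuation becomes a stack of values applied one after the
  other, and every call-by-name reduction step becomes a call-by-value equation, mainly because
  lifting and \<open>(\<lambda>x. x) M = M\<close> make \<open>(\<lambda>x. E[x]) M = E[M]\<close> derivable for every \<open>E\<close> built from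
  contexts \<open>V [ ]\<close>. Since an equational proof in the target may leave the grammar, one also needs confluence of
  the typed call-by-name calculus.
\<close>

section \<open>Renaming, substitution and typing\<close>

text \<open>Confluence is a matter of typed terms. With annotated binders,
  \<open>Lam \<sigma> (App (lift (Lam \<sigma>' B)) (Var 0))\<close> goes to
  \<open>Lam \<sigma> B\<close> by beta and to \<open>Lam \<sigma>' B\<close> by eta, and nothing
  but typing identifies \<sigma> with \<sigma>'. Flattening against the identity rule for boxes
  raises the same conflict. Beta and flattening on one side, eta and the identity rule on the other,
  are therefore kept apart: the first pair gets a triangle property that needs no types, and types
  enter only where the two pairs meet.

  On the source side the obstacle is that the body of a box must stay a value. Equality of two
  values, as a relation between terms, cannot be used inside a box, since a chain of equations may
  pass through terms that are not values. Hence both directions carry a value version beside the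
  term version: \<open>cps_val\<close> beside \<open>cps\<close>, and equality through values beside
  plain equality.

  The decoding is not a left inverse of the CPS transformation. Decoding a transform gives back the
  source term only up to equality, so what matters is that the decoding of a given target term is
  unique.\<close>

lemma up_ren_comp: "up_ren f \<circ> up_ren g = up_ren (f \<circ> g)"
proof
  fix i show "(up_ren f \<circ> up_ren g) i = up_ren (f \<circ> g) i" by (cases i) auto
qed

lemma up_ren_id [simp]: "up_ren (\<lambda>i. i) = (\<lambda>i. i)"
proof
  fix i show "up_ren (\<lambda>i. i) i = i" by (cases i) auto
qed

lemma ren_ren: "ren f (ren g M) = ren (f \<circ> g) M"
  by (induction M arbitrary: f g) (auto simp: up_ren_comp)

lemma ren_id [simp]: "ren (\<lambda>i. i) M = M"
  by (induction M) (auto simp: map_idI)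

lemma up_sub_up_ren: "up_sub s \<circ> up_ren f = up_sub (s \<circ> f)"
proof
  fix i show "(up_sub s \<circ> up_ren f) i = up_sub (s \<circ> f) i" by (cases i) auto
qed

lemma sub_ren: "sub s (ren f M) = sub (s \<circ> f) M"
  by (induction M arbitrary: s f) (auto simp: up_sub_up_ren)

lemma ren_up_sub: "ren (up_ren f) \<circ> up_sub s = up_sub (ren f \<circ> s)"
proof
  fix i show "(ren (up_ren f) \<circ> up_sub s) i = up_sub (ren f \<circ> s) i"
    by (cases i) (auto simp: ren_ren comp_def)
qed

lemma ren_sub: "ren f (sub s M) = sub (ren f \<circ> s) M"
  by (induction M arbitrary: s f) (auto simp: ren_up_sub)

lemma up_sub_Var [simp]: "up_sub Var = Var"
proof
  fix i show "up_sub Var i = Var i" by (cases i) auto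
qed

lemma sub_Var [simp]: "sub Var M = M"
  by (induction M) (auto simp: map_idI)

lemma up_sub_comp: "sub (up_sub t) \<circ> up_sub s = up_sub (sub t \<circ> s)"
proof
  fix i show "(sub (up_sub t) \<circ> up_sub s) i = up_sub (sub t \<circ> s) i"
    by (cases i) (auto simp: sub_ren ren_sub comp_def)
qed

lemma sub_sub: "sub t (sub s M) = sub (sub t \<circ> s) M"
  by (induction M arbitrary: s t) (auto simp: up_sub_comp)

text \<open>Lets facts about substitution, such as preservation of reduction, serve for renamings
  too.\<close>

lemma ren_as_sub: "ren f M = sub (Var \<circ> f) M"
  using sub_ren[of Var f M] by simp

lemma sub_up_lift: "sub (up_sub s) (lift M) = lift (sub s M)"
  by (simp add: sub_ren ren_sub comp_def)

lemma ren_up_lift: "ren (up_ren f) (lift M) = lift (ren f M)"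
  by (simp add: ren_ren comp_def)

lemma sub0_lift [simp]: "sub0 N (lift M) = M"
  by (simp add: sub0_def sub_ren comp_def)

lemma sub_sub0: "sub s (sub0 N M) = sub0 (sub s N) (sub (up_sub s) M)"
proof -
  have "sub s \<circ> case_nat N Var = sub (case_nat (sub s N) Var) \<circ> up_sub s"
  proof
    fix i show "(sub s \<circ> case_nat N Var) i = (sub (case_nat (sub s N) Var) \<circ> up_sub s) i"
      by (cases i) (auto simp: sub_ren comp_def)
  qed
  then show ?thesis by (simp add: sub0_def sub_sub)
qed

lemma ren_sub0: "ren f (sub0 N M) = sub0 (ren f N) (ren (up_ren f) M)"
proof -
  have "ren f \<circ> case_nat N Var = case_nat (ren f N) Var \<circ> up_ren f"
  proof
    fix i show "(ren f \<circ> case_nat N Var) i = (case_nat (ren f N) Var \<circ> up_ren f) i"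
      by (cases i) auto
  qed
  then show ?thesis by (simp add: sub0_def ren_sub sub_ren)
qed

section \<open>Injectivity of renaming, and well-scoped terms\<close>

lemma inj_up_ren: "inj f \<Longrightarrow> inj (up_ren f)"
proof (rule injI)
  fix i j assume "inj f" "up_ren f i = up_ren f j"
  then show "i = j" by (cases i; cases j) (auto dest: injD)
qed

lemma ren_inj: "inj f \<Longrightarrow> ren f M = ren f N \<Longrightarrow> M = N"
proof (induction M arbitrary: N f)
  case (Con c) then show ?case by (cases N) auto
next
  case (Var i) then show ?case by (cases N) (auto dest: injD)
next
  case (Lam \<sigma> M) then show ?case by (cases N) (auto intro: inj_up_ren)
next
  case (App M1 M2) then show ?case by (cases N) auto
next
  case (Box ts Ns M)
  from Box.prems obtain Ns' where N: "N = Box ts Ns' M" and eq: "map (ren f) Ns = map (ren f) Ns'"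
    by (cases N) auto
  have "Ns = Ns'"
  proof (rule nth_equalityI)
    show l: "length Ns = length Ns'" using eq by (rule map_eq_imp_length_eq)
    fix i assume i: "i < length Ns"
    with l have "ren f (Ns ! i) = ren f (Ns' ! i)" using arg_cong[OF eq, of "\<lambda>xs. xs ! i"] by simp
    with i Box show "Ns ! i = Ns' ! i" by simp
  qed
  with N show ?case by simp
qed

lemma lift_inj: "lift M = lift N \<Longrightarrow> M = N"
  by (rule ren_inj[of Suc]) auto

text \<open>The invariant under which rewriting arguments work on raw terms. Equal numbers of
  annotations and arguments allow a box to be read as a list of pairs, and the bound on the body
  makes it independent of everything outside the box.\<close>

fun scoped :: "nat \<Rightarrow> ('p, 'c) tm \<Rightarrow> bool" where
  "scoped n (Con c) = True"
| "scoped n (Var i) = (i < n)"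
| "scoped n (Lam \<sigma> M) = scoped (Suc n) M"
| "scoped n (App M N) = (scoped n M \<and> scoped n N)"
| "scoped n (Box ts Ns M) =
     (length ts = length Ns \<and> (\<forall>N \<in> set Ns. scoped n N) \<and> scoped (length ts) M)"

lemma sub_cong_scoped: "scoped n M \<Longrightarrow> (\<And>i. i < n \<Longrightarrow> s i = t i) \<Longrightarrow> sub s M = sub t M"
proof (induction M arbitrary: n s t)
  case (Lam \<sigma> M)
  have "up_sub s i = up_sub t i" if "i < Suc n" for i
    using that Lam.prems(2) by (cases i) auto
  then have "sub (up_sub s) M = sub (up_sub t) M"
    by (rule Lam.IH[rotated]) (use Lam.prems(1) in auto)
  then show ?case by simp
next
  case (App M N)
  have "sub s M = sub t M" by (rule App.IH(1)[OF _ App.prems(2)]) (use App.prems(1) in auto)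
  moreover have "sub s N = sub t N" by (rule App.IH(2)[OF _ App.prems(2)]) (use App.prems(1) in auto)
  ultimately show ?case by simp
next
  case (Box ts Ns M)
  have "sub s N = sub t N" if "N \<in> set Ns" for N
    by (rule Box.IH(1)[OF that _ Box.prems(2)]) (use Box.prems(1) that in auto)
  then show ?case by simp
qed simp_all

lemma typing_scoped: "typing Sig \<Gamma> M \<tau> \<Longrightarrow> scoped (length \<Gamma>) M"
  by (induction rule: typing.induct)
    (auto simp: list_all2_conv_all_nth in_set_conv_nth)

section \<open>Inversion of typing, and typing under renaming and substitution\<close>

lemma typing_simps [simp]:
  "typing Sig \<Gamma> (Con c) \<tau> \<longleftrightarrow> \<tau> = Sig c"
  "typing Sig \<Gamma> (Var i) \<tau> \<longleftrightarrow> i < length \<Gamma> \<and> \<tau> = \<Gamma> ! i"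
  "typing Sig \<Gamma> (Lam \<sigma> M) \<tau> \<longleftrightarrow> (\<exists>\<rho>. \<tau> = \<sigma> \<rightarrow> \<rho> \<and> typing Sig (\<sigma> # \<Gamma>) M \<rho>)"
  "typing Sig \<Gamma> (App M N) \<tau> \<longleftrightarrow> (\<exists>\<sigma>. typing Sig \<Gamma> M (\<sigma> \<rightarrow> \<tau>) \<and> typing Sig \<Gamma> N \<sigma>)"
  "typing Sig \<Gamma> (Box ts Ns M) \<tau> \<longleftrightarrow>
     (\<exists>\<rho>. \<tau> = Nec \<rho> \<and> list_all2 (\<lambda>N \<sigma>. typing Sig \<Gamma> N (Nec \<sigma>)) Ns ts \<and> typing Sig ts M \<rho>)"
  by (simp_all add: typing.simps[of Sig \<Gamma> "Con c"] typing.simps[of Sig \<Gamma> "Var i"]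
      typing.simps[of Sig \<Gamma> "Lam \<sigma> M"] typing.simps[of Sig \<Gamma> "App M N"]
      typing.simps[of Sig \<Gamma> "Box ts Ns M"] conj_commute)

lemma typing_unique: "typing Sig \<Gamma> M \<tau> \<Longrightarrow> typing Sig \<Gamma> M \<tau>' \<Longrightarrow> \<tau> = \<tau>'"
  by (metis ty_of_typing)

lemma typing_ren:
  "typing Sig \<Gamma> M \<tau> \<Longrightarrow> (\<And>i. i < length \<Gamma> \<Longrightarrow> f i < length \<Delta> \<and> \<Delta> ! f i = \<Gamma> ! i) \<Longrightarrow>
   typing Sig \<Delta> (ren f M) \<tau>"
proof (induction arbitrary: f \<Delta> rule: typing.induct)
  case (Lam \<sigma> \<Gamma> M \<tau>)
  have "up_ren f i < length (\<sigma> # \<Delta>) \<and> (\<sigma> # \<Delta>) ! up_ren f i = (\<sigma> # \<Gamma>) ! i"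
    if "i < length (\<sigma> # \<Gamma>)" for i
    using that Lam.prems by (cases i) auto
  with Lam.IH show ?case by auto
next
  case (App \<Gamma> M \<sigma> \<tau> N)
  then show ?case by (simp, blast)
next
  case (Box \<Gamma> Ns ts M \<tau>)
  then show ?case by (auto simp: list_all2_conv_all_nth)
qed auto

lemma typing_lift: "typing Sig \<Gamma> M \<tau> \<Longrightarrow> typing Sig (\<sigma> # \<Gamma>) (lift M) \<tau>"
  by (rule typing_ren) auto

text \<open>Strengthening: a renamed term mentions no index outside the range of the renaming. Its
  instance for \<open>lift\<close> makes eta contraction preserve types.\<close>

lemma typing_ren_inv:
  "typing Sig \<Delta> (ren f M) \<tau> \<Longrightarrow>
   (\<And>i. f i < length \<Delta> \<Longrightarrow> i < length \<Gamma> \<and> \<Delta> ! f i = \<Gamma> ! i) \<Longrightarrow> typing Sig \<Gamma> M \<tau>"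
proof (induction M arbitrary: f \<Gamma> \<Delta> \<tau>)
  case (Lam \<sigma> M)
  have *: "i < length (\<sigma> # \<Gamma>) \<and> (\<sigma> # \<Delta>) ! up_ren f i = (\<sigma> # \<Gamma>) ! i"
    if "up_ren f i < length (\<sigma> # \<Delta>)" for i
    using that Lam.prems(2) by (cases i) auto
  from Lam.prems(1) obtain \<rho> where "\<tau> = \<sigma> \<rightarrow> \<rho>" "typing Sig (\<sigma> # \<Delta>) (ren (up_ren f) M) \<rho>" by auto
  with Lam.IH[of "\<sigma> # \<Delta>" "up_ren f" \<rho> "\<sigma> # \<Gamma>"] * show ?case by simp
next
  case (App M N)
  from App.prems(1) obtain \<sigma> where "typing Sig \<Delta> (ren f M) (\<sigma> \<rightarrow> \<tau>)" "typing Sig \<Delta> (ren f N) \<sigma>" by auto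
  with App.IH App.prems(2) show ?case by simp blast
next
  case (Box ts Ns M)
  have "typing Sig \<Gamma> N (Nec \<sigma>)" if "N \<in> set Ns" "typing Sig \<Delta> (ren f N) (Nec \<sigma>)" for N \<sigma>
    using Box.IH(1)[OF that Box.prems(2)] .
  with Box.prems(1) show ?case by (auto simp: list_all2_conv_all_nth)
qed auto

lemma typing_lift_inv: "typing Sig (\<sigma> # \<Gamma>) (lift M) \<tau> \<Longrightarrow> typing Sig \<Gamma> M \<tau>"
  by (erule typing_ren_inv) auto

lemma typing_lift_iff [simp]: "typing Sig (\<sigma> # \<Gamma>) (lift M) \<tau> \<longleftrightarrow> typing Sig \<Gamma> M \<tau>"
  using typing_lift typing_lift_inv by blast

lemma typing_sub:
  "typing Sig \<Gamma> M \<tau> \<Longrightarrow> (\<And>i. i < length \<Gamma> \<Longrightarrow> typing Sig \<Delta> (s i) (\<Gamma> ! i)) \<Longrightarrow>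
   typing Sig \<Delta> (sub s M) \<tau>"
proof (induction arbitrary: s \<Delta> rule: typing.induct)
  case (Lam \<sigma> \<Gamma> M \<tau>)
  have "typing Sig (\<sigma> # \<Delta>) (up_sub s i) ((\<sigma> # \<Gamma>) ! i)" if "i < length (\<sigma> # \<Gamma>)" for i
    using that Lam.prems by (cases i) auto
  with Lam.IH show ?case by auto
next
  case (App \<Gamma> M \<sigma> \<tau> N)
  then show ?case by simp blast
next
  case (Box \<Gamma> Ns ts M \<tau>)
  then show ?case by (auto simp: list_all2_conv_all_nth)
qed auto

lemma typing_sub0:
  "typing Sig (\<sigma> # \<Gamma>) M \<tau> \<Longrightarrow> typing Sig \<Gamma> N \<sigma> \<Longrightarrow> typing Sig \<Gamma> (sub0 N M) \<tau>"
  unfolding sub0_def by (rule typing_sub) (auto split: nat.split simp: nth_Cons')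

lemma typing_flat_sub:
  assumes "typing Sig (ws @ \<sigma> # zs) M \<tau>" "typing Sig ys N \<sigma>"
  shows "typing Sig (ws @ ys @ zs) (flat_sub (length ws) (length ys) N M) \<tau>"
  unfolding flat_sub_def
proof (rule typing_sub[OF assms(1)])
  fix i assume i: "i < length (ws @ \<sigma> # zs)"
  have "typing Sig (ws @ ys @ zs) (ren (\<lambda>j. length ws + j) N) \<sigma>"
    by (rule typing_ren[OF assms(2)]) (auto simp: nth_append)
  with i show "typing Sig (ws @ ys @ zs)
      (if i < length ws then Var i
       else if i = length ws then ren (\<lambda>j. length ws + j) N
       else Var (i - 1 + length ys)) ((ws @ \<sigma> # zs) ! i)"
    by (auto simp: nth_append nth_Cons')
qed


section \<open>Subject reduction of the call-by-name calculus\<close>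

lemma typing_cbn_root: "cbn_root M N \<Longrightarrow> typing Sig \<Gamma> M \<tau> \<Longrightarrow> typing Sig \<Gamma> N \<tau>"
proof (induction rule: cbn_root.induct)
  case (beta \<sigma> M N) then show ?case by (auto intro: typing_sub0)
next
  case (box_flat ws Ps ys Ls \<sigma> zs N Qs M)
  let ?P = "list_all2 (\<lambda>N \<sigma>. typing Sig \<Gamma> N (Nec \<sigma>))"
  from box_flat.prems obtain \<rho> where \<tau>: "\<tau> = Nec \<rho>" and M: "typing Sig (ws @ \<sigma> # zs) M \<rho>"
    and l: "?P (Ps @ Box ys Ls N # Qs) (ws @ \<sigma> # zs)" by auto
  from l box_flat.hyps(1) have ls: "?P Ps ws" "typing Sig \<Gamma> (Box ys Ls N) (Nec \<sigma>)" "?P Qs zs"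
    by (simp_all add: list_all2_append)
  then have "?P Ls ys" "typing Sig ys N \<sigma>" by auto
  with ls have "?P (Ps @ Ls @ Qs) (ws @ ys @ zs)" by (simp add: list_all2_appendI)
  with \<tau> typing_flat_sub[OF M \<open>typing Sig ys N \<sigma>\<close>] show ?case by simp
qed (auto simp: list_all2_Cons1)

lemma typing_cbn_red: "cbn_red M N \<Longrightarrow> typing Sig \<Gamma> M \<tau> \<Longrightarrow> typing Sig \<Gamma> N \<tau>"
  unfolding cbn_red_def
proof (induction arbitrary: \<Gamma> \<tau> rule: compat.induct)
  case (root M M') then show ?case by (rule typing_cbn_root)
next
  case (boxArg N N' ts Ps Qs M)
  from boxArg.prems obtain \<rho> where \<tau>: "\<tau> = Nec \<rho>" "typing Sig ts M \<rho>"
    and l: "list_all2 (\<lambda>N \<sigma>. typing Sig \<Gamma> N (Nec \<sigma>)) (Ps @ N # Qs) ts" by auto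
  from l obtain ts1 \<sigma> ts2 where ts: "ts = ts1 @ \<sigma> # ts2"
    and ls: "list_all2 (\<lambda>N \<sigma>. typing Sig \<Gamma> N (Nec \<sigma>)) Ps ts1" "typing Sig \<Gamma> N (Nec \<sigma>)"
      "list_all2 (\<lambda>N \<sigma>. typing Sig \<Gamma> N (Nec \<sigma>)) Qs ts2"
    by (auto simp: list_all2_append1 list_all2_Cons1)
  have "typing Sig \<Gamma> N' (Nec \<sigma>)" using boxArg.IH ls(2) .
  with ls have "list_all2 (\<lambda>N \<sigma>. typing Sig \<Gamma> N (Nec \<sigma>)) (Ps @ N' # Qs) ts"
    unfolding ts by (simp add: list_all2_appendI)
  with \<tau> show ?case by simp
next
  case (appL M M' N)
  then show ?case by simp blast
next
  case (appR N N' M)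
  then show ?case by simp blast
next
  case (lam M M' \<sigma>)
  then show ?case by simp blast
next
  case (boxBody M M' ts Ns)
  then show ?case by simp blast
qed

section \<open>Compatible closure\<close>

lemma rtranclp_map: "r\<^sup>*\<^sup>* x y \<Longrightarrow> (\<And>x y. r x y \<Longrightarrow> s (f x) (f y)) \<Longrightarrow> s\<^sup>*\<^sup>* (f x) (f y)"
  by (induction rule: rtranclp_induct) (auto intro: rtranclp.rtrancl_into_rtrancl)

lemma compat_rtranclp_Lam: "(compat r)\<^sup>*\<^sup>* M M' \<Longrightarrow> (compat r)\<^sup>*\<^sup>* (Lam \<sigma> M) (Lam \<sigma> M')"
  by (erule rtranclp_map) (rule compat.lam)

lemma compat_rtranclp_App:
  "(compat r)\<^sup>*\<^sup>* M M' \<Longrightarrow> (compat r)\<^sup>*\<^sup>* N N' \<Longrightarrow> (compat r)\<^sup>*\<^sup>* (App M N) (App M' N')"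
  by (rule rtranclp_trans[where y = "App M' N"])
    (erule rtranclp_map, erule compat.appL compat.appR)+

lemma compat_rtranclp_boxBody: "(compat r)\<^sup>*\<^sup>* M M' \<Longrightarrow> (compat r)\<^sup>*\<^sup>* (Box ts Ns M) (Box ts Ns M')"
  by (erule rtranclp_map) (rule compat.boxBody)

text \<open>The prefix \<open>Ps\<close> is generalised because each induction step moves one
  rewritten argument into it.\<close>

lemma compat_rtranclp_boxArgs:
  "list_all2 (compat r)\<^sup>*\<^sup>* Ns Ns' \<Longrightarrow> (compat r)\<^sup>*\<^sup>* (Box ts (Ps @ Ns) M) (Box ts (Ps @ Ns') M)"
proof (induction arbitrary: Ps rule: list_all2_induct)
  case (Cons N Ns N' Ns')
  have "(compat r)\<^sup>*\<^sup>* (Box ts (Ps @ N # Ns) M) (Box ts (Ps @ N' # Ns) M)"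
    using Cons(1) by (rule rtranclp_map[where f = "\<lambda>N. Box ts (Ps @ N # Ns) M"]) (rule compat.boxArg)
  also have "(compat r)\<^sup>*\<^sup>* (Box ts (Ps @ N' # Ns) M) (Box ts (Ps @ N' # Ns') M)"
    using Cons.IH[of "Ps @ [N']"] by simp
  finally show ?case .
qed simp

lemma compat_rtranclp_Box:
  "list_all2 (compat r)\<^sup>*\<^sup>* Ns Ns' \<Longrightarrow> (compat r)\<^sup>*\<^sup>* M M' \<Longrightarrow>
   (compat r)\<^sup>*\<^sup>* (Box ts Ns M) (Box ts Ns' M')"
  using compat_rtranclp_boxArgs[of r Ns Ns' ts "[]" M] compat_rtranclp_boxBody[of r M M' ts Ns']
  by (auto intro: rtranclp_trans)

lemma compat_mono: "compat r M N \<Longrightarrow> (\<And>M N. r M N \<Longrightarrow> r' M N) \<Longrightarrow> compat r' M N"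
  by (induction rule: compat.induct) (auto intro: compat.intros)

lemma compat_sub:
  assumes "compat r M N" and r: "\<And>s M N. r M N \<Longrightarrow> r (sub s M) (sub s N)"
  shows "compat r (sub s M) (sub s N)"
  using assms(1) by (induction arbitrary: s rule: compat.induct) (auto intro: compat.intros r)

lemma compat_rtranclp_sub_env:
  assumes r: "\<And>s M N. r M N \<Longrightarrow> r (sub s M) (sub s N)"
  shows "(\<And>i. (compat r)\<^sup>*\<^sup>* (s i) (t i)) \<Longrightarrow> (compat r)\<^sup>*\<^sup>* (sub s M) (sub t M)"
proof (induction M arbitrary: s t)
  case (Lam \<sigma> M)
  have "(compat r)\<^sup>*\<^sup>* (up_sub s i) (up_sub t i)" for i
  proof (cases i)
    case (Suc j)
    have "(compat r)\<^sup>*\<^sup>* (lift (s j)) (lift (t j))" unfolding ren_as_sub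
      by (rule rtranclp_map[OF Lam.prems]) (erule compat_sub, erule r)
    with Suc show ?thesis by simp
  qed simp
  from Lam.IH[OF this] show ?case by (simp add: compat_rtranclp_Lam)
next
  case (App M N)
  then show ?case by (simp add: compat_rtranclp_App)
next
  case (Box ts Ns M)
  have "list_all2 (compat r)\<^sup>*\<^sup>* (map (sub s) Ns) (map (sub t) Ns)"
    by (rule list_all2_all_nthI) (use Box in auto)
  then show ?case by (simp add: compat_rtranclp_Box)
qed simp_all

text \<open>For two redexes in arguments of the same box: they sit in the same argument, or the
  second one is further right, or further left.\<close>

lemma list_split_cases:
  assumes "xs @ x # ys = xs' @ x' # ys'"
  obtains "xs' = xs" "x' = x" "ys' = ys"
  | zs where "xs' = xs @ x # zs" "ys = zs @ x' # ys'"
  | zs where "xs = xs' @ x' # zs" "ys' = zs @ x # ys"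
  using assms by (auto simp: append_eq_append_conv2 append_eq_Cons_conv Cons_eq_append_conv)


section \<open>Two fragments of the call-by-name reduction\<close>

text \<open>Confluence is proved separately for these two fragments, which commute on typed terms.\<close>

inductive beta_flat :: "('p, 'c) tm \<Rightarrow> ('p, 'c) tm \<Rightarrow> bool" where
  beta: "beta_flat (App (Lam \<sigma> M) N) (sub0 N M)"
| flat: "length ws = length Ps \<Longrightarrow> length ys = length Ls \<Longrightarrow>
    beta_flat (Box (ws @ \<sigma> # zs) (Ps @ Box ys Ls N # Qs) M)
              (Box (ws @ ys @ zs) (Ps @ Ls @ Qs) (flat_sub (length ws) (length ys) N M))"

inductive eta_id :: "('p, 'c) tm \<Rightarrow> ('p, 'c) tm \<Rightarrow> bool" where
  eta: "eta_id (Lam \<sigma> (App (lift M) (Var 0))) M"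
| ident: "eta_id (Box [\<sigma>] [M] (Var 0)) M"

abbreviation "red1 \<equiv> compat beta_flat"
abbreviation "red2 \<equiv> compat eta_id"

lemma cbn_root_iff: "cbn_root M N \<longleftrightarrow> beta_flat M N \<or> eta_id M N"
  by (auto simp: cbn_root.simps beta_flat.simps eta_id.simps)

lemma cbn_red_iff: "cbn_red M N \<longleftrightarrow> red1 M N \<or> red2 M N"
proof
  assume "cbn_red M N"
  then show "red1 M N \<or> red2 M N"
    unfolding cbn_red_def
    by (induction rule: compat.induct) (auto simp: cbn_root_iff intro: compat.intros)
qed (auto simp: cbn_red_def cbn_root_iff intro: compat_mono)

section \<open>The two fragments under substitution and renaming\<close>

lemma beta_flat_sub: "beta_flat M N \<Longrightarrow> beta_flat (sub s M) (sub s N)"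
proof (induction rule: beta_flat.induct)
  case (flat ws Ps ys Ls \<sigma> zs N Qs M)
  then show ?case
    using beta_flat.flat[of ws "map (sub s) Ps" ys "map (sub s) Ls" \<sigma> zs N "map (sub s) Qs" M] by simp
qed (simp add: sub_sub0 beta_flat.beta)

lemma eta_id_sub: "eta_id M N \<Longrightarrow> eta_id (sub s M) (sub s N)"
  by (induction rule: eta_id.induct) (simp_all add: sub_up_lift eta_id.intros)

lemma red2_sub: "red2 M N \<Longrightarrow> red2 (sub s M) (sub s N)"
  by (erule compat_sub) (rule eta_id_sub)

lemma red2_sub_env: "(\<And>i. red2\<^sup>*\<^sup>* (s i) (t i)) \<Longrightarrow> red2\<^sup>*\<^sup>* (sub s M) (sub t M)"
  by (rule compat_rtranclp_sub_env) (rule eta_id_sub)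

lemma cbn_root_sub: "cbn_root M N \<Longrightarrow> cbn_root (sub s M) (sub s N)"
  by (auto simp: cbn_root_iff intro: beta_flat_sub eta_id_sub)

lemma typing_red1: "red1 M N \<Longrightarrow> typing Sig \<Gamma> M \<tau> \<Longrightarrow> typing Sig \<Gamma> N \<tau>"
  using typing_cbn_red cbn_red_iff by blast

lemma typing_red2: "red2 M N \<Longrightarrow> typing Sig \<Gamma> M \<tau> \<Longrightarrow> typing Sig \<Gamma> N \<tau>"
  using typing_cbn_red cbn_red_iff by blast

text \<open>Renaming acts through the variables alone, so a weak pullback square of index maps
  induces one of terms. With one leg equal to \<open>Suc\<close> it recognises the function part of
  an eta redex behind a renaming.\<close>

lemma ren_pullback:
  "ren f M = ren g N \<Longrightarrow> (\<And>i j. f i = g j \<Longrightarrow> \<exists>l. i = h l \<and> j = k l) \<Longrightarrow>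
   \<exists>P. M = ren h P \<and> N = ren k P"
proof (induction M arbitrary: N f g h k)
  case (Con c)
  then show ?case by (cases N) (auto intro: exI[of _ "Con c"])
next
  case (Var i)
  then obtain j where N: "N = Var j" and "f i = g j" by (cases N) auto
  with Var.prems(2) obtain l where "i = h l" "j = k l" by blast
  with N show ?case by (intro exI[of _ "Var l"]) simp
next
  case (Lam \<sigma> M)
  then obtain N' where N: "N = Lam \<sigma> N'" and eq: "ren (up_ren f) M = ren (up_ren g) N'" by (cases N) auto
  have "\<exists>l. i = up_ren h l \<and> j = up_ren k l" if ij: "up_ren f i = up_ren g j" for i j
  proof (cases i)
    case 0
    with ij show ?thesis by (cases j) (auto intro: exI[of _ 0])
  next
    case (Suc i')
    with ij obtain j' where "j = Suc j'" "f i' = g j'" by (cases j) auto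
    with Suc Lam.prems(2)[of i' j'] obtain l where "i = up_ren h (Suc l)" "j = up_ren k (Suc l)" by auto
    then show ?thesis by blast
  qed
  from Lam.IH[OF eq this] obtain P where "M = ren (up_ren h) P" "N' = ren (up_ren k) P" by blast
  with N show ?case by (intro exI[of _ "Lam \<sigma> P"]) simp
next
  case (App M1 M2)
  then obtain N1 N2 where N: "N = App N1 N2" and eq: "ren f M1 = ren g N1" "ren f M2 = ren g N2"
    by (cases N) auto
  from App.IH(1)[OF eq(1) App.prems(2)] App.IH(2)[OF eq(2) App.prems(2)] obtain P1 P2
    where "M1 = ren h P1" "N1 = ren k P1" "M2 = ren h P2" "N2 = ren k P2" by blast
  with N show ?case by (intro exI[of _ "App P1 P2"]) simp
next
  case (Box ts Ms M)
  then obtain Ns where N: "N = Box ts Ns M" and eq: "map (ren f) Ms = map (ren g) Ns"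
    by (cases N) auto
  have "\<forall>x \<in> set Ms. \<forall>N. ren f x = ren g N \<longrightarrow> (\<exists>P. x = ren h P \<and> N = ren k P)"
    using Box.IH(1) Box.prems(2) by blast
  with eq have "\<exists>Ps. Ms = map (ren h) Ps \<and> Ns = map (ren k) Ps"
  proof (induction Ms arbitrary: Ns)
    case (Cons M Ms)
    then obtain N Ns' where Ns: "Ns = N # Ns'" and "ren f M = ren g N" "map (ren f) Ms = map (ren g) Ns'"
      by auto
    with Cons obtain P Ps where "M = ren h P \<and> N = ren k P" "Ms = map (ren h) Ps \<and> Ns' = map (ren k) Ps"
      by (meson list.set_intros)
    with Ns show ?case by (intro exI[of _ "P # Ps"]) simp
  qed simp
  then obtain Ps where "Ms = map (ren h) Ps" "Ns = map (ren k) Ps" by blast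
  with N show ?case by (intro exI[of _ "Box ts Ps M"]) simp
qed

lemma ren_up_eq_lift: "ren (up_ren f) M = lift N \<Longrightarrow> \<exists>P. M = lift P \<and> N = ren f P"
proof -
  assume eq: "ren (up_ren f) M = lift N"
  have "\<exists>l. i = Suc l \<and> j = f l" if "up_ren f i = Suc j" for i j
    using that by (cases i) auto
  from ren_pullback[OF eq this] show ?thesis by blast
qed

lemma eta_id_ren_inv:
  assumes "eta_id (ren f M) X"
  shows "\<exists>M'. X = ren f M' \<and> eta_id M M'"
  using assms
proof (cases rule: eta_id.cases)
  case (eta \<sigma>)
  then obtain A where M: "M = Lam \<sigma> A" and "ren (up_ren f) A = App (lift X) (Var 0)" by (cases M) auto
  then obtain B C where A: "A = App B C" and "ren (up_ren f) B = lift X" and "ren (up_ren f) C = Var 0"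
    by (cases A) auto
  moreover have "up_ren f i = 0 \<Longrightarrow> i = 0" for i by (cases i) auto
  with \<open>ren (up_ren f) C = Var 0\<close> have "C = Var 0" by (cases C) auto
  moreover from ren_up_eq_lift[OF \<open>ren (up_ren f) B = lift X\<close>]
  obtain P' where "B = lift P'" "X = ren f P'" by blast
  ultimately show ?thesis using M by (auto intro: eta_id.eta)
next
  case (ident \<sigma>)
  then obtain P' where "M = Box [\<sigma>] [P'] (Var 0)" "X = ren f P'" by (cases M) auto
  then show ?thesis by (auto intro: eta_id.ident)
qed

lemma beta_flat_ren_inv:
  assumes "beta_flat (ren f M) X"
  shows "\<exists>M'. X = ren f M' \<and> beta_flat M M'"
  using assms
proof (cases rule: beta_flat.cases)
  case (beta \<sigma> A N)
  then obtain A' N' where "M = App A' N'" "ren f A' = Lam \<sigma> A" and N: "N = ren f N'" by (cases M) auto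
  moreover from this obtain A'' where "A' = Lam \<sigma> A''" "A = ren (up_ren f) A''" by (cases A') auto
  ultimately show ?thesis using beta by (auto simp: ren_sub0[symmetric] intro: beta_flat.beta)
next
  case (flat ws Ps ys Ls \<sigma> zs N Qs B)
  then obtain Ns where M: "M = Box (ws @ \<sigma> # zs) Ns B" and "map (ren f) Ns = Ps @ Box ys Ls N # Qs"
    by (cases M) auto
  then obtain Ps' K Qs' where Ns: "Ns = Ps' @ K # Qs'" "Ps = map (ren f) Ps'" "Qs = map (ren f) Qs'"
    "ren f K = Box ys Ls N" by (auto simp: map_eq_append_conv append_eq_map_conv Cons_eq_map_conv map_eq_Cons_conv)
  then obtain Ls' where K: "K = Box ys Ls' N" "Ls = map (ren f) Ls'" by (cases K) auto
  from flat Ns K show ?thesis unfolding M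
    by (intro exI[of _ "Box (ws @ ys @ zs) (Ps' @ Ls' @ Qs') (flat_sub (length ws) (length ys) N B)"])
      (use beta_flat.flat[of ws Ps' ys Ls' \<sigma> zs N Qs' B] in simp)
qed

text \<open>Renaming creates no redexes. This is used for reductions inside \<open>lift M\<close> in
  the body of an eta redex, which have to be replayed on \<open>M\<close>.\<close>

lemma compat_ren_inv:
  assumes r: "\<And>f M X. r (ren f M) X \<Longrightarrow> \<exists>M'. X = ren f M' \<and> r M M'"
  shows "compat r (ren f M) X \<Longrightarrow> \<exists>M'. X = ren f M' \<and> compat r M M'"
proof (induction "ren f M" X arbitrary: f M rule: compat.induct)
  case (root M') then show ?case using r compat.root by blast
next
  case (lam A A' \<sigma>)
  then obtain B where "M = Lam \<sigma> B" "A = ren (up_ren f) B" by (cases M) auto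
  with lam(2)[of "up_ren f" B] show ?case by (auto intro: exI[of _ "Lam \<sigma> _"] compat.lam)
next
  case (appL A A' B)
  then obtain C D where "M = App C D" "A = ren f C" "B = ren f D" by (cases M) auto
  with appL(2)[of f C] show ?case by (auto intro: exI[of _ "App _ D"] compat.appL)
next
  case (appR A A' B)
  then obtain C D where "M = App C D" "A = ren f D" "B = ren f C" by (cases M) auto
  with appR(2)[of f D] show ?case by (auto intro: exI[of _ "App C _"] compat.appR)
next
  case (boxArg N N' ts Ps Qs B)
  then obtain Ns where M: "M = Box ts Ns B" and "map (ren f) Ns = Ps @ N # Qs" by (cases M) auto
  then obtain Ps' K Qs' where Ns: "Ns = Ps' @ K # Qs'" "Ps = map (ren f) Ps'" "Qs = map (ren f) Qs'"
    "N = ren f K" by (auto simp: map_eq_append_conv append_eq_map_conv Cons_eq_map_conv map_eq_Cons_conv)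
  from boxArg(2)[OF Ns(4)] obtain K' where "N' = ren f K'" "compat r K K'" by blast
  with M Ns show ?case by (intro exI[of _ "Box ts (Ps' @ K' # Qs') B"]) (simp add: compat.boxArg)
next
  case (boxBody B B' ts Ns)
  then obtain Ns' where "M = Box ts Ns' B" "Ns = map (ren f) Ns'" by (cases M) auto
  with boxBody show ?case by (intro exI[of _ "Box ts Ns' B'"]) (simp add: compat.boxBody)
qed

lemma red1_ren_inv: "red1 (ren f M) X \<Longrightarrow> \<exists>M'. X = ren f M' \<and> red1 M M'"
  by (erule compat_ren_inv[rotated]) (rule beta_flat_ren_inv)

lemma red2_ren_inv: "red2 (ren f M) X \<Longrightarrow> \<exists>M'. X = ren f M' \<and> red2 M M'"
  by (erule compat_ren_inv[rotated]) (rule eta_id_ren_inv)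

subsection \<open>The fragments commute\<close>

lemma red2_Var [simp]: "\<not> red2 (Var i) X"
  by (auto elim: compat.cases eta_id.cases)

lemma red2_Lam_cases:
  assumes "red2 (Lam \<sigma> A) X"
  obtains A' where "X = Lam \<sigma> A'" "red2 A A'"
  | "A = App (lift X) (Var 0)"
  using assms by (cases rule: compat.cases) (auto elim: eta_id.cases)

lemma red2_App_cases:
  assumes "red2 (App M N) X"
  obtains M' where "X = App M' N" "red2 M M'"
  | N' where "X = App M N'" "red2 N N'"
  using assms by (cases rule: compat.cases) (auto elim: eta_id.cases)

lemma red2_Box_cases:
  assumes "red2 (Box ts Ns M) X"
  obtains Ps N N' Qs where "Ns = Ps @ N # Qs" "X = Box ts (Ps @ N' # Qs) M" "red2 N N'"
  | M' where "X = Box ts Ns M'" "red2 M M'"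
  | \<sigma> where "ts = [\<sigma>]" "Ns = [X]" "M = Var 0"
  using assms by (cases rule: compat.cases) (auto elim: eta_id.cases)

lemma red1_Var [simp]: "\<not> red1 (Var i) X"
  by (auto elim: compat.cases beta_flat.cases)

lemma sub0_Var_ren_up [simp]: "sub0 (Var 0) (ren (up_ren Suc) M) = M"
proof -
  have "(case_nat (Var 0) Var \<circ> up_ren Suc) i = Var i" for i by (cases i) auto
  then have "sub (case_nat (Var 0) Var \<circ> up_ren Suc) M = sub Var M"
    by (intro arg_cong[of _ _ "\<lambda>s. sub s M"] ext)
  then show ?thesis by (simp add: sub0_def sub_ren)
qed

text \<open>The second alternative is the critical pair of eta with beta.\<close>

lemma red1_eta_body:
  assumes "red1 (App (lift P) (Var 0)) X"
  obtains P' where "X = App (lift P') (Var 0)" "red1 P P'"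
  | \<sigma> A where "P = Lam \<sigma> A" "X = A"
  using assms
proof (cases rule: compat.cases)
  case root
  then show ?thesis
  proof (cases rule: beta_flat.cases)
    case (beta \<sigma> A)
    then obtain A' where "P = Lam \<sigma> A'" "A = ren (up_ren Suc) A'" by (cases P) auto
    then show ?thesis using beta that(2) by simp
  qed
next
  case (appL M')
  with red1_ren_inv that(1) show ?thesis by blast
qed auto

lemma ren_plus_0 [simp]: "ren ((+) 0) M = M"
proof -
  have "(+) (0::nat) = (\<lambda>i. i)" by auto
  then show ?thesis by (simp only: ren_id)
qed

text \<open>Closes the overlap of flattening with an inner identity box;
  \<open>flat_sub_into_Var\<close> does so for an outer one.\<close>

lemma flat_sub_Var [simp]: "flat_sub n (Suc 0) (Var 0) M = M"
proof -
  have eq: "(\<lambda>i. if i < n then Var i else if i = n then ren (\<lambda>j. n + j) (Var 0) else Var (i - 1 + Suc 0)) = Var"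
    by auto
  show ?thesis by (simp only: flat_sub_def eq sub_Var)
qed

lemma flat_sub_into_Var [simp]: "flat_sub 0 m N (Var 0) = N"
  by (simp add: flat_sub_def)

lemma red2_flat_sub: "red2 M M' \<Longrightarrow> red2 (flat_sub n m N M) (flat_sub n m N M')"
  unfolding flat_sub_def by (rule red2_sub)

lemma red2_flat_sub_env: "red2 N N' \<Longrightarrow> red2\<^sup>*\<^sup>* (flat_sub n m N M) (flat_sub n m N' M)"
  unfolding flat_sub_def
  by (rule red2_sub_env) (auto simp: ren_as_sub intro!: red2_sub r_into_rtranclp)

lemma red2_sub0: "red2 M M' \<Longrightarrow> red2 (sub0 N M) (sub0 N M')"
  unfolding sub0_def by (rule red2_sub)

lemma red2_sub0_env: "red2 N N' \<Longrightarrow> red2\<^sup>*\<^sup>* (sub0 N M) (sub0 N' M)"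
  unfolding sub0_def by (rule red2_sub_env) (auto split: nat.split)

text \<open>The asymmetry is deliberate. A beta or flattening step may copy or erase the other
  redex, so many \<open>red2\<close> steps may be needed on one side; eta and the identity rule copy
  nothing, so at most one \<open>red1\<close> step is left on the other. This is the shape that
  strong commutation asks for.\<close>

lemma beta_flat_red2_commute:
  assumes "beta_flat M N1" "red2 M N2" "typing Sig \<Gamma> M \<tau>"
  shows "\<exists>P. red2\<^sup>*\<^sup>* N1 P \<and> red1\<^sup>=\<^sup>= N2 P"
  using assms
proof (cases rule: beta_flat.cases)
  case (beta \<sigma> A N)
  note M = \<open>M = App (Lam \<sigma> A) N\<close> \<open>N1 = sub0 N A\<close>
  from assms(2)[unfolded M(1)] show ?thesis
  proof (cases rule: red2_App_cases)
    case (1 L)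
    from \<open>red2 (Lam \<sigma> A) L\<close> show ?thesis
    proof (cases rule: red2_Lam_cases)
      case (1 A')
      then have "red1 N2 (sub0 N A')" using \<open>N2 = App L N\<close> by (auto intro: compat.root beta_flat.beta)
      moreover have "red2\<^sup>*\<^sup>* N1 (sub0 N A')" using 1 M by (simp add: red2_sub0 r_into_rtranclp)
      ultimately show ?thesis by blast
    next
      case 2
      \<comment> \<open>The abstraction is itself an eta redex, and contracting it either way yields
        its function part applied to \<open>N\<close>.\<close>
      have "N1 = N2" using 2 M \<open>N2 = App L N\<close> by (simp add: sub0_def sub_ren comp_def)
      then show ?thesis by blast
    qed
  next
    case (2 N')
    then have "red1 N2 (sub0 N' A)" by (auto intro: compat.root beta_flat.beta)
    moreover have "red2\<^sup>*\<^sup>* N1 (sub0 N' A)" using 2 M by (simp add: red2_sub0_env)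
    ultimately show ?thesis by blast
  qed
next
  case (flat ws Ps ys Ls \<sigma> zs N Qs B)
  note M = \<open>M = Box (ws @ \<sigma> # zs) (Ps @ Box ys Ls N # Qs) B\<close>
    and N1 = \<open>N1 = Box (ws @ ys @ zs) (Ps @ Ls @ Qs) (flat_sub (length ws) (length ys) N B)\<close>
    and len = \<open>length ws = length Ps\<close> \<open>length ys = length Ls\<close>
  let ?F = "\<lambda>Ps Ls Qs N B. Box (ws @ ys @ zs) (Ps @ Ls @ Qs) (flat_sub (length ws) (length ys) N B)"
  have step: "red1 (Box (ws @ \<sigma> # zs) (Ps' @ Box ys Ls' N' # Qs') B') (?F Ps' Ls' Qs' N' B')"
    if "length Ps' = length Ps" "length Ls' = length Ls" for Ps' Ls' Qs' N' B'
    by (rule compat.root, rule beta_flat.flat) (use that len in auto)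
  have args: "red2 (Box ts (Ps' @ Ls' @ Qs') C) (Box ts (Ps'' @ Ls'' @ Qs'') C)"
    if "\<exists>X Y K K'. Ps' @ Ls' @ Qs' = X @ K # Y \<and> Ps'' @ Ls'' @ Qs'' = X @ K' # Y \<and> red2 K K'"
    for ts Ps' Ls' Qs' Ps'' Ls'' Qs'' C
    using that by (metis compat.boxArg)
  have close: ?thesis if "red2\<^sup>*\<^sup>* (?F Ps Ls Qs N B) (?F Ps' Ls' Qs' N' B')" "length Ps' = length Ps"
    "length Ls' = length Ls" "N2 = Box (ws @ \<sigma> # zs) (Ps' @ Box ys Ls' N' # Qs') B'" for Ps' Ls' Qs' N' B'
    using that step unfolding N1 by blast
  from assms(2)[unfolded M] show ?thesis
  proof (cases rule: red2_Box_cases)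
    case (1 Ps1 K K' Qs1)
    from 1(1) show ?thesis
    proof (cases rule: list_split_cases)
      case 1
      with \<open>red2 K K'\<close> have "red2 (Box ys Ls N) K'" by simp
      then show ?thesis
      proof (cases rule: red2_Box_cases)
        case (1 Ps2 L L' Qs2)
        have "red2 (?F Ps Ls Qs N B) (?F Ps (Ps2 @ L' # Qs2) Qs N B)"
          by (rule args, rule exI[of _ "Ps @ Ps2"], rule exI[of _ "Qs2 @ Qs"]) (use 1 in auto)
        then show ?thesis
          by (intro close[of Ps "Ps2 @ L' # Qs2" Qs N B])
            (use 1 \<open>K = Box ys Ls N\<close> \<open>Ps1 = Ps\<close> \<open>Qs1 = Qs\<close> \<open>N2 = _\<close> in auto)
      next
        case (2 N')
        have "red2\<^sup>*\<^sup>* (?F Ps Ls Qs N B) (?F Ps Ls Qs N' B)"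
          by (intro compat_rtranclp_boxBody red2_flat_sub_env 2)
        then show ?thesis
          by (intro close[of Ps Ls Qs N' B]) (use 2 \<open>Ps1 = Ps\<close> \<open>Qs1 = Qs\<close> \<open>N2 = _\<close> in auto)
      next
        case (3 \<sigma>')
        \<comment> \<open>Flattening the inner identity box brings its own annotation \<sigma>' to
          the slot, while the identity rule leaves \<sigma> there; typing makes them equal.\<close>
        have "typing Sig \<Gamma> (Box ys Ls N) (Nec \<sigma>)"
          using assms(3) len unfolding M by (auto simp: list_all2_append)
        with 3 have "\<sigma>' = \<sigma>" by auto
        then have "N1 = N2" using 3 \<open>Ps1 = Ps\<close> \<open>Qs1 = Qs\<close> \<open>N2 = _\<close> N1 by simp
        then show ?thesis by blast
      qed
    next
      case (2 Zs)
      have "red2 (?F Ps Ls Qs N B) (?F Ps Ls (Zs @ K' # Qs1) N B)"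
        by (rule args, rule exI[of _ "Ps @ Ls @ Zs"], rule exI[of _ "Qs1"]) (use 1 2 in auto)
      then show ?thesis
        by (intro close[of Ps Ls "Zs @ K' # Qs1" N B]) (use 1 2 in auto)
    next
      case (3 Zs)
      have "red2 (?F Ps Ls Qs N B) (?F (Ps1 @ K' # Zs) Ls Qs N B)"
        by (rule args, rule exI[of _ "Ps1"], rule exI[of _ "Zs @ Ls @ Qs"]) (use 1 3 in auto)
      then show ?thesis
        by (intro close[of "Ps1 @ K' # Zs" Ls Qs N B]) (use 1 3 in auto)
    qed
  next
    case (2 B')
    have "red2 (?F Ps Ls Qs N B) (?F Ps Ls Qs N B')"
      by (intro compat.boxBody red2_flat_sub 2)
    then show ?thesis by (intro close[of Ps Ls Qs N B']) (use 2 in auto)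
  next
    case (3 \<sigma>')
    then have "Ps = []" "Qs = []" "ws = []" "zs = []" "N2 = Box ys Ls N"
      by (auto simp: append_eq_Cons_conv)
    then have "N1 = N2" using N1 3 by simp
    then show ?thesis by blast
  qed
qed

text \<open>Serves both for \<open>red1\<close> against \<open>red2\<close> and for
  \<open>red2\<close> against itself. Only overlaps at the root of an \<open>r\<close> step and
  steps inside an eta redex depend on \<open>r\<close>; disjoint redexes are treated uniformly. The
  assumption on variables excludes a step in the body \<open>Var 0\<close> of an identity
  box.\<close>

lemma compat_red2_commute:
  assumes root: "\<And>M N1 N2 \<Gamma> \<tau>. r M N1 \<Longrightarrow> red2 M N2 \<Longrightarrow> typing Sig \<Gamma> M \<tau> \<Longrightarrow>
      \<exists>P. red2\<^sup>*\<^sup>* N1 P \<and> (compat r)\<^sup>=\<^sup>= N2 P"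
    and eta: "\<And>\<sigma> M A \<Gamma> \<tau>. compat r (App (lift M) (Var 0)) A \<Longrightarrow> typing Sig \<Gamma> (Lam \<sigma> (App (lift M) (Var 0))) \<tau> \<Longrightarrow>
      \<exists>P. red2\<^sup>*\<^sup>* (Lam \<sigma> A) P \<and> (compat r)\<^sup>=\<^sup>= M P"
    and Var: "\<And>i X. \<not> compat r (Var i) X"
  shows "compat r M N1 \<Longrightarrow> red2 M N2 \<Longrightarrow> typing Sig \<Gamma> M \<tau> \<Longrightarrow> \<exists>P. red2\<^sup>*\<^sup>* N1 P \<and> (compat r)\<^sup>=\<^sup>= N2 P"
proof (induction arbitrary: N2 \<Gamma> \<tau> rule: compat.induct)
  case (root M M')
  then show ?case by (rule assms(1))
next
  case (lam A A' \<sigma>)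
  from lam.prems(1) show ?case
  proof (cases rule: red2_Lam_cases)
    case (1 A2)
    from lam.prems(2) obtain \<rho> where "typing Sig (\<sigma> # \<Gamma>) A \<rho>" by auto
    from lam.IH[OF 1(2) this] obtain P where "red2\<^sup>*\<^sup>* A' P" "(compat r)\<^sup>=\<^sup>= A2 P" by blast
    with 1 show ?thesis by (intro exI[of _ "Lam \<sigma> P"]) (auto intro: compat_rtranclp_Lam compat.lam)
  next
    case 2
    from eta[OF lam.hyps[unfolded 2] lam.prems(2)[unfolded 2]] show ?thesis .
  qed
next
  case (appL A A' B)
  from appL.prems(1) show ?case
  proof (cases rule: red2_App_cases)
    case (1 A2)
    from appL.prems(2) obtain \<rho> where "typing Sig \<Gamma> A \<rho>" by auto
    from appL.IH[OF 1(2) this] obtain P where "red2\<^sup>*\<^sup>* A' P" "(compat r)\<^sup>=\<^sup>= A2 P" by blast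
    with 1 show ?thesis by (intro exI[of _ "App P B"]) (auto intro: compat_rtranclp_App compat.appL)
  next
    case (2 B2)
    then show ?thesis using appL.hyps
      by (intro exI[of _ "App A' B2"]) (auto intro: compat.appL compat.appR)
  qed
next
  case (appR B B' A)
  from appR.prems(1) show ?case
  proof (cases rule: red2_App_cases)
    case (1 A2)
    then show ?thesis using appR.hyps
      by (intro exI[of _ "App A2 B'"]) (auto intro: compat.appL compat.appR)
  next
    case (2 B2)
    from appR.prems(2) obtain \<rho> where "typing Sig \<Gamma> B \<rho>" by auto
    from appR.IH[OF 2(2) this] obtain P where "red2\<^sup>*\<^sup>* B' P" "(compat r)\<^sup>=\<^sup>= B2 P" by blast
    with 2 show ?thesis by (intro exI[of _ "App A P"]) (auto intro: compat_rtranclp_App compat.appR)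
  qed
next
  case (boxArg K K' ts Ps Qs B)
  from boxArg.prems(1) show ?case
  proof (cases rule: red2_Box_cases)
    case (1 Ps1 L L' Qs1)
    from 1(1) show ?thesis
    proof (cases rule: list_split_cases)
      case e: 1
      from boxArg.prems(2) obtain \<rho> where "typing Sig \<Gamma> K \<rho>"
        by (auto simp: list_all2_append1 list_all2_Cons1)
      from boxArg.IH[OF _ this] 1 e obtain P where "red2\<^sup>*\<^sup>* K' P" "(compat r)\<^sup>=\<^sup>= L' P" by blast
      moreover from this(1) have "red2\<^sup>*\<^sup>* (Box ts (Ps @ K' # Qs) B) (Box ts (Ps @ P # Qs) B)"
        by (rule rtranclp_map[where f = "\<lambda>N. Box ts (Ps @ N # Qs) B"]) (rule compat.boxArg)
      ultimately show ?thesis using 1 e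
        by (intro exI[of _ "Box ts (Ps @ P # Qs) B"]) (auto intro: compat.boxArg)
    next
      case (2 Zs)
      have "red2 (Box ts ((Ps @ K' # Zs) @ L # Qs1) B) (Box ts ((Ps @ K' # Zs) @ L' # Qs1) B)"
        using 1 by (intro compat.boxArg)
      moreover have "(compat r) (Box ts (Ps @ K # Zs @ L' # Qs1) B) (Box ts (Ps @ K' # Zs @ L' # Qs1) B)"
        using boxArg.hyps by (rule compat.boxArg)
      ultimately show ?thesis using 1 2
        by (intro exI[of _ "Box ts (Ps @ K' # Zs @ L' # Qs1) B"]) auto
    next
      case (3 Zs)
      have "(compat r) (Box ts ((Ps1 @ L' # Zs) @ K # Qs) B) (Box ts ((Ps1 @ L' # Zs) @ K' # Qs) B)"
        using boxArg.hyps by (rule compat.boxArg)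
      moreover have "red2 (Box ts (Ps1 @ L # Zs @ K' # Qs) B) (Box ts (Ps1 @ L' # Zs @ K' # Qs) B)"
        using 1 by (intro compat.boxArg)
      ultimately show ?thesis using 1 3
        by (intro exI[of _ "Box ts (Ps1 @ L' # Zs @ K' # Qs) B"]) auto
    qed
  next
    case (2 B')
    then show ?thesis using boxArg.hyps
      by (intro exI[of _ "Box ts (Ps @ K' # Qs) B'"]) (auto intro: compat.boxArg compat.boxBody)
  next
    case (3 \<sigma>)
    then have "red2 (Box ts (Ps @ K' # Qs) B) K'" "N2 = K"
      by (auto simp: append_eq_Cons_conv intro: compat.root eta_id.ident)
    with boxArg.hyps show ?thesis by blast
  qed
next
  case (boxBody B B' ts Ns)
  from boxBody.prems(1) show ?case
  proof (cases rule: red2_Box_cases)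
    case (1 Ps L L' Qs)
    then show ?thesis using boxBody.hyps
      by (intro exI[of _ "Box ts (Ps @ L' # Qs) B'"]) (auto intro: compat.boxArg compat.boxBody)
  next
    case (2 B2)
    from boxBody.prems(2) obtain \<rho> where "typing Sig ts B \<rho>" by auto
    from boxBody.IH[OF 2(2) this] obtain P where "red2\<^sup>*\<^sup>* B' P" "(compat r)\<^sup>=\<^sup>= B2 P" by blast
    with 2 show ?thesis
      by (intro exI[of _ "Box ts Ns P"]) (auto intro: compat_rtranclp_boxBody compat.boxBody)
  next
    case (3 \<sigma>)
    with boxBody.hyps Var show ?thesis by simp
  qed
qed

lemma red1_red2_commute:
  assumes "red1 M N1" "red2 M N2" "typing Sig \<Gamma> M \<tau>"
  shows "\<exists>P. red2\<^sup>*\<^sup>* N1 P \<and> red1\<^sup>=\<^sup>= N2 P"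
proof (rule compat_red2_commute[OF beta_flat_red2_commute _ red1_Var assms])
  fix \<sigma> \<Gamma> \<tau> and M A :: "('a, 'b) tm"
  assume t: "typing Sig \<Gamma> (Lam \<sigma> (App (lift M) (Var 0))) \<tau>"
  assume "red1 (App (lift M) (Var 0)) A"
  then show "\<exists>P. red2\<^sup>*\<^sup>* (Lam \<sigma> A) P \<and> red1\<^sup>=\<^sup>= M P"
  proof (cases rule: red1_eta_body)
    case (1 P')
    then have "red2 (Lam \<sigma> A) P'" by (auto intro: compat.root eta_id.eta)
    with 1 show ?thesis by blast
  next
    case (2 \<sigma>' B)
    \<comment> \<open>Typing of the eta redex forces the annotation of \<open>M\<close> to be
      \<sigma>; otherwise the two reducts could differ in it.\<close>
    with t have "Lam \<sigma> A = M" by auto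
    then show ?thesis by blast
  qed
qed

lemma red2_eta_body: "red2 (App (lift M) (Var 0)) A \<Longrightarrow> \<exists>M'. red2 (Lam \<sigma> A) M' \<and> red2 M M'"
proof (cases rule: red2_App_cases, assumption)
  fix K assume "A = App K (Var 0)" "red2 (lift M) K"
  moreover from red2_ren_inv[OF this(2)] obtain M' where "K = lift M'" "red2 M M'" by blast
  ultimately show ?thesis by (auto intro: compat.root eta_id.eta)
qed simp

lemma eta_id_red2_commute:
  assumes "eta_id M N1" "red2 M N2"
  shows "\<exists>P. red2\<^sup>*\<^sup>* N1 P \<and> red2\<^sup>=\<^sup>= N2 P"
  using assms(1)
proof (cases rule: eta_id.cases)
  case (eta \<sigma>)
  from assms(2)[unfolded eta] show ?thesis
  proof (cases rule: red2_Lam_cases)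
    case (1 A)
    from red2_eta_body[OF 1(2), of \<sigma>] 1(1) show ?thesis by blast
  next
    case 2
    then have "N1 = N2" using lift_inj by blast
    then show ?thesis by blast
  qed
next
  case (ident \<sigma>)
  from assms(2)[unfolded ident] show ?thesis
  proof (cases rule: red2_Box_cases)
    case (1 Ps N N' Qs)
    then have "N2 = Box [\<sigma>] [N'] (Var 0)" "red2 N1 N'" by (auto simp: Cons_eq_append_conv)
    then have "red2 N2 N'" "red2 N1 N'" by (auto intro: compat.root eta_id.ident)
    then show ?thesis by blast
  qed auto
qed

lemma red2_red2_commute:
  assumes "red2 M N1" "red2 M N2" "typing Sig \<Gamma> M \<tau>"
  shows "\<exists>P. red2\<^sup>*\<^sup>* N1 P \<and> red2\<^sup>=\<^sup>= N2 P"
proof (rule compat_red2_commute[OF eta_id_red2_commute _ red2_Var assms])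
  fix \<sigma> and M A :: "('a, 'b) tm"
  assume "red2 (App (lift M) (Var 0)) A"
  from red2_eta_body[OF this, of \<sigma>] show "\<exists>P. red2\<^sup>*\<^sup>* (Lam \<sigma> A) P \<and> red2\<^sup>=\<^sup>= M P" by blast
qed

subsection \<open>Superdevelopments\<close>

text \<open>
  In \<open>asm gs M\<close>, the \<open>i\<close>-th variable of \<open>M\<close> is replaced by the body of the \<open>i\<close>-th segment,
  whose own arguments are spliced into the argument list. A box argument that stays in place is
  the segment whose body is \<open>Var 0\<close>, so that simultaneous flattening needs no case distinction.
\<close>

type_synonym ('p, 'c) args = "('p ty \<times> ('p, 'c) tm) list"
type_synonym ('p, 'c) seg = "('p, 'c) args \<times> ('p, 'c) tm"

text \<open>The first body needs no shift because its arguments come first in the joint argument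
  list; the later ones are moved past them.\<close>

primrec senv :: "('p, 'c) seg list \<Rightarrow> nat \<Rightarrow> ('p, 'c) tm" where
  "senv [] = Var"
| "senv (g # gs) = case_nat (snd g) (\<lambda>i. ren (\<lambda>j. length (fst g) + j) (senv gs i))"

definition mkbox :: "('p, 'c) args \<Rightarrow> ('p, 'c) tm \<Rightarrow> ('p, 'c) tm" where
  "mkbox ps M = Box (map fst ps) (map snd ps) M"

primrec seg_args :: "('p, 'c) seg list \<Rightarrow> ('p, 'c) args" where
  "seg_args [] = []"
| "seg_args (g # gs) = fst g @ seg_args gs"

definition asm :: "('p, 'c) seg list \<Rightarrow> ('p, 'c) tm \<Rightarrow> ('p, 'c) tm" where
  "asm gs M = mkbox (seg_args gs) (sub (senv gs) M)"

definition keep :: "'p ty \<times> ('p, 'c) tm \<Rightarrow> ('p, 'c) seg" where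
  "keep p = ([p], Var 0)"

text \<open>An argument that is a box may still be left closed. The annotation \<sigma> survives
  only in that case; an opened box brings its own annotations.\<close>

definition opens :: "'p ty \<Rightarrow> ('p, 'c) tm \<Rightarrow> ('p, 'c) seg \<Rightarrow> bool" where
  "opens \<sigma> N g \<longleftrightarrow> g = keep (\<sigma>, N) \<or> N = mkbox (fst g) (snd g)"

text \<open>Superdevelopments: the contraction rules look at the reducts of the immediate subterms,
  not at the subterms themselves. \<open>beta\<close> fires when the function part reduces to an
  abstraction, and \<open>box\<close> opens an argument whose reduct is a box. Boxes nested several
  levels deep form overlapping redexes; working from the inside out flattens all of them in one
  step.\<close>

inductive sd :: "('p, 'c) tm \<Rightarrow> ('p, 'c) tm \<Rightarrow> bool" where
  Con: "sd (Con c) (Con c)"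
| Var: "sd (Var i) (Var i)"
| Lam: "sd M M' \<Longrightarrow> sd (Lam \<sigma> M) (Lam \<sigma> M')"
| App: "sd M M' \<Longrightarrow> sd N N' \<Longrightarrow> sd (App M N) (App M' N')"
| beta: "sd M (Lam \<sigma> P) \<Longrightarrow> sd N N' \<Longrightarrow> sd (App M N) (sub0 N' P)"
| box: "list_all2 (\<lambda>p g. \<exists>N'. sd (snd p) N' \<and> opens (fst p) N' g) ps gs \<Longrightarrow> sd M M' \<Longrightarrow>
    sd (mkbox ps M) (asm gs M')"

abbreviation sd_seg :: "'p ty \<times> ('p, 'c) tm \<Rightarrow> ('p, 'c) seg \<Rightarrow> bool" where
  "sd_seg p g \<equiv> \<exists>N'. sd (snd p) N' \<and> opens (fst p) N' g"

lemma mkbox_inj [simp]: "mkbox ps M = mkbox qs N \<longleftrightarrow> ps = qs \<and> M = N"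
  by (auto simp: mkbox_def intro: nth_equalityI prod_eqI)
    (metis zip_map_fst_snd)

lemma mkbox_distinct [simp]:
  "mkbox ps M \<noteq> Con c" "mkbox ps M \<noteq> Var i" "mkbox ps M \<noteq> Lam \<sigma> A" "mkbox ps M \<noteq> App A B"
  "Con c \<noteq> mkbox ps M" "Var i \<noteq> mkbox ps M" "Lam \<sigma> A \<noteq> mkbox ps M" "App A B \<noteq> mkbox ps M"
  by (auto simp: mkbox_def)

lemma Box_eq_mkbox: "length ts = length Ns \<Longrightarrow> Box ts Ns M = mkbox (zip ts Ns) M"
  by (simp add: mkbox_def)

lemma scoped_mkbox [simp]:
  "scoped n (mkbox ps M) \<longleftrightarrow> (\<forall>p \<in> set ps. scoped n (snd p)) \<and> scoped (length ps) M"
  by (auto simp: mkbox_def)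

lemma sub_mkbox: "sub s (mkbox ps M) = mkbox (map (map_prod id (sub s)) ps) M"
  by (simp add: mkbox_def comp_def)

lemma ren_mkbox: "ren f (mkbox ps M) = mkbox (map (map_prod id (ren f)) ps) M"
  by (simp add: mkbox_def comp_def)

lemma keep_simps [simp]: "fst (keep p) = [p]" "snd (keep p) = Var 0"
  by (simp_all add: keep_def)

lemma seg_args_append [simp]: "seg_args (gs @ hs) = seg_args gs @ seg_args hs"
  by (induction gs) auto

lemma senv_append: "senv (gs @ hs) i =
   (if i < length gs then senv gs i
    else ren (\<lambda>j. length (seg_args gs) + j) (senv hs (i - length gs)))"
proof (induction gs arbitrary: i)
  case (Cons g gs)
  then show ?case by (cases i) (auto simp: ren_ren comp_def add.assoc)
qed simp

lemma senv_keep [simp]: "senv (map keep ps) = Var"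
proof (induction ps)
  case (Cons p ps)
  show ?case by (rule ext) (simp add: Cons split: nat.split)
qed simp

lemma seg_args_keep [simp]: "seg_args (map keep ps) = ps"
  by (induction ps) auto

lemma asm_keep: "asm (map keep ps) M = mkbox ps M"
  by (simp add: asm_def)

lemma scoped_ren: "scoped n M \<Longrightarrow> (\<And>i. i < n \<Longrightarrow> f i < m) \<Longrightarrow> scoped m (ren f M)"
proof (induction M arbitrary: n m f)
  case (Lam \<sigma> M)
  have "up_ren f i < Suc m" if "i < Suc n" for i using that Lam.prems(2) by (cases i) auto
  then have "scoped (Suc m) (ren (up_ren f) M)"
    by (rule Lam.IH[rotated]) (use Lam.prems(1) in auto)
  then show ?case by simp
next
  case (App M N)
  have "scoped m (ren f M)" by (rule App.IH(1)[OF _ App.prems(2)]) (use App.prems(1) in auto)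
  moreover have "scoped m (ren f N)" by (rule App.IH(2)[OF _ App.prems(2)]) (use App.prems(1) in auto)
  ultimately show ?case by simp
next
  case (Box ts Ns M)
  have "scoped m (ren f N)" if "N \<in> set Ns" for N
    by (rule Box.IH(1)[OF that _ Box.prems(2)]) (use that Box.prems(1) in auto)
  with Box.prems(1) show ?case by auto
qed simp_all

lemma scoped_sub: "scoped n M \<Longrightarrow> (\<And>i. i < n \<Longrightarrow> scoped m (s i)) \<Longrightarrow> scoped m (sub s M)"
proof (induction M arbitrary: n m s)
  case (Lam \<sigma> M)
  have "scoped (Suc m) (up_sub s i)" if "i < Suc n" for i
    using that Lam.prems(2) by (cases i) (auto intro: scoped_ren)
  then have "scoped (Suc m) (sub (up_sub s) M)"
    by (rule Lam.IH[rotated]) (use Lam.prems(1) in auto)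
  then show ?case by simp
next
  case (App M N)
  have "scoped m (sub s M)" by (rule App.IH(1)[OF _ App.prems(2)]) (use App.prems(1) in auto)
  moreover have "scoped m (sub s N)" by (rule App.IH(2)[OF _ App.prems(2)]) (use App.prems(1) in auto)
  ultimately show ?case by simp
next
  case (Box ts Ns M)
  have "scoped m (sub s N)" if "N \<in> set Ns" for N
    by (rule Box.IH(1)[OF that _ Box.prems(2)]) (use that Box.prems(1) in auto)
  with Box.prems(1) show ?case by auto
qed simp_all

lemma scoped_senv:
  "(\<And>g. g \<in> set gs \<Longrightarrow> scoped (length (fst g)) (snd g)) \<Longrightarrow> i < length gs \<Longrightarrow>
   scoped (length (seg_args gs)) (senv gs i)"
proof (induction gs arbitrary: i)
  case (Cons g gs)
  show ?case
  proof (cases i)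
    case 0
    have "scoped (length (fst g)) (snd g)" using Cons.prems by simp
    then have "scoped (length (seg_args (g # gs))) (ren (\<lambda>j. j) (snd g))"
      by (rule scoped_ren) simp
    with 0 show ?thesis by simp
  next
    case (Suc j)
    have "scoped (length (seg_args gs)) (senv gs j)" using Cons Suc by simp
    then have "scoped (length (seg_args (g # gs))) (ren (\<lambda>j. length (fst g) + j) (senv gs j))"
      by (rule scoped_ren) simp
    with Suc show ?thesis by simp
  qed
qed simp

lemma set_seg_args: "set (seg_args gs) = (\<Union>g \<in> set gs. set (fst g))"
  by (induction gs) auto

lemma scoped_asm:
  "(\<And>g. g \<in> set gs \<Longrightarrow> scoped (length (fst g)) (snd g) \<and> (\<forall>p \<in> set (fst g). scoped n (snd p))) \<Longrightarrow>
   scoped (length gs) M \<Longrightarrow> scoped n (asm gs M)"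
  unfolding asm_def by (fastforce simp: set_seg_args intro!: scoped_sub scoped_senv)

lemma opens_scoped:
  "opens \<sigma> N g \<Longrightarrow> scoped n N \<Longrightarrow>
   scoped (length (fst g)) (snd g) \<and> (\<forall>p \<in> set (fst g). scoped n (snd p))"
  unfolding opens_def by (elim disjE) simp_all

lemma sd_scoped: "sd M N \<Longrightarrow> scoped n M \<Longrightarrow> scoped n N"
proof (induction arbitrary: n rule: sd.induct)
  case (beta M \<sigma> P N N')
  then have "scoped (Suc n) P" "scoped n N'" by auto
  then show ?case unfolding sub0_def by (auto intro!: scoped_sub split: nat.split)
next
  case (box ps gs M M')
  show ?case
  proof (rule scoped_asm)
    show "scoped (length gs) M'" using box list_all2_lengthD[OF box.IH(1)] by simp
    fix g assume "g \<in> set gs"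
    then obtain i where i: "i < length gs" "g = gs ! i" by (auto simp: in_set_conv_nth)
    with list_all2_nthD2[OF box.IH(1) i(1)] list_all2_lengthD[OF box.IH(1)]
    obtain N' where "\<And>n. scoped n (snd (ps ! i)) \<Longrightarrow> scoped n N'" "opens (fst (ps ! i)) N' g"
      and "ps ! i \<in> set ps" by auto
    then obtain p where p: "p \<in> set ps" "\<And>n. scoped n (snd p) \<Longrightarrow> scoped n N'" "opens (fst p) N' g"
      by blast
    with box.prems opens_scoped show "scoped (length (fst g)) (snd g) \<and> (\<forall>p \<in> set (fst g). scoped n (snd p))"
      by (metis scoped_mkbox)
  qed
qed auto

text \<open>The body component stays as it is because renaming and substitution do not enter box
  bodies.\<close>

abbreviation mapseg :: "(('p, 'c) tm \<Rightarrow> ('p, 'c) tm) \<Rightarrow> ('p, 'c) seg \<Rightarrow> ('p, 'c) seg" where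
  "mapseg h g \<equiv> (map (map_prod id h) (fst g), snd g)"

lemma senv_mapseg [simp]: "senv (map (mapseg h) gs) = senv gs"
  by (induction gs) auto

lemma seg_args_mapseg [simp]: "seg_args (map (mapseg h) gs) = map (map_prod id h) (seg_args gs)"
  by (induction gs) auto

lemma ren_asm: "ren f (asm gs M) = asm (map (mapseg (ren f)) gs) M"
  by (simp only: asm_def ren_mkbox senv_mapseg seg_args_mapseg)

lemma sub_asm: "sub s (asm gs M) = asm (map (mapseg (sub s)) gs) M"
  by (simp only: asm_def sub_mkbox senv_mapseg seg_args_mapseg)

lemma opens_ren: "opens \<sigma> N g \<Longrightarrow> opens \<sigma> (ren f N) (mapseg (ren f) g)"
  by (auto simp: opens_def keep_def ren_mkbox)

lemma opens_sub: "opens \<sigma> N g \<Longrightarrow> opens \<sigma> (sub s N) (mapseg (sub s) g)"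
  by (auto simp: opens_def keep_def sub_mkbox)

section \<open>Superdevelopments under renaming and substitution\<close>

lemma sd_ren: "sd M N \<Longrightarrow> sd (ren f M) (ren f N)"
proof (induction arbitrary: f rule: sd.induct)
  case (beta M \<sigma> P N N')
  then have "sd (ren f M) (Lam \<sigma> (ren (up_ren f) P))" "sd (ren f N) (ren f N')" by auto
  then show ?case unfolding ren.simps ren_sub0 by (rule sd.beta)
next
  case (box ps gs M M')
  have "list_all2 sd_seg (map (map_prod id (ren f)) ps) (map (mapseg (ren f)) gs)"
    unfolding list.rel_map using box.IH(1)
    by (rule list_all2_mono) (auto dest: opens_ren)
  then show ?case unfolding ren_mkbox ren_asm using box.hyps by (rule sd.box)
qed (auto intro: sd.intros)

lemma sd_sub:
  fixes M :: "('p, 'c) tm"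
  shows "sd M M' \<Longrightarrow> (\<And>i. sd (s i) (t i)) \<Longrightarrow> sd (sub s M) (sub t M')"
proof (induction arbitrary: s t rule: sd.induct)
  case (Lam M M' \<sigma>)
  have "sd (up_sub s i) (up_sub t i)" for i
    using Lam.prems by (cases i) (auto intro: sd_ren sd.Var)
  with Lam show ?case by (simp add: sd.Lam)
next
  case (beta M \<sigma> P N N')
  have "sd (sub s M) (sub t (Lam \<sigma> P))" "sd (sub s N) (sub t N')" using beta by blast+
  then show ?case unfolding sub.simps sub_sub0 by (rule sd.beta)
next
  case (box ps gs M M')
  have "list_all2 sd_seg (map (map_prod id (sub s)) ps) (map (mapseg (sub t)) gs)"
    unfolding list.rel_map using box.IH(1)
  proof (rule list_all2_mono, elim exE conjE)
    fix p :: "'p ty \<times> ('p, 'c) tm" and g N'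
    assume "\<forall>s t. (\<forall>i. sd (s i) (t i)) \<longrightarrow> sd (sub s (snd p)) (sub t N')" "opens (fst p) N' g"
    with box.prems show "sd_seg (map_prod id (sub s) p) (mapseg (sub t) g)"
      by (intro exI[of _ "sub t N'"]) (simp add: opens_sub)
  qed
  then show ?case unfolding sub_mkbox sub_asm using box.hyps by (rule sd.box)
qed (auto intro: sd.intros)

lemma sd_sub0: "sd M M' \<Longrightarrow> sd N N' \<Longrightarrow> sd (sub0 N M) (sub0 N' M')"
  unfolding sub0_def by (rule sd_sub) (auto split: nat.split intro: sd.Var)

text \<open>Scoping enters because the only rule for boxes is about \<open>mkbox\<close>, which has
  exactly one annotation per argument.\<close>

lemma sd_refl: "scoped n M \<Longrightarrow> sd M M"
proof (induction M arbitrary: n)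
  case (Box ts Ns M)
  have "list_all2 sd_seg (zip ts Ns) (map keep (zip ts Ns))"
  proof (rule list_all2_all_nthI)
    fix i assume i: "i < length (zip ts Ns)"
    then have "sd (Ns ! i) (Ns ! i)" using Box.IH(1)[of "Ns ! i" n] Box.prems by simp
    with i show "sd_seg (zip ts Ns ! i) (map keep (zip ts Ns) ! i)" by (auto simp: opens_def)
  qed simp
  moreover have "sd M M" using Box by auto
  ultimately have "sd (mkbox (zip ts Ns) M) (mkbox (zip ts Ns) M)"
    using sd.box[of "zip ts Ns" "map keep (zip ts Ns)" M M] by (simp only: asm_keep)
  with Box.prems show ?case by (simp add: Box_eq_mkbox)
qed (auto intro: sd.intros)

lemma sd_Lam_inv: "sd (Lam \<sigma> M) N \<Longrightarrow> \<exists>M'. N = Lam \<sigma> M' \<and> sd M M'"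
  by (erule sd.cases) auto

lemma sd_mkbox_inv: "sd (mkbox ps M) N \<Longrightarrow> \<exists>gs M'. N = asm gs M' \<and> list_all2 sd_seg ps gs \<and> sd M M'"
  by (erule sd.cases) auto

text \<open>The greediest choice permitted by \<open>opens\<close>.\<close>

fun opened :: "'p ty \<Rightarrow> ('p, 'c) tm \<Rightarrow> ('p, 'c) seg" where
  "opened \<sigma> (Box ys Ls B) = (zip ys Ls, B)"
| "opened \<sigma> N = keep (\<sigma>, N)"

lemma opened_mkbox [simp]: "opened \<sigma> (mkbox ps M) = (ps, M)"
  by (simp add: mkbox_def zip_map_fst_snd)

lemma opens_opened: "scoped n N \<Longrightarrow> opens \<sigma> N (opened \<sigma> N)"
  by (cases N) (auto simp: opens_def mkbox_def)

text \<open>The complete superdevelopment, which contracts every redex that a superdevelopment may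
  contract. It is the target in the triangle property.\<close>

primrec star :: "('p, 'c) tm \<Rightarrow> ('p, 'c) tm" where
  "star (Con c) = Con c"
| "star (Var i) = Var i"
| "star (Lam \<sigma> M) = Lam \<sigma> (star M)"
| "star (App M N) = (case star M of Lam \<sigma> P \<Rightarrow> sub0 (star N) P | M' \<Rightarrow> App M' (star N))"
| "star (Box ts Ns M) = asm (map2 opened ts (map star Ns)) (star M)"

lemma star_mkbox: "star (mkbox ps M) = asm (map (\<lambda>p. opened (fst p) (star (snd p))) ps) (star M)"
proof -
  have "map2 opened (map fst ps) (map star (map snd ps)) = map (\<lambda>p. opened (fst p) (star (snd p))) ps"
    by (induction ps) auto
  then show ?thesis by (simp add: mkbox_def)
qed

text \<open>Two rounds of opening can be rearranged. When each segment of the first round is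
  developed further, with segments \<open>S\<close> for its own arguments and a reduct
  \<open>B\<close> of its body, then the lists \<open>S\<close> concatenated treat the whole
  argument list, and the bodies \<open>B\<close>, moved to their positions, form the environment
  \<open>BB\<close>. This is the box case of the triangle property.\<close>

lemma senv_nested:
  assumes "list_all2 (\<lambda>g h. \<exists>S B. list_all2 sd_seg (fst g) S \<and> sd (snd g) B \<and>
      h = (seg_args S, sub (senv S) B) \<and> scoped (length (fst g)) B) gs hs"
  shows "\<exists>SS BB. list_all2 sd_seg (seg_args gs) SS \<and> seg_args SS = seg_args hs \<and>
    (\<forall>i. sd (senv gs i) (BB i)) \<and> (\<forall>i. sub (senv SS) (BB i) = senv hs i)"
  using assms
proof (induction rule: list_all2_induct)
  case Nil
  then show ?case by (intro exI[of _ "[]"] exI[of _ Var]) (auto intro: sd.Var)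
next
  case (Cons g gs h hs)
  then obtain S B SS BB where S: "list_all2 sd_seg (fst g) S" "sd (snd g) B"
    "h = (seg_args S, sub (senv S) B)" "scoped (length (fst g)) B"
    and SS: "list_all2 sd_seg (seg_args gs) SS" "seg_args SS = seg_args hs"
    "\<And>i. sd (senv gs i) (BB i)" "\<And>i. sub (senv SS) (BB i) = senv hs i"
    by blast
  have len: "length S = length (fst g)" using list_all2_lengthD[OF S(1)] by simp
  \<comment> \<open>\<open>B\<close> still lives over the arguments of \<open>g\<close>, hence the
    shift by their number; applying \<open>senv (S @ SS)\<close> later turns it into a shift by the
    number of arguments of \<open>S\<close>.\<close>
  let ?BB = "case_nat B (\<lambda>i. ren (\<lambda>j. length (fst g) + j) (BB i))"
  have "list_all2 sd_seg (seg_args (g # gs)) (S @ SS)"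
    using S(1) SS(1) by (simp add: list_all2_appendI)
  moreover have "seg_args (S @ SS) = seg_args (h # hs)" using S(3) SS(2) by simp
  moreover have "sd (senv (g # gs) i) (?BB i)" for i
    using S(2) SS(3) by (cases i) (auto intro: sd_ren)
  moreover have "sub (senv (S @ SS)) (?BB i) = senv (h # hs) i" for i
  proof (cases i)
    case 0
    have "sub (senv (S @ SS)) B = sub (senv S) B"
      by (rule sub_cong_scoped[OF S(4)]) (simp add: senv_append len)
    with 0 S(3) show ?thesis by simp
  next
    case (Suc j)
    have "sub (senv (S @ SS)) (ren (\<lambda>j. length (fst g) + j) (BB j))
        = sub (ren (\<lambda>j. length (seg_args S) + j) \<circ> senv SS) (BB j)"
      by (simp add: sub_ren comp_def senv_append len)
    also have "\<dots> = ren (\<lambda>j. length (seg_args S) + j) (senv hs j)"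
      by (simp add: ren_sub[symmetric] SS(4))
    finally show ?thesis using Suc S(3) by simp
  qed
  ultimately show ?case by blast
qed

text \<open>Takahashi's argument: whatever a step from \<open>M\<close> has left undone, a further
  step completes to \<open>star M\<close>. Two steps from \<open>M\<close> therefore meet in
  \<open>star M\<close>, with no comparison of pairs of redexes.\<close>

lemma triangle: "sd M N \<Longrightarrow> scoped n M \<Longrightarrow> sd N (star M)"
proof (induction arbitrary: n rule: sd.induct)
  case (App M M' N N')
  then have "sd M' (star M)" "sd N' (star N)" by auto
  \<comment> \<open>If \<open>star M\<close> is an abstraction, \<open>star\<close> contracts a
    redex that the given step left alone, and \<open>sd.beta\<close> catches up.\<close>
  then show ?case by (cases "star M") (auto intro: sd.App sd.beta)
next
  case (beta M \<sigma> P N N')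
  then have "sd (Lam \<sigma> P) (star M)" "sd N' (star N)" by auto
  then show ?case by (auto dest!: sd_Lam_inv intro: sd_sub0)
next
  case (box ps gs M M')
  let ?hs = "map (\<lambda>p. opened (fst p) (star (snd p))) ps"
  have sM: "sd M' (star M)" using box by auto
  have "list_all2 (\<lambda>g h. \<exists>S B. list_all2 sd_seg (fst g) S \<and> sd (snd g) B \<and>
      h = (seg_args S, sub (senv S) B) \<and> scoped (length (fst g)) B) gs ?hs"
  proof (rule list_all2_all_nthI)
    show len: "length gs = length ?hs" using list_all2_lengthD[OF box.IH(1)] by simp
    fix i assume i: "i < length gs"
    define p g where "p = ps ! i" and "g = gs ! i"
    from len i have p: "p \<in> set ps" by (simp add: p_def)
    from list_all2_nthD2[OF box.IH(1) i] obtain N' where N': "sd (snd p) N'"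
      "\<And>n. scoped n (snd p) \<Longrightarrow> sd N' (star (snd p))" "opens (fst p) N' g"
      by (auto simp: p_def g_def)
    have sc: "scoped n (snd p)" using box.prems p by auto
    then have scN': "scoped n N'" using N'(1) sd_scoped by blast
    have tri: "sd N' (star (snd p))" using N'(2) sc .
    have scs: "scoped n (star (snd p))" using sd_scoped[OF tri scN'] .
    from N'(3)[unfolded opens_def] have "\<exists>S B. list_all2 sd_seg (fst g) S \<and> sd (snd g) B \<and>
        opened (fst p) (star (snd p)) = (seg_args S, sub (senv S) B) \<and> scoped (length (fst g)) B"
    proof
      \<comment> \<open>The first step left this argument closed; the completing step opens it as a
        single segment if its development is a box.\<close>
      assume g: "g = keep (fst p, N')"
      let ?h = "opened (fst p) (star (snd p))"
      have "list_all2 sd_seg (fst g) [?h]"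
        using tri opens_opened[OF scs] g by (auto simp: keep_def)
      moreover have "?h = (seg_args [?h], sub (senv [?h]) (Var 0))" by simp
      moreover have "sd (snd g) (Var 0)" "scoped (length (fst g)) (Var 0 :: ('a, 'b) tm)"
        using g by (simp_all add: sd.Var)
      ultimately show ?thesis by blast
    next
      \<comment> \<open>The argument has been opened already; the completing step acts on its
        arguments and its body separately.\<close>
      assume N'_eq: "N' = mkbox (fst g) (snd g)"
      with tri sd_mkbox_inv obtain S B where S: "star (snd p) = asm S B" "list_all2 sd_seg (fst g) S" "sd (snd g) B"
        by blast
      moreover have "scoped (length (fst g)) B" using sd_scoped[OF S(3)] scN' N'_eq by simp
      ultimately show ?thesis by (auto simp: asm_def)
    qed
    then show "\<exists>S B. list_all2 sd_seg (fst (gs ! i)) S \<and> sd (snd (gs ! i)) B \<and>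
        ?hs ! i = (seg_args S, sub (senv S) B) \<and> scoped (length (fst (gs ! i))) B"
      using i len by (simp add: p_def g_def)
  qed
  from senv_nested[OF this] obtain SS BB where SS: "list_all2 sd_seg (seg_args gs) SS"
    "seg_args SS = seg_args ?hs" "\<And>i. sd (senv gs i) (BB i)" "\<And>i. sub (senv SS) (BB i) = senv ?hs i"
    by blast
  have "sd (mkbox (seg_args gs) (sub (senv gs) M')) (asm SS (sub BB (star M)))"
    using SS(1) sd_sub[OF sM SS(3)] by (rule sd.box)
  also have "asm SS (sub BB (star M)) = star (mkbox ps M)"
    by (simp add: asm_def star_mkbox SS sub_sub comp_def)
  finally show ?case by (simp add: asm_def)
qed (auto intro: sd.intros)

text \<open>Relates simultaneous opening to the one-step rule: once the segments on the left are
  opened, a single flattening opens the next argument. Scoping keeps the bodies on the left away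
  from the slot that is replaced.\<close>

lemma flat_sub_senv:
  assumes "\<And>g. g \<in> set gs \<Longrightarrow> scoped (length (fst g)) (snd g)"
  shows "flat_sub (length (seg_args gs)) (length (fst h)) (snd h) (senv (gs @ keep p # ks) i)
    = senv (gs @ h # ks) i"
  using assms
proof (induction gs arbitrary: i)
  case Nil
  show ?case
  proof (cases i)
    case 0
    then show ?thesis using ren_id by (simp add: flat_sub_def keep_def)
  next
    case (Suc j)
    have "ren (\<lambda>j. length (fst h) + j) (senv ks j) = sub (\<lambda>x. Var (x + length (fst h))) (senv ks j)"
      by (simp add: ren_as_sub comp_def add.commute)
    with Suc show ?thesis by (simp add: flat_sub_def sub_ren comp_def)
  qed
next
  case (Cons g gs)
  let ?n = "length (seg_args gs)" and ?m = "length (fst h)" and ?l = "length (fst g)"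
  show ?case
  proof (cases i)
    case 0
    have "flat_sub (?l + ?n) ?m (snd h) (snd g) = sub Var (snd g)" unfolding flat_sub_def
      by (rule sub_cong_scoped[of ?l]) (use Cons.prems in auto)
    with 0 show ?thesis by simp
  next
    case (Suc j)
    have "flat_sub (?l + ?n) ?m (snd h) (ren (\<lambda>j. ?l + j) X) = ren (\<lambda>j. ?l + j) (flat_sub ?n ?m (snd h) X)" for X
      unfolding flat_sub_def sub_ren ren_sub
      by (rule arg_cong[of _ _ "\<lambda>s. sub s X"]) (auto simp: fun_eq_iff ren_ren comp_def add.assoc[abs_def])
    with Suc Cons show ?thesis by simp
  qed
qed

lemma red1_open:
  assumes "\<And>g. g \<in> set gs \<Longrightarrow> scoped (length (fst g)) (snd g)" "opens (fst p) (snd p) h"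
  shows "red1\<^sup>=\<^sup>= (asm (gs @ keep p # ks) M) (asm (gs @ h # ks) M)"
  using assms(2) unfolding opens_def
proof
  assume p: "snd p = mkbox (fst h) (snd h)"
  have "flat_sub (length (seg_args gs)) (length (fst h)) (snd h) (sub (senv (gs @ keep p # ks)) M)
      = sub (senv (gs @ h # ks)) M"
    using flat_sub_senv[OF assms(1)] by (simp add: flat_sub_def sub_sub comp_def)
  moreover have "beta_flat
     (Box (map fst (seg_args gs) @ fst p # map fst (seg_args ks))
        (map snd (seg_args gs) @ Box (map fst (fst h)) (map snd (fst h)) (snd h) # map snd (seg_args ks)) X)
     (Box (map fst (seg_args gs) @ map fst (fst h) @ map fst (seg_args ks))
        (map snd (seg_args gs) @ map snd (fst h) @ map snd (seg_args ks))
        (flat_sub (length (map fst (seg_args gs))) (length (map fst (fst h))) (snd h) X))" for X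
    by (rule beta_flat.flat) simp_all
  from this[of "sub (senv (gs @ keep p # ks)) M", THEN compat.root[of beta_flat]] p
  have "red1 (asm (gs @ keep p # ks) M)
     (Box (map fst (seg_args gs) @ map fst (fst h) @ map fst (seg_args ks))
        (map snd (seg_args gs) @ map snd (fst h) @ map snd (seg_args ks))
        (flat_sub (length (seg_args gs)) (length (fst h)) (snd h) (sub (senv (gs @ keep p # ks)) M)))"
    by (simp add: asm_def mkbox_def)
  ultimately show ?thesis by (auto simp: asm_def mkbox_def)
qed auto

text \<open>Arguments are opened from left to right; \<open>hs\<close> collects the segments that
  are done.\<close>

lemma red1_opens:
  assumes "list_all2 (\<lambda>p g. opens (fst p) (snd p) g \<and> scoped (length (fst g)) (snd g)) ps gs"
  shows "(\<And>g. g \<in> set hs \<Longrightarrow> scoped (length (fst g)) (snd g)) \<Longrightarrow>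
    red1\<^sup>*\<^sup>* (asm (hs @ map keep ps) M) (asm (hs @ gs) M)"
  using assms
proof (induction arbitrary: hs rule: list_all2_induct)
  case (Cons p ps g gs)
  have "red1\<^sup>=\<^sup>= (asm (hs @ keep p # map keep ps) M) (asm (hs @ g # map keep ps) M)"
    by (rule red1_open) (use Cons in auto)
  moreover have "red1\<^sup>*\<^sup>* (asm ((hs @ [g]) @ map keep ps) M) (asm ((hs @ [g]) @ gs) M)"
    by (rule Cons.IH) (use Cons in auto)
  ultimately show ?case by (auto intro: converse_rtranclp_into_rtranclp)
qed simp

lemma sd_red1: "sd M N \<Longrightarrow> scoped n M \<Longrightarrow> red1\<^sup>*\<^sup>* M N"
proof (induction arbitrary: n rule: sd.induct)
  case (Lam M M' \<sigma>)
  then show ?case by (auto intro: compat_rtranclp_Lam)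
next
  case (App M M' N N')
  then show ?case by (auto intro: compat_rtranclp_App)
next
  case (beta M \<sigma> P N N')
  then have "red1\<^sup>*\<^sup>* (App M N) (App (Lam \<sigma> P) N')" by (auto intro: compat_rtranclp_App)
  moreover have "red1 (App (Lam \<sigma> P) N') (sub0 N' P)" by (intro compat.root beta_flat.beta)
  ultimately show ?case by simp
next
  case (box ps gs M M')
  \<comment> \<open>The simultaneous step is split: the arguments reduce in place to
    \<open>qs\<close>, and then those chosen for it are opened.\<close>
  have "\<exists>qs. list_all2 (\<lambda>p q. red1\<^sup>*\<^sup>* (snd p) (snd q) \<and> fst p = fst q) ps qs \<and>
    list_all2 (\<lambda>q g. opens (fst q) (snd q) g \<and> scoped (length (fst g)) (snd g)) qs gs"
  proof -
    have "list_all2 (\<lambda>p g. \<exists>q. red1\<^sup>*\<^sup>* (snd p) (snd q) \<and> fst p = fst q \<and>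
      opens (fst q) (snd q) g \<and> scoped (length (fst g)) (snd g)) ps gs"
    proof (rule list_all2_all_nthI)
      show "length ps = length gs" using list_all2_lengthD[OF box.IH(1)] .
      fix i assume i: "i < length ps"
      from list_all2_nthD[OF box.IH(1) i] obtain N' where N': "sd (snd (ps ! i)) N'"
        "\<And>n. scoped n (snd (ps ! i)) \<Longrightarrow> red1\<^sup>*\<^sup>* (snd (ps ! i)) N'" "opens (fst (ps ! i)) N' (gs ! i)"
        by auto
      have sc: "scoped n (snd (ps ! i))" using box.prems i by auto
      from sd_scoped[OF N'(1) sc] opens_scoped[OF N'(3)] N' sc
      show "\<exists>q. red1\<^sup>*\<^sup>* (snd (ps ! i)) (snd q) \<and> fst (ps ! i) = fst q \<and>
        opens (fst q) (snd q) (gs ! i) \<and> scoped (length (fst (gs ! i))) (snd (gs ! i))"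
        by (intro exI[of _ "(fst (ps ! i), N')"]) auto
    qed
    then show ?thesis
    proof (induction rule: list_all2_induct)
      case (Cons p ps g gs)
      then obtain q qs where "red1\<^sup>*\<^sup>* (snd p) (snd q) \<and> fst p = fst q \<and>
          opens (fst q) (snd q) g \<and> scoped (length (fst g)) (snd g)"
        "list_all2 (\<lambda>p q. red1\<^sup>*\<^sup>* (snd p) (snd q) \<and> fst p = fst q) ps qs"
        "list_all2 (\<lambda>q g. opens (fst q) (snd q) g \<and> scoped (length (fst g)) (snd g)) qs gs" by blast
      then show ?case by (intro exI[of _ "q # qs"]) simp
    qed simp
  qed
  then obtain qs where qs: "list_all2 (\<lambda>p q. red1\<^sup>*\<^sup>* (snd p) (snd q) \<and> fst p = fst q) ps qs"
    "list_all2 (\<lambda>q g. opens (fst q) (snd q) g \<and> scoped (length (fst g)) (snd g)) qs gs" by blast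
  from qs(1) have "map fst qs = map fst ps"
    by (induction rule: list_all2_induct) auto
  moreover from qs(1) have "list_all2 red1\<^sup>*\<^sup>* (map snd ps) (map snd qs)"
    by (auto simp: list.rel_map elim: list_all2_mono)
  moreover have "red1\<^sup>*\<^sup>* M M'" using box by auto
  ultimately have "red1\<^sup>*\<^sup>* (mkbox ps M) (mkbox qs M')"
    unfolding mkbox_def by (simp add: compat_rtranclp_Box)
  also have "mkbox qs M' = asm ([] @ map keep qs) M'" by (simp add: asm_keep)
  also have "red1\<^sup>*\<^sup>* \<dots> (asm ([] @ gs) M')" by (rule red1_opens[OF qs(2)]) simp
  finally show ?case by simp
qed simp_all

lemma sd_seg_keep: "(\<And>p. p \<in> set ps \<Longrightarrow> sd (snd p) (snd p)) \<Longrightarrow> list_all2 sd_seg ps (map keep ps)"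
proof (rule list_all2_all_nthI)
  fix i assume "\<And>p. p \<in> set ps \<Longrightarrow> sd (snd p) (snd p)" "i < length ps"
  then show "sd_seg (ps ! i) (map keep ps ! i)"
    by (intro exI[of _ "snd (ps ! i)"]) (simp add: opens_def)
qed simp

lemma red1_sd: "red1 M N \<Longrightarrow> scoped n M \<Longrightarrow> sd M N"
proof (induction arbitrary: n rule: compat.induct)
  case (root M M')
  from root.hyps show ?case
  proof (cases rule: beta_flat.cases)
    case (beta \<sigma> A N)
    with root.prems show ?thesis by (auto intro!: sd.beta sd.Lam sd_refl)
  next
    case (flat ws Ps ys Ls \<sigma> zs N Qs B)
    let ?p = "(\<sigma>, Box ys Ls N)" and ?h = "(zip ys Ls, N)"
    let ?ps = "zip ws Ps @ ?p # zip zs Qs"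
    \<comment> \<open>A single flattening is the superdevelopment that opens exactly one argument
      and keeps all others.\<close>
    let ?gs = "map keep (zip ws Ps) @ ?h # map keep (zip zs Qs)"
    from root.prems flat have len: "length zs = length Qs" by simp
    with flat have M: "M = mkbox ?ps B" by (simp add: mkbox_def)
    have h: "opens \<sigma> (Box ys Ls N) ?h" using flat by (simp add: opens_def Box_eq_mkbox)
    have "sd (snd p) (snd p)" if "p \<in> set ?ps" for p
      by (rule sd_refl[of n]) (use that root.prems M in auto)
    moreover from this[of ?p] have "sd_seg ?p ?h" using h by auto
    ultimately have "list_all2 sd_seg (zip ws Ps) (map keep (zip ws Ps))"
      "list_all2 sd_seg (zip zs Qs) (map keep (zip zs Qs))" "sd_seg ?p ?h"
      by (auto intro!: sd_seg_keep)
    then have "list_all2 sd_seg ?ps ?gs" by (simp add: list_all2_appendI)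
    then have "sd M (asm ?gs B)" unfolding M
      by (rule sd.box) (use root.prems M in \<open>auto intro: sd_refl\<close>)
    moreover have "sub (senv ?gs) B = flat_sub (length ws) (length ys) N B"
    proof -
      have "senv ?gs i = flat_sub (length ws) (length ys) N (Var i)" for i
      proof -
        have "flat_sub (length (seg_args (map keep (zip ws Ps)))) (length (fst ?h)) (snd ?h)
          (senv (map keep (zip ws Ps) @ keep ?p # map keep (zip zs Qs)) i) = senv ?gs i"
          by (rule flat_sub_senv) (auto simp: keep_def)
        moreover have "map keep (zip ws Ps) @ keep ?p # map keep (zip zs Qs) = map keep ?ps" by simp
        ultimately show ?thesis using flat by (simp only: seg_args_keep senv_keep) simp
      qed
      then have "senv ?gs = (\<lambda>i. flat_sub (length ws) (length ys) N (Var i))" by (rule ext)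
      then show ?thesis by (simp add: flat_sub_def)
    qed
    ultimately show ?thesis using flat len by (simp add: asm_def mkbox_def)
  qed
next
  case (lam M M' \<sigma>)
  then show ?case by (auto intro: sd.Lam)
next
  case (appL M M' N)
  then show ?case by (auto intro: sd.App sd_refl)
next
  case (appR N N' M)
  then show ?case by (auto intro: sd.App sd_refl)
next
  case (boxArg N N' ts Ps Qs M)
  then have "length ts = length (Ps @ N # Qs)" by simp
  then have "list_all2 (\<lambda>_ _. True) (Ps @ N # Qs) ts" by (auto simp: list_all2_conv_all_nth)
  then obtain ws \<sigma> zs where ts: "ts = ws @ \<sigma> # zs" "length ws = length Ps" "length zs = length Qs"
    by (auto simp: list_all2_append1 list_all2_Cons1 dest: list_all2_lengthD)
  let ?gs = "map keep (zip ws Ps @ (\<sigma>, N') # zip zs Qs)"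
  let ?ps = "zip ws Ps @ (\<sigma>, N) # zip zs Qs"
  have M: "Box ts (Ps @ N # Qs) M = mkbox ?ps M" "Box ts (Ps @ N' # Qs) M = asm ?gs M"
    unfolding asm_keep using ts by (simp_all add: mkbox_def)
  have "sd (snd p) (snd p)" if "p \<in> set (zip ws Ps) \<union> set (zip zs Qs)" for p
    by (rule sd_refl[of n]) (use that boxArg.prems M in auto)
  moreover have "sd N N'" using boxArg by auto
  then have "sd_seg (\<sigma>, N) (keep (\<sigma>, N'))" by (auto simp: opens_def)
  ultimately have "list_all2 sd_seg ?ps ?gs"
    by (simp add: list_all2_appendI sd_seg_keep)
  then show ?case unfolding M
    by (rule sd.box) (use boxArg.prems M in \<open>auto intro: sd_refl\<close>)
next
  case (boxBody M M' ts Ns)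
  have M: "Box ts Ns X = mkbox (zip ts Ns) X" for X using boxBody.prems by (simp add: Box_eq_mkbox)
  have "sd (snd p) (snd p)" if "p \<in> set (zip ts Ns)" for p
    by (rule sd_refl[of n]) (use that boxBody.prems M in auto)
  then have "list_all2 sd_seg (zip ts Ns) (map keep (zip ts Ns))"
    by (rule sd_seg_keep)
  then have "sd (mkbox (zip ts Ns) M) (asm (map keep (zip ts Ns)) M')"
    by (rule sd.box) (use boxBody in auto)
  then show ?case by (simp only: M asm_keep)
qed


section \<open>Confluence of the typed call-by-name calculus\<close>

definition commute :: "('a \<Rightarrow> 'a \<Rightarrow> bool) \<Rightarrow> ('a \<Rightarrow> 'a \<Rightarrow> bool) \<Rightarrow> bool" where
  "commute r s \<longleftrightarrow> (\<forall>x y z. r x y \<longrightarrow> s x z \<longrightarrow> (\<exists>u. s y u \<and> r z u))"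

lemma commuteD: "commute r s \<Longrightarrow> r x y \<Longrightarrow> s x z \<Longrightarrow> \<exists>u. s y u \<and> r z u"
  unfolding commute_def by blast

lemma commute_sym: "commute r s \<Longrightarrow> commute s r"
  unfolding commute_def by blast

lemma commute_rtranclp_left: "commute r s \<Longrightarrow> commute r\<^sup>*\<^sup>* s"
proof -
  assume c: "commute r s"
  have "\<exists>u. s y u \<and> r\<^sup>*\<^sup>* z u" if "r\<^sup>*\<^sup>* x y" "s x z" for x y z
    using that
  proof (induction rule: rtranclp_induct)
    case (step y y')
    then obtain u where "s y u" "r\<^sup>*\<^sup>* z u" by blast
    with commuteD[OF c \<open>r y y'\<close>] show ?case by (meson rtranclp.rtrancl_into_rtrancl)
  qed blast
  then show ?thesis unfolding commute_def by blast
qed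

lemma commute_rtranclp: "commute r s \<Longrightarrow> commute r\<^sup>*\<^sup>* s\<^sup>*\<^sup>*"
  by (metis commute_rtranclp_left commute_sym)

text \<open>Hindley's strong commutation. Since an \<open>r\<close> step is answered by at most one
  \<open>r\<close> step, it can be pushed along a whole \<open>s\<close> reduction without
  multiplying; repeating this handles several \<open>r\<close> steps.\<close>

lemma commute_strong:
  assumes "\<And>x y z. r x y \<Longrightarrow> s x z \<Longrightarrow> \<exists>u. s\<^sup>*\<^sup>* y u \<and> r\<^sup>=\<^sup>= z u"
  shows "commute r\<^sup>*\<^sup>* s\<^sup>*\<^sup>*"
proof -
  have "\<exists>u. s\<^sup>*\<^sup>* y u \<and> r\<^sup>=\<^sup>= z u" if "s\<^sup>*\<^sup>* x z" "r\<^sup>=\<^sup>= x y" for x y z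
    using that
  proof (induction rule: rtranclp_induct)
    case (step z z')
    then obtain u where u: "s\<^sup>*\<^sup>* y u" "r\<^sup>=\<^sup>= z u" by blast
    show ?case
    proof (cases "z = u")
      case True
      with u step.hyps(2) show ?thesis by (intro exI[of _ z']) auto
    next
      case False
      with u assms step.hyps(2) obtain v where "s\<^sup>*\<^sup>* u v" "r\<^sup>=\<^sup>= z' v" by blast
      with u show ?thesis by (meson rtranclp_trans)
    qed
  qed blast
  then have "commute r\<^sup>=\<^sup>= s\<^sup>*\<^sup>*" unfolding commute_def by blast
  from commute_rtranclp_left[OF this] show ?thesis by simp
qed

text \<open>The Hindley-Rosen lemma.\<close>

lemma commute_union:
  assumes "commute r\<^sup>*\<^sup>* r\<^sup>*\<^sup>*" "commute s\<^sup>*\<^sup>* s\<^sup>*\<^sup>*" "commute r\<^sup>*\<^sup>* s\<^sup>*\<^sup>*"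
  shows "commute (sup r s)\<^sup>*\<^sup>* (sup r s)\<^sup>*\<^sup>*"
proof -
  have "commute (sup r\<^sup>*\<^sup>* s\<^sup>*\<^sup>*) r\<^sup>*\<^sup>*" "commute (sup r\<^sup>*\<^sup>* s\<^sup>*\<^sup>*) s\<^sup>*\<^sup>*"
    using assms unfolding commute_def sup_fun_def sup_bool_def by blast+
  from this[THEN commute_rtranclp_left]
  have "commute (sup r\<^sup>*\<^sup>* s\<^sup>*\<^sup>*)\<^sup>*\<^sup>* (sup r\<^sup>*\<^sup>* s\<^sup>*\<^sup>*)"
    unfolding commute_def sup_fun_def sup_bool_def by blast
  from commute_rtranclp[OF this] show ?thesis by (simp add: rtranclp_sup_rtranclp)
qed

text \<open>Reduction as an abstract relation on the terms of one type in one context, so that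
  commutation results depending on typing become unconditional statements about relations.\<close>

definition tred :: "('c \<Rightarrow> 'p ty) \<Rightarrow> 'p ty list \<Rightarrow> 'p ty \<Rightarrow> (('p, 'c) tm \<Rightarrow> ('p, 'c) tm \<Rightarrow> bool) \<Rightarrow>
    ('p, 'c) tm \<Rightarrow> ('p, 'c) tm \<Rightarrow> bool" where
  "tred Sig \<Gamma> \<tau> r M N \<longleftrightarrow> typing Sig \<Gamma> M \<tau> \<and> typing Sig \<Gamma> N \<tau> \<and> r M N"

lemma typing_rtranclp:
  "r\<^sup>*\<^sup>* M N \<Longrightarrow> (\<And>M N. r M N \<Longrightarrow> typing Sig \<Gamma> M \<tau> \<Longrightarrow> typing Sig \<Gamma> N \<tau>) \<Longrightarrow>
   typing Sig \<Gamma> M \<tau> \<Longrightarrow> typing Sig \<Gamma> N \<tau> \<and> (tred Sig \<Gamma> \<tau> r)\<^sup>*\<^sup>* M N"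
  by (induction rule: rtranclp_induct)
    (auto simp: tred_def intro: rtranclp.rtrancl_into_rtrancl)

text \<open>On typed terms \<open>sd\<close> lies between one step and many steps of
  \<open>red1\<close>, so the diamond that the triangle property gives for \<open>sd\<close> is
  confluence of \<open>red1\<close>.\<close>

lemma commute_red1: "commute (tred Sig \<Gamma> \<tau> red1)\<^sup>*\<^sup>* (tred Sig \<Gamma> \<tau> red1)\<^sup>*\<^sup>*"
proof -
  have sd_tred: "typing Sig \<Gamma> N \<tau> \<and> (tred Sig \<Gamma> \<tau> red1)\<^sup>*\<^sup>* M N" if "sd M N" "typing Sig \<Gamma> M \<tau>" for M N
    by (rule typing_rtranclp[OF sd_red1[OF that(1) typing_scoped[OF that(2)]] _ that(2)])
      (rule typing_red1)
  have "commute (tred Sig \<Gamma> \<tau> sd) (tred Sig \<Gamma> \<tau> sd)"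
    unfolding commute_def tred_def
    by (meson sd_tred triangle typing_scoped)
  then have c: "commute (tred Sig \<Gamma> \<tau> sd)\<^sup>*\<^sup>* (tred Sig \<Gamma> \<tau> sd)\<^sup>*\<^sup>*" by (rule commute_rtranclp)
  have "(tred Sig \<Gamma> \<tau> sd)\<^sup>*\<^sup>* = (tred Sig \<Gamma> \<tau> red1)\<^sup>*\<^sup>*"
  proof (rule rtranclp_subset)
    show "tred Sig \<Gamma> \<tau> red1 \<le> tred Sig \<Gamma> \<tau> sd"
      using red1_sd typing_scoped by (fastforce simp: tred_def)
    show "tred Sig \<Gamma> \<tau> sd \<le> (tred Sig \<Gamma> \<tau> red1)\<^sup>*\<^sup>*"
      using sd_tred by (auto simp: tred_def)
  qed
  with c show ?thesis by simp
qed

lemma commute_tred_red2: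
  assumes step: "\<And>x y z. r x y \<Longrightarrow> red2 x z \<Longrightarrow> typing Sig \<Gamma> x \<tau> \<Longrightarrow> \<exists>u. red2\<^sup>*\<^sup>* y u \<and> r\<^sup>=\<^sup>= z u"
    and r: "\<And>x y. r x y \<Longrightarrow> typing Sig \<Gamma> x \<tau> \<Longrightarrow> typing Sig \<Gamma> y \<tau>"
  shows "commute (tred Sig \<Gamma> \<tau> r)\<^sup>*\<^sup>* (tred Sig \<Gamma> \<tau> red2)\<^sup>*\<^sup>*"
proof (rule commute_strong)
  fix x y z
  assume a: "tred Sig \<Gamma> \<tau> r x y" "tred Sig \<Gamma> \<tau> red2 x z"
  then obtain u where u: "red2\<^sup>*\<^sup>* y u" "r\<^sup>=\<^sup>= z u" unfolding tred_def using step by blast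
  from a have "typing Sig \<Gamma> y \<tau>" "typing Sig \<Gamma> z \<tau>" by (simp_all add: tred_def)
  then have "(tred Sig \<Gamma> \<tau> red2)\<^sup>*\<^sup>* y u" "(tred Sig \<Gamma> \<tau> r)\<^sup>=\<^sup>= z u"
    using typing_rtranclp[OF u(1) typing_red2] u(2) r by (auto simp: tred_def)
  then show "\<exists>u. (tred Sig \<Gamma> \<tau> red2)\<^sup>*\<^sup>* y u \<and> (tred Sig \<Gamma> \<tau> r)\<^sup>=\<^sup>= z u" by blast
qed

lemma cbn_confluent: "commute (tred Sig \<Gamma> \<tau> cbn_red)\<^sup>*\<^sup>* (tred Sig \<Gamma> \<tau> cbn_red)\<^sup>*\<^sup>*"
proof -
  have "tred Sig \<Gamma> \<tau> cbn_red = sup (tred Sig \<Gamma> \<tau> red1) (tred Sig \<Gamma> \<tau> red2)"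
    by (auto simp: fun_eq_iff tred_def cbn_red_iff)
  moreover have "commute (tred Sig \<Gamma> \<tau> red1)\<^sup>*\<^sup>* (tred Sig \<Gamma> \<tau> red2)\<^sup>*\<^sup>*"
    by (rule commute_tred_red2) (erule (2) red1_red2_commute, erule (1) typing_red1)
  moreover have "commute (tred Sig \<Gamma> \<tau> red2)\<^sup>*\<^sup>* (tred Sig \<Gamma> \<tau> red2)\<^sup>*\<^sup>*"
    by (rule commute_tred_red2) (erule (2) red2_red2_commute, erule (1) typing_red2)
  ultimately show ?thesis by (simp add: commute_union commute_red1)
qed

lemma cbn_eq_joinable:
  assumes "cbn_eq Sig \<Gamma> \<tau> M N"
  shows "\<exists>P. (tred Sig \<Gamma> \<tau> cbn_red)\<^sup>*\<^sup>* M P \<and> (tred Sig \<Gamma> \<tau> cbn_red)\<^sup>*\<^sup>* N P"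
proof -
  from assms have "equivclp (tred Sig \<Gamma> \<tau> cbn_red) M N"
    unfolding cbn_eq_def tred_def .
  then show ?thesis
  proof (induction rule: equivclp_induct)
    case (step y z)
    then obtain P where P: "(tred Sig \<Gamma> \<tau> cbn_red)\<^sup>*\<^sup>* M P" "(tred Sig \<Gamma> \<tau> cbn_red)\<^sup>*\<^sup>* y P" by blast
    from step(2) show ?case
    proof
      assume "tred Sig \<Gamma> \<tau> cbn_red y z"
      with commuteD[OF cbn_confluent P(2) r_into_rtranclp] P(1) show ?thesis
        by (meson rtranclp_trans)
    next
      assume "tred Sig \<Gamma> \<tau> cbn_red z y"
      with P show ?thesis by (meson converse_rtranclp_into_rtranclp)
    qed
  qed blast
qed

section \<open>Equational reasoning in the call-by-value calculus\<close>

lemma is_val_ren [simp]: "is_val (ren f M) = is_val M"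
  by (induction M arbitrary: f) auto

lemma restricted_ren [simp]: "restricted (ren f M) = restricted M"
  by (induction M arbitrary: f) auto

lemma restricted_sub: "restricted M \<Longrightarrow> (\<And>i. restricted (s i)) \<Longrightarrow> restricted (sub s M)"
proof (induction M arbitrary: s)
  case (Lam \<sigma> M)
  have "restricted (up_sub s i)" for i using Lam.prems(2) by (cases i) auto
  with Lam show ?case by simp
qed auto

lemma restricted_sub0: "restricted M \<Longrightarrow> restricted N \<Longrightarrow> restricted (sub0 N M)"
  unfolding sub0_def by (rule restricted_sub) (auto split: nat.split)

primrec ren_sctx :: "(nat \<Rightarrow> nat) \<Rightarrow> ('p, 'c) sctx \<Rightarrow> ('p, 'c) sctx" where
  "ren_sctx f (CFun M) = CFun (ren f M)"
| "ren_sctx f (CArg V) = CArg (ren f V)"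
| "ren_sctx f (CBox ts Vs Ms M) = CBox ts (map (ren f) Vs) (map (ren f) Ms) M"

lemma ren_plug: "ren f (plug C M) = plug (ren_sctx f C) (ren f M)"
  by (cases C) auto

lemma sctx_ok_ren [simp]: "sctx_ok (ren_sctx f C) = sctx_ok C"
  by (cases C) auto

lemma ren_up_lift_sctx: "ren_sctx (up_ren f) (lift_sctx C) = lift_sctx (ren_sctx f C)"
  by (cases C) (auto simp: ren_up_lift)

lemma ren_plugs: "ren f (plugs E M) = plugs (map (ren_sctx f) E) (ren f M)"
  by (induction E) (auto simp: plugs_def ren_plug)

lemma cbv_root_ren: "cbv_root M N \<Longrightarrow> cbv_root (ren f M) (ren f N)"
proof (induction rule: cbv_root.induct)
  case (ident \<sigma> M)
  then show ?case by (simp add: cbv_root.ident)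
next
  case (beta_v V \<sigma> M)
  then show ?case by (simp add: ren_sub0 cbv_root.beta_v)
next
  case (eta_v V \<sigma>)
  then show ?case using cbv_root.eta_v[of "ren f V" \<sigma>] by (simp add: ren_up_lift)
next
  case (lift C \<sigma> M N)
  then show ?case by (simp add: ren_plug ren_up_lift_sctx cbv_root.lift)
next
  case (flat C y M \<sigma>)
  then have "\<forall>V. ren_sctx f C \<noteq> CArg V" by (cases C) auto
  with flat cbv_root.flat[of "ren_sctx f C" "f y" "ren f M" \<sigma>] show ?case
    by (simp add: ren_plug ren_up_lift_sctx)
next
  case (eval E \<sigma> y M)
  have "map (ren_sctx (up_ren f)) (map lift_sctx E) = map lift_sctx (map (ren_sctx f) E)"
    by (simp add: ren_up_lift_sctx)
  moreover have "\<forall>C \<in> set (map (ren_sctx f) E). sctx_ok C" using eval by auto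
  note cbv_root.eval[OF this, of \<sigma> "f y" "ren f M"]
  ultimately show ?case by (simp only: ren.simps ren_plugs up_ren.simps)
next
  case (box_id_v \<sigma> M)
  then show ?case by (simp add: cbv_root.box_id_v)
next
  case (box_flat_v ws Ws ys Ns V \<sigma> zs Ps M)
  then show ?case
    using cbv_root.box_flat_v[of ws "map (ren f) Ws" ys "map (ren f) Ns" V \<sigma> zs "map (ren f) Ps" M] by simp
qed

lemma cbv_red_ren: "cbv_red M N \<Longrightarrow> cbv_red (ren f M) (ren f N)"
  unfolding cbv_red_def
  by (induction arbitrary: f rule: compat.induct) (auto intro: compat.intros cbv_root_ren)

text \<open>
  The body of a box has to remain a value, so that equality of values is generated by chains
  of values; this is \<open>veq is_val\<close>.
\<close>

definition veq :: "(('p, 'c) tm \<Rightarrow> bool) \<Rightarrow> ('c \<Rightarrow> 'p ty) \<Rightarrow> 'p ty list \<Rightarrow> 'p ty \<Rightarrow>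
    ('p, 'c) tm \<Rightarrow> ('p, 'c) tm \<Rightarrow> bool" where
  "veq Q Sig \<Gamma> \<tau> = equivclp (\<lambda>M N. (cbv_typing Sig \<Gamma> M \<tau> \<and> Q M) \<and> (cbv_typing Sig \<Gamma> N \<tau> \<and> Q N) \<and> cbv_red M N)"

lemma cbv_eq_veq: "cbv_eq = veq (\<lambda>_. True)"
  by (simp add: cbv_eq_def veq_def fun_eq_iff)

lemma veq_refl [simp]: "veq Q Sig \<Gamma> \<tau> M M"
  unfolding veq_def by (rule equivclp_refl)

lemma veq_sym: "veq Q Sig \<Gamma> \<tau> M N \<Longrightarrow> veq Q Sig \<Gamma> \<tau> N M"
  unfolding veq_def by (rule equivclp_sym)

lemma veq_trans [trans]: "veq Q Sig \<Gamma> \<tau> M N \<Longrightarrow> veq Q Sig \<Gamma> \<tau> N P \<Longrightarrow> veq Q Sig \<Gamma> \<tau> M P"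
  unfolding veq_def by (rule equivclp_trans)

lemma veq_step:
  "cbv_root M N \<Longrightarrow> cbv_typing Sig \<Gamma> M \<tau> \<Longrightarrow> cbv_typing Sig \<Gamma> N \<tau> \<Longrightarrow> Q M \<Longrightarrow> Q N \<Longrightarrow> veq Q Sig \<Gamma> \<tau> M N"
  unfolding veq_def cbv_red_def by (rule r_into_equivclp) (auto intro: compat.root)

text \<open>The source of all congruence rules: \<open>F\<close> is a context, and the last premise
  keeps the transported chain well typed and inside the predicate \<open>Q'\<close>.\<close>

lemma veq_map:
  assumes "veq Q Sig \<Gamma> \<tau> M N"
    and "\<And>M N. cbv_red M N \<Longrightarrow> cbv_red (F M) (F N)"
    and "\<And>M. cbv_typing Sig \<Gamma> M \<tau> \<Longrightarrow> Q M \<Longrightarrow> cbv_typing Sig \<Delta> (F M) \<rho> \<and> Q' (F M)"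
  shows "veq Q' Sig \<Delta> \<rho> (F M) (F N)"
  using assms(1) unfolding veq_def
proof (induction rule: equivclp_induct)
  case (step N P)
  then have "cbv_typing Sig \<Gamma> N \<tau> \<and> Q N" "cbv_typing Sig \<Gamma> P \<tau> \<and> Q P" "cbv_red N P \<or> cbv_red P N" by auto
  with assms(2,3) have "(cbv_typing Sig \<Delta> (F N) \<rho> \<and> Q' (F N)) \<and> (cbv_typing Sig \<Delta> (F P) \<rho> \<and> Q' (F P)) \<and>
      (cbv_red (F N) (F P) \<or> cbv_red (F P) (F N))" by metis
  with step(3) show ?case by (auto intro: equivclp_into_equivclp)
qed simp

lemma cbv_typing_simps [simp]:
  "cbv_typing Sig \<Gamma> (Con c) \<tau> \<longleftrightarrow> \<tau> = Sig c"
  "cbv_typing Sig \<Gamma> (Var i) \<tau> \<longleftrightarrow> i < length \<Gamma> \<and> \<tau> = \<Gamma> ! i"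
  "cbv_typing Sig \<Gamma> (Lam \<sigma> M) \<tau> \<longleftrightarrow> (\<exists>\<rho>. \<tau> = \<sigma> \<rightarrow> \<rho> \<and> cbv_typing Sig (\<sigma> # \<Gamma>) M \<rho>)"
  "cbv_typing Sig \<Gamma> (App M N) \<tau> \<longleftrightarrow> (\<exists>\<sigma>. cbv_typing Sig \<Gamma> M (\<sigma> \<rightarrow> \<tau>) \<and> cbv_typing Sig \<Gamma> N \<sigma>)"
  "cbv_typing Sig \<Gamma> (Box ts Ns M) \<tau> \<longleftrightarrow>
     (\<exists>\<rho>. \<tau> = Nec \<rho> \<and> list_all2 (\<lambda>N \<sigma>. cbv_typing Sig \<Gamma> N (Nec \<sigma>)) Ns ts \<and> cbv_typing Sig ts M \<rho> \<and> is_val M)"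
proof -
  have "list_all2 (\<lambda>N \<sigma>. typing Sig \<Gamma> N (Nec \<sigma>)) Ns ts \<and> (\<forall>N \<in> set Ns. restricted N) \<longleftrightarrow>
    list_all2 (\<lambda>N \<sigma>. cbv_typing Sig \<Gamma> N (Nec \<sigma>)) Ns ts"
    unfolding cbv_typing_def list_all2_conv_all_nth by (auto simp: all_set_conv_all_nth)
  then show "cbv_typing Sig \<Gamma> (Box ts Ns M) \<tau> \<longleftrightarrow>
     (\<exists>\<rho>. \<tau> = Nec \<rho> \<and> list_all2 (\<lambda>N \<sigma>. cbv_typing Sig \<Gamma> N (Nec \<sigma>)) Ns ts \<and> cbv_typing Sig ts M \<rho> \<and> is_val M)"
    by (auto simp: cbv_typing_def)
qed (auto simp: cbv_typing_def)

lemma cbv_typing_unique: "cbv_typing Sig \<Gamma> M \<tau> \<Longrightarrow> cbv_typing Sig \<Gamma> M \<tau>' \<Longrightarrow> \<tau> = \<tau>'"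
  unfolding cbv_typing_def by (metis typing_unique)

lemma cbv_typing_lift [simp]: "cbv_typing Sig (\<sigma> # \<Gamma>) (lift M) \<tau> \<longleftrightarrow> cbv_typing Sig \<Gamma> M \<tau>"
  by (simp add: cbv_typing_def)

lemma cbv_typing_sub0:
  "cbv_typing Sig (\<sigma> # \<Gamma>) M \<tau> \<Longrightarrow> cbv_typing Sig \<Gamma> N \<sigma> \<Longrightarrow> cbv_typing Sig \<Gamma> (sub0 N M) \<tau>"
  unfolding cbv_typing_def by (blast intro: typing_sub0 restricted_sub0)

section \<open>Congruence rules of call-by-value equality\<close>

lemma veq_weaken: "veq is_val Sig \<Gamma> \<tau> M N \<Longrightarrow> veq (\<lambda>_. True) Sig \<Gamma> \<tau> M N"
  using veq_map[of is_val Sig \<Gamma> \<tau> M N "\<lambda>M. M"] by simp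

lemma veq_lift: "veq Q Sig \<Gamma> \<tau> M N \<Longrightarrow> (\<And>M. Q (lift M) = Q M) \<Longrightarrow> veq Q Sig (\<sigma> # \<Gamma>) \<tau> (lift M) (lift N)"
  by (erule veq_map) (auto intro: cbv_red_ren)

lemma veq_Lam: "veq Q Sig (\<sigma> # \<Gamma>) \<tau> M N \<Longrightarrow> veq is_val Sig \<Gamma> (\<sigma> \<rightarrow> \<tau>) (Lam \<sigma> M) (Lam \<sigma> N)"
  by (erule veq_map) (auto simp: cbv_red_def intro: compat.lam)

lemma veq_appL:
  "veq Q Sig \<Gamma> (\<sigma> \<rightarrow> \<tau>) M N \<Longrightarrow> cbv_typing Sig \<Gamma> P \<sigma> \<Longrightarrow> veq (\<lambda>_. True) Sig \<Gamma> \<tau> (App M P) (App N P)"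
  by (erule veq_map) (auto simp: cbv_red_def intro: compat.appL)

lemma veq_appR:
  "veq Q Sig \<Gamma> \<sigma> M N \<Longrightarrow> cbv_typing Sig \<Gamma> P (\<sigma> \<rightarrow> \<tau>) \<Longrightarrow> veq (\<lambda>_. True) Sig \<Gamma> \<tau> (App P M) (App P N)"
  by (erule veq_map) (auto simp: cbv_red_def intro: compat.appR)

text \<open>The chain of the body has to consist of values; a box around any other intermediate term
  would not be restricted.\<close>

lemma veq_boxBody:
  "veq is_val Sig ts \<tau> M N \<Longrightarrow> list_all2 (\<lambda>N \<sigma>. cbv_typing Sig \<Gamma> N (Nec \<sigma>)) Ns ts \<Longrightarrow>
   (\<And>M. Q (Box ts Ns M)) \<Longrightarrow> veq Q Sig \<Gamma> (Nec \<tau>) (Box ts Ns M) (Box ts Ns N)"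
  by (erule veq_map) (auto simp: cbv_red_def intro: compat.boxBody)

lemma veq_boxArg:
  assumes "veq Q Sig \<Gamma> (Nec \<sigma>) N N'"
    and "list_all2 (\<lambda>N \<sigma>. cbv_typing Sig \<Gamma> N (Nec \<sigma>)) Ps ts" "list_all2 (\<lambda>N \<sigma>. cbv_typing Sig \<Gamma> N (Nec \<sigma>)) Qs ss"
    and "cbv_typing Sig (ts @ \<sigma> # ss) M \<tau>" "is_val M"
    and "\<And>N. Q N \<Longrightarrow> Q' (Box (ts @ \<sigma> # ss) (Ps @ N # Qs) M)"
  shows "veq Q' Sig \<Gamma> (Nec \<tau>) (Box (ts @ \<sigma> # ss) (Ps @ N # Qs) M) (Box (ts @ \<sigma> # ss) (Ps @ N' # Qs) M)"
  using assms(1)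
  by (rule veq_map) (use assms(2-) in \<open>auto simp: cbv_red_def intro: compat.boxArg list_all2_appendI\<close>)

text \<open>A continuation of the CPS image decodes to a stack of values that are applied in turn.\<close>

definition fills :: "('p, 'c) tm list \<Rightarrow> ('p, 'c) tm \<Rightarrow> ('p, 'c) tm" where
  "fills Vs M = foldr App Vs M"

lemma fills_simps [simp]:
  "fills [] M = M" "fills (V # Vs) M = App V (fills Vs M)" "fills (Vs @ Ws) M = fills Vs (fills Ws M)"
  by (simp_all add: fills_def)

lemma ren_fills: "ren f (fills Vs M) = fills (map (ren f) Vs) (ren f M)"
  by (induction Vs) auto

lemma sub_fills: "sub s (fills Vs M) = fills (map (sub s) Vs) (sub s M)"
  by (induction Vs) auto

text \<open>The head of the list is applied last: \<sigma> is the type received by the last value of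
  the list, \<rho> the type returned by the first.\<close>

primrec stack :: "('c \<Rightarrow> 'p ty) \<Rightarrow> 'p ty list \<Rightarrow> 'p ty \<Rightarrow> ('p, 'c) tm list \<Rightarrow> 'p ty \<Rightarrow> bool" where
  "stack Sig \<Gamma> \<sigma> [] \<rho> \<longleftrightarrow> \<sigma> = \<rho>"
| "stack Sig \<Gamma> \<sigma> (V # Vs) \<rho> \<longleftrightarrow> (\<exists>\<sigma>'. cbv_typing Sig \<Gamma> V (\<sigma>' \<rightarrow> \<rho>) \<and> is_val V \<and> stack Sig \<Gamma> \<sigma> Vs \<sigma>')"

lemma stack_append: "stack Sig \<Gamma> \<sigma> (Vs @ Ws) \<rho> \<longleftrightarrow> (\<exists>\<sigma>'. stack Sig \<Gamma> \<sigma>' Vs \<rho> \<and> stack Sig \<Gamma> \<sigma> Ws \<sigma>')"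
  by (induction Vs arbitrary: \<rho>) auto

lemma stack_lift [simp]: "stack Sig (\<alpha> # \<Gamma>) \<sigma> (map lift Vs) \<rho> \<longleftrightarrow> stack Sig \<Gamma> \<sigma> Vs \<rho>"
  by (induction Vs arbitrary: \<rho>) auto

lemma cbv_typing_fills: "stack Sig \<Gamma> \<sigma> Vs \<rho> \<Longrightarrow> cbv_typing Sig \<Gamma> M \<sigma> \<Longrightarrow> cbv_typing Sig \<Gamma> (fills Vs M) \<rho>"
  by (induction Vs arbitrary: \<rho>) auto

abbreviation "eqv \<equiv> veq (\<lambda>_. True)"

lemma eqv_fills: "stack Sig \<Gamma> \<sigma> Vs \<rho> \<Longrightarrow> veq Q Sig \<Gamma> \<sigma> M N \<Longrightarrow> eqv Sig \<Gamma> \<rho> (fills Vs M) (fills Vs N)"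
proof (induction Vs arbitrary: \<rho>)
  case Nil
  then show ?case using veq_map[of Q Sig \<Gamma> \<sigma> M N "\<lambda>M. M"] by simp
next
  case (Cons V Vs)
  then show ?case by (auto intro: veq_appR)
qed

text \<open>The lifting rule, used once per value of the stack with the context
  \<open>V [ ]\<close>, from the inside outwards.\<close>

lemma eqv_fills_let:
  "stack Sig \<Gamma> \<sigma> Vs \<rho> \<Longrightarrow> cbv_typing Sig (\<alpha> # \<Gamma>) B \<sigma> \<Longrightarrow> cbv_typing Sig \<Gamma> N \<alpha> \<Longrightarrow>
   eqv Sig \<Gamma> \<rho> (fills Vs (App (Lam \<alpha> B) N)) (App (Lam \<alpha> (fills (map lift Vs) B)) N)"
proof (induction Vs arbitrary: \<rho>)
  case (Cons V Vs)
  then obtain \<sigma>' where V: "cbv_typing Sig \<Gamma> V (\<sigma>' \<rightarrow> \<rho>)" "is_val V" "stack Sig \<Gamma> \<sigma> Vs \<sigma>'" by auto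
  let ?B = "fills (map lift Vs) B"
  have B: "cbv_typing Sig (\<alpha> # \<Gamma>) ?B \<sigma>'" using V Cons.prems by (auto intro: cbv_typing_fills)
  have "eqv Sig \<Gamma> \<rho> (App V (fills Vs (App (Lam \<alpha> B) N))) (App V (App (Lam \<alpha> ?B) N))"
    using Cons V by (auto intro: veq_appR)
  also have "eqv Sig \<Gamma> \<rho> (App V (App (Lam \<alpha> ?B) N)) (App (Lam \<alpha> (App (lift V) ?B)) N)"
    by (rule veq_step) (use V B Cons.prems cbv_root.lift[of "CArg V" \<alpha> ?B N] in auto)
  finally show ?case by simp
qed simp

lemma eqv_ident: "cbv_typing Sig \<Gamma> M \<sigma> \<Longrightarrow> eqv Sig \<Gamma> \<sigma> (App (Lam \<sigma> (Var 0)) M) M"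
  by (rule veq_step) (auto intro: cbv_root.ident)

text \<open>The identity rule is read backwards to create a redex around \<open>M\<close>, which
  lifting then pulls out of the stack. In this way a term that is not a value gets substituted,
  although beta only accepts values.\<close>

lemma eqv_let_fills:
  assumes "stack Sig \<Gamma> \<sigma> Vs \<rho>" "cbv_typing Sig \<Gamma> M \<sigma>"
  shows "eqv Sig \<Gamma> \<rho> (App (Lam \<sigma> (fills (map lift Vs) (Var 0))) M) (fills Vs M)"
proof -
  have "eqv Sig \<Gamma> \<rho> (fills Vs (App (Lam \<sigma> (Var 0)) M)) (App (Lam \<sigma> (fills (map lift Vs) (Var 0))) M)"
    by (rule eqv_fills_let[OF assms(1)]) (use assms in auto)
  moreover have "eqv Sig \<Gamma> \<rho> (fills Vs (App (Lam \<sigma> (Var 0)) M)) (fills Vs M)"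
    by (rule eqv_fills[OF assms(1) eqv_ident[OF assms(2)]])
  ultimately show ?thesis using veq_sym veq_trans by blast
qed

lemma eqv_beta_v:
  assumes "is_val V" "cbv_typing Sig (\<sigma> # \<Gamma>) M \<tau>" "cbv_typing Sig \<Gamma> V \<sigma>"
  shows "eqv Sig \<Gamma> \<tau> (App (Lam \<sigma> M) V) (sub0 V M)"
  by (rule veq_step) (use assms in \<open>auto intro: cbv_root.beta_v cbv_typing_sub0\<close>)

lemma eqv_beta_Var:
  assumes "cbv_typing Sig (\<sigma> # \<Gamma>) M \<tau>"
  shows "eqv Sig (\<sigma> # \<Gamma>) \<tau> (App (lift (Lam \<sigma> M)) (Var 0)) M"
proof -
  have "cbv_typing Sig (\<sigma> # \<Gamma>) (lift (Lam \<sigma> M)) (\<sigma> \<rightarrow> \<tau>)" using assms by (simp del: ren.simps)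
  then have "cbv_typing Sig (\<sigma> # \<sigma> # \<Gamma>) (ren (up_ren Suc) M) \<tau>" by simp
  from eqv_beta_v[OF _ this, of "Var 0"] show ?thesis by simp
qed

text \<open>Stacks are contexts, not terms. Comparing them on a fresh variable is enough to exchange
  them around any term, by \<open>keq_fills\<close>.\<close>

definition keq :: "('c \<Rightarrow> 'p ty) \<Rightarrow> 'p ty list \<Rightarrow> 'p ty \<Rightarrow> 'p ty \<Rightarrow> ('p, 'c) tm list \<Rightarrow> ('p, 'c) tm list \<Rightarrow> bool" where
  "keq Sig \<Gamma> \<sigma> \<rho> Vs Ws \<longleftrightarrow> stack Sig \<Gamma> \<sigma> Vs \<rho> \<and> stack Sig \<Gamma> \<sigma> Ws \<rho> \<and>
     eqv Sig (\<sigma> # \<Gamma>) \<rho> (fills (map lift Vs) (Var 0)) (fills (map lift Ws) (Var 0))"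

lemma keq_refl: "stack Sig \<Gamma> \<sigma> Vs \<rho> \<Longrightarrow> keq Sig \<Gamma> \<sigma> \<rho> Vs Vs"
  by (simp add: keq_def)

text \<open>Abstracting the fresh variable turns the hypothesis into an equation between two
  functions, and \<open>eqv_let_fills\<close> instantiates both at an arbitrary term.\<close>

lemma keq_fills:
  assumes "keq Sig \<Gamma> \<sigma> \<rho> Vs Ws" "cbv_typing Sig \<Gamma> M \<sigma>"
  shows "eqv Sig \<Gamma> \<rho> (fills Vs M) (fills Ws M)"
proof -
  have "eqv Sig \<Gamma> \<rho> (App (Lam \<sigma> (fills (map lift Vs) (Var 0))) M) (App (Lam \<sigma> (fills (map lift Ws) (Var 0))) M)"
    using assms unfolding keq_def by (blast intro: veq_appL veq_Lam)
  also have "eqv Sig \<Gamma> \<rho> (App (Lam \<sigma> (fills (map lift Ws) (Var 0))) M) (fills Ws M)"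
    using assms unfolding keq_def by (blast intro: eqv_let_fills)
  finally have "eqv Sig \<Gamma> \<rho> (App (Lam \<sigma> (fills (map lift Vs) (Var 0))) M) (fills Ws M)" .
  moreover have "eqv Sig \<Gamma> \<rho> (App (Lam \<sigma> (fills (map lift Vs) (Var 0))) M) (fills Vs M)"
    using assms unfolding keq_def by (blast intro: eqv_let_fills)
  ultimately show ?thesis using veq_sym veq_trans by blast
qed

lemma keq_lift: "keq Sig \<Gamma> \<sigma> \<rho> Vs Ws \<Longrightarrow> keq Sig (\<alpha> # \<Gamma>) \<sigma> \<rho> (map lift Vs) (map lift Ws)"
proof -
  assume k: "keq Sig \<Gamma> \<sigma> \<rho> Vs Ws"
  then have e: "eqv Sig (\<sigma> # \<Gamma>) \<rho> (fills (map lift Vs) (Var 0)) (fills (map lift Ws) (Var 0))"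
    by (simp add: keq_def)
  have "eqv Sig (\<sigma> # \<alpha> # \<Gamma>) \<rho> (ren (up_ren Suc) (fills (map lift Vs) (Var 0))) (ren (up_ren Suc) (fills (map lift Ws) (Var 0)))"
    using e
  proof (rule veq_map)
    fix M assume "cbv_typing Sig (\<sigma> # \<Gamma>) M \<rho>"
    \<comment> \<open>Weakening behind the bound variable is obtained by weakening the whole
      abstraction at the front of its context.\<close>
    then have "cbv_typing Sig (\<alpha> # \<Gamma>) (lift (Lam \<sigma> M)) (\<sigma> \<rightarrow> \<rho>)" by (simp del: ren.simps)
    then show "cbv_typing Sig (\<sigma> # \<alpha> # \<Gamma>) (ren (up_ren Suc) M) \<rho> \<and> True" by simp
  qed (rule cbv_red_ren)
  with k show ?thesis by (simp add: keq_def ren_fills ren_up_lift comp_def)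
qed

lemma keq_append:
  assumes "keq Sig \<Gamma> \<sigma>' \<rho> Vs Ws" "stack Sig \<Gamma> \<sigma> Us \<sigma>'"
  shows "keq Sig \<Gamma> \<sigma> \<rho> (Vs @ Us) (Ws @ Us)"
proof -
  have "cbv_typing Sig (\<sigma> # \<Gamma>) (fills (map lift Us) (Var 0)) \<sigma>'"
    by (rule cbv_typing_fills[of _ _ \<sigma>]) (use assms in auto)
  from keq_fills[OF keq_lift[OF assms(1), of \<sigma>] this] assms show ?thesis
    by (auto simp: keq_def stack_append)
qed

lemma keq_single:
  assumes "eqv Sig (\<sigma> # \<Gamma>) \<rho> M (fills (map lift Vs) (Var 0))" "cbv_typing Sig (\<sigma> # \<Gamma>) M \<rho>" "stack Sig \<Gamma> \<sigma> Vs \<rho>"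
  shows "keq Sig \<Gamma> \<sigma> \<rho> [Lam \<sigma> M] Vs"
proof -
  have "eqv Sig (\<sigma> # \<Gamma>) \<rho> (App (lift (Lam \<sigma> M)) (Var 0)) (fills (map lift Vs) (Var 0))"
    using eqv_beta_Var[OF assms(2)] assms(1) by (rule veq_trans)
  with assms show ?thesis by (simp add: keq_def)
qed

section \<open>The image of the CPS transformation and its decoding\<close>

lemma cps_ty_inject [simp]: "cps_ty R \<sigma> = cps_ty R \<tau> \<longleftrightarrow> \<sigma> = \<tau>"
proof (induction \<sigma> arbitrary: \<tau>)
  case (TConst p) then show ?case by (cases \<tau>) auto
next
  case (Imp \<sigma>1 \<sigma>2) then show ?case by (cases \<tau>) auto
next
  case (Nec \<sigma>) then show ?case by (cases \<tau>) auto
qed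

text \<open>The image of an arrow type has an arrow as its codomain, never the constant
  \<open>R\<close>, even if \<open>R\<close> occurs in source types. Hence the annotation of an
  abstraction tells whether it binds a value or a continuation.\<close>

lemma cps_ty_neq_cont_ty [simp]: "cps_ty R \<sigma> \<noteq> cps_ty R \<tau> \<rightarrow> TConst R" "cps_ty R \<tau> \<rightarrow> TConst R \<noteq> cps_ty R \<sigma>"
  by (cases \<sigma>; auto)+

text \<open>A continuation binder adds an index to the target only; a value binder, treated by
  \<open>bind\<close>, adds one to the source as well.\<close>

abbreviation hide :: "(nat \<Rightarrow> nat option) \<Rightarrow> nat \<Rightarrow> nat option" where
  "hide v \<equiv> case_nat None v"

abbreviation bind :: "(nat \<Rightarrow> nat option) \<Rightarrow> nat \<Rightarrow> nat option" where
  "bind v \<equiv> case_nat (Some 0) (\<lambda>i. map_option Suc (v i))"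

text \<open>
  Values, continuations, answers and terms of the CPS image, each related to its decoding into the
  call-by-value calculus. The map \<open>v\<close> sends the value variables of the target to those of
  the source context \<open>\<Gamma>\<close>; it is undefined at continuation variables. In a continuation or an
  answer exactly one continuation variable is live: it has index \<open>\<kappa>\<close> and accepts type \<open>\<rho>\<close>.
\<close>

inductive dW and dK and dA and dT for R :: 'p and Sig :: "'c \<Rightarrow> 'p ty" where
  Con: "dW R Sig \<Gamma> v (Con c) (Con c) (Sig c)"
| Var: "v i = Some j \<Longrightarrow> j < length \<Gamma> \<Longrightarrow> dW R Sig \<Gamma> v (Var i) (Var j) (\<Gamma> ! j)"
| Lam: "dK R Sig \<Gamma> (hide v) 0 \<tau> K Vs \<sigma> \<Longrightarrow>
    dW R Sig \<Gamma> v (Lam (cont_ty R \<tau>) K) (Lam \<sigma> (fills (map lift Vs) (Var 0))) (\<sigma> \<rightarrow> \<tau>)"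
| Box: "list_all2 (\<lambda>W u. dW R Sig \<Gamma> v W (fst u) (Nec (snd u))) Ws us \<Longrightarrow>
    dW R Sig (map snd us) Some B V \<tau> \<Longrightarrow>
    dW R Sig \<Gamma> v (Box (map (cps_ty R) (map snd us)) Ws B) (Box (map snd us) (map fst us) V) (Nec \<tau>)"
| KVar: "dK R Sig \<Gamma> v \<kappa> \<rho> (Var \<kappa>) [] \<rho>"
| KLam: "dA R Sig (\<sigma> # \<Gamma>) (bind v) (Suc \<kappa>) \<rho> A M \<Longrightarrow>
    dK R Sig \<Gamma> v \<kappa> \<rho> (Lam (cps_ty R \<sigma>) A) [Lam \<sigma> M] \<sigma>"
| KApp: "dW R Sig \<Gamma> v W V (\<sigma> \<rightarrow> \<sigma>') \<Longrightarrow> dK R Sig \<Gamma> v \<kappa> \<rho> K Vs \<sigma>' \<Longrightarrow>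
    dK R Sig \<Gamma> v \<kappa> \<rho> (App W K) (Vs @ [V]) \<sigma>"
| AVal: "dK R Sig \<Gamma> v \<kappa> \<rho> K Vs \<sigma> \<Longrightarrow> dW R Sig \<Gamma> v W V \<sigma> \<Longrightarrow>
    dA R Sig \<Gamma> v \<kappa> \<rho> (App K W) (fills Vs V)"
| ATerm: "dT R Sig \<Gamma> v T M \<sigma> \<Longrightarrow> dK R Sig \<Gamma> v \<kappa> \<rho> K Vs \<sigma> \<Longrightarrow>
    dA R Sig \<Gamma> v \<kappa> \<rho> (App T K) (fills Vs M)"
| TLam: "dA R Sig \<Gamma> (hide v) 0 \<tau> A M \<Longrightarrow> dT R Sig \<Gamma> v (Lam (cont_ty R \<tau>) A) M \<tau>"

inductive_cases dW_LamE: "dW R Sig \<Gamma> v (Lam \<alpha> K) V \<tau>"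
inductive_cases dW_BoxE: "dW R Sig \<Gamma> v (Box ts Ws B) V \<tau>"
inductive_cases dW_VarE: "dW R Sig \<Gamma> v (Var i) V \<tau>"
inductive_cases dW_ConE: "dW R Sig \<Gamma> v (Con c) V \<tau>"
inductive_cases dK_VarE: "dK R Sig \<Gamma> v \<kappa> \<rho> (Var i) Vs \<sigma>"
inductive_cases dK_LamE: "dK R Sig \<Gamma> v \<kappa> \<rho> (Lam \<alpha> A) Vs \<sigma>"
inductive_cases dK_AppE: "dK R Sig \<Gamma> v \<kappa> \<rho> (App W K) Vs \<sigma>"
inductive_cases dA_AppE: "dA R Sig \<Gamma> v \<kappa> \<rho> (App X Y) M"
inductive_cases dT_E: "dT R Sig \<Gamma> v T M \<tau>"

lemma decode_typing:
  "dW R Sig \<Gamma> v W V \<sigma> \<Longrightarrow> cbv_typing Sig \<Gamma> V \<sigma> \<and> is_val V"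
  "dK R Sig \<Gamma> v \<kappa> \<rho> K Vs \<sigma> \<Longrightarrow> stack Sig \<Gamma> \<sigma> Vs \<rho>"
  "dA R Sig \<Gamma> v \<kappa> \<rho> A M \<Longrightarrow> cbv_typing Sig \<Gamma> M \<rho>"
  "dT R Sig \<Gamma> v T M \<tau> \<Longrightarrow> cbv_typing Sig \<Gamma> M \<tau>"
proof (induction rule: dW_dK_dA_dT.inducts)
  case (Lam \<Gamma> v \<tau> K Vs \<sigma>)
  then have "stack Sig (\<sigma> # \<Gamma>) \<sigma> (map lift Vs) \<tau>" by simp
  then show ?case by (simp add: cbv_typing_fills)
next
  case (Box \<Gamma> v Ws us B V \<tau>)
  have len: "length Ws = length us" using list_all2_lengthD[OF Box.IH(1)] .
  have u: "cbv_typing Sig \<Gamma> (fst (us ! i)) (Nec (snd (us ! i))) \<and> is_val (fst (us ! i))" if "i < length us" for i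
    using list_all2_nthD2[OF Box.IH(1) that] by blast
  then have "is_val V" if "V \<in> set (map fst us)" for V
    using that unfolding in_set_conv_nth by fastforce
  moreover have "list_all2 (\<lambda>N \<sigma>. cbv_typing Sig \<Gamma> N (Nec \<sigma>)) (map fst us) (map snd us)"
    using u by (auto simp: list_all2_conv_all_nth)
  ultimately show ?case using Box by simp
next
  case (KApp \<Gamma> v W V \<sigma> \<sigma>' \<kappa> \<rho> K Vs)
  then show ?case by (auto simp: stack_append)
next
  case (AVal \<Gamma> v \<kappa> \<rho> K Vs \<sigma> W V)
  then show ?case by (auto intro: cbv_typing_fills)
next
  case (ATerm \<Gamma> v T M \<sigma> \<kappa> \<rho> K Vs)
  then show ?case by (auto intro: cbv_typing_fills)
qed auto

text \<open>The head of an application decides whether it is a continuation applied to a value or a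
  term applied to a continuation. Only abstractions could be both, and their annotations exclude
  it.\<close>

lemma dK_dT_disjoint: "dK R Sig \<Gamma> v \<kappa> \<rho> X Vs \<sigma> \<Longrightarrow> dT R Sig \<Gamma>' v' X M \<tau> \<Longrightarrow> False"
  by (auto elim!: dT_E elim: dK_LamE)

text \<open>Makes decoding a partial function of the target term, so that a common reduct of two
  transforms stands for one source term.\<close>

lemma decode_unique:
  "dW R Sig \<Gamma> v W V \<sigma> \<Longrightarrow> dW R Sig \<Gamma> v W V' \<sigma>' \<Longrightarrow> V = V' \<and> \<sigma> = \<sigma>'"
  "dK R Sig \<Gamma> v \<kappa> \<rho> K Vs \<sigma> \<Longrightarrow> dK R Sig \<Gamma> v \<kappa> \<rho> K Vs' \<sigma>' \<Longrightarrow> Vs = Vs' \<and> \<sigma> = \<sigma>'"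
  "dA R Sig \<Gamma> v \<kappa> \<rho> A M \<Longrightarrow> dA R Sig \<Gamma> v \<kappa> \<rho> A M' \<Longrightarrow> M = M'"
  "dT R Sig \<Gamma> v T M \<tau> \<Longrightarrow> dT R Sig \<Gamma> v T M' \<tau>' \<Longrightarrow> M = M' \<and> \<tau> = \<tau>'"
proof (induction arbitrary: V' \<sigma>' and Vs' \<sigma>' and M' and M' \<tau>' rule: dW_dK_dA_dT.inducts)
  case (Con \<Gamma> v c)
  then show ?case by (auto elim: dW_ConE)
next
  case (Var v i j \<Gamma>)
  then show ?case by (auto elim: dW_VarE)
next
  case (Lam \<Gamma> v \<tau> K Vs \<sigma>)
  from Lam.prems obtain Vs2 s where "V' = Lam s (fills (map lift Vs2) (Var 0))" "\<sigma>' = s \<rightarrow> \<tau>"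
    "dK R Sig \<Gamma> (hide v) 0 \<tau> K Vs2 s" by (auto elim!: dW_LamE)
  with Lam.IH(2)[OF this(3)] show ?case by simp
next
  case (Box \<Gamma> v Ws us B V \<tau>)
  from Box.prems obtain us' V2 \<tau>2 where V': "V' = Box (map snd us') (map fst us') V2" "\<sigma>' = Nec \<tau>2"
    and snd: "map (cps_ty R) (map snd us) = map (cps_ty R) (map snd us')"
    and l: "list_all2 (\<lambda>W u. dW R Sig \<Gamma> v W (fst u) (Nec (snd u))) Ws us'"
    and B: "dW R Sig (map snd us') Some B V2 \<tau>2"
    by (auto elim!: dW_BoxE)
  \<comment> \<open>Source annotations are recovered from the target ones, so both decodings of the
    body live in the same context.\<close>
  have "inj (cps_ty R)" by (auto intro: injI)
  with snd have s: "map snd us = map snd us'" using inj_map_eq_map by blast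
  from B have "V = V2 \<and> \<tau> = \<tau>2" unfolding s[symmetric] by (rule Box.IH(3))
  moreover have "us = us'"
  proof (rule nth_equalityI)
    show len: "length us = length us'" using s by (rule map_eq_imp_length_eq)
    fix i assume i: "i < length us"
    have "dW R Sig \<Gamma> v (Ws ! i) (fst (us' ! i)) (Nec (snd (us' ! i)))"
      using list_all2_nthD2[OF l, of i] i len by simp
    with list_all2_nthD2[OF Box.IH(1) i]
    have "fst (us ! i) = fst (us' ! i) \<and> Nec (snd (us ! i)) = Nec (snd (us' ! i))" by blast
    then have "fst (us ! i) = fst (us' ! i)" "snd (us ! i) = snd (us' ! i)" by simp_all
    then show "us ! i = us' ! i" by (rule prod_eqI)
  qed
  ultimately show ?case using V' by simp
next
  case (KVar \<Gamma> v \<kappa> \<rho>)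
  then show ?case by (auto elim: dK_VarE)
next
  case (KLam \<sigma> \<Gamma> v \<kappa> \<rho> A M)
  from KLam.prems KLam.IH(2) show ?case by (auto elim!: dK_LamE)
next
  case (KApp \<Gamma> v W V \<sigma> \<sigma>'' \<kappa> \<rho> K Vs)
  from KApp.prems obtain V2 s Vs2 where "Vs' = Vs2 @ [V2]" and W: "dW R Sig \<Gamma> v W V2 (\<sigma>' \<rightarrow> s)"
    and K: "dK R Sig \<Gamma> v \<kappa> \<rho> K Vs2 s" by (rule dK_AppE)
  with KApp.IH(2)[OF W] KApp.IH(4)[OF K] show ?case by simp
next
  case (AVal \<Gamma> v \<kappa> \<rho> K Vs \<sigma> W V)
  from AVal.prems show ?case
  proof (rule dA_AppE)
    fix Vs' \<sigma>' V' assume "M' = fills Vs' V'" "dK R Sig \<Gamma> v \<kappa> \<rho> K Vs' \<sigma>'" "dW R Sig \<Gamma> v W V' \<sigma>'"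
    with AVal.IH(2)[of Vs' \<sigma>'] AVal.IH(4)[of V' \<sigma>'] show ?thesis by simp
  next
    fix N \<sigma>' assume "dT R Sig \<Gamma> v K N \<sigma>'"
    from dK_dT_disjoint[OF AVal.IH(1) this] show ?thesis ..
  qed
next
  case (ATerm \<Gamma> v T M \<sigma> \<kappa> \<rho> K Vs)
  from ATerm.prems show ?case
  proof (rule dA_AppE)
    fix Vs' \<sigma>' assume "dK R Sig \<Gamma> v \<kappa> \<rho> T Vs' \<sigma>'"
    from dK_dT_disjoint[OF this ATerm.IH(1)] show ?thesis ..
  next
    fix N \<sigma>' Vs' assume "M' = fills Vs' N" "dT R Sig \<Gamma> v T N \<sigma>'" "dK R Sig \<Gamma> v \<kappa> \<rho> K Vs' \<sigma>'"
    with ATerm.IH(2)[of N \<sigma>'] ATerm.IH(4)[of Vs' \<sigma>'] show ?thesis by simp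
  qed
next
  case (TLam \<Gamma> v \<tau> A M)
  from TLam.prems show ?case by (rule dT_E) (use TLam.IH(2) in auto)
qed

subsection \<open>Renaming and substitution\<close>

text \<open>\<open>f\<close> renames the target and \<open>g\<close> the source. They differ because
  continuation variables have no counterpart in the source.\<close>

definition dren :: "(nat \<Rightarrow> nat) \<Rightarrow> (nat \<Rightarrow> nat) \<Rightarrow> 'p ty list \<Rightarrow> (nat \<Rightarrow> nat option) \<Rightarrow>
    'p ty list \<Rightarrow> (nat \<Rightarrow> nat option) \<Rightarrow> bool" where
  "dren f g \<Gamma> v \<Gamma>' v' \<longleftrightarrow> (\<forall>i j. v i = Some j \<longrightarrow> j < length \<Gamma> \<longrightarrow>
     v' (f i) = Some (g j) \<and> g j < length \<Gamma>' \<and> \<Gamma>' ! g j = \<Gamma> ! j)"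

lemma dren_hide: "dren f g \<Gamma> v \<Gamma>' v' \<Longrightarrow> dren (up_ren f) g \<Gamma> (hide v) \<Gamma>' (hide v')"
  by (auto simp: dren_def split: nat.splits)

lemma dren_bind: "dren f g \<Gamma> v \<Gamma>' v' \<Longrightarrow> dren (up_ren f) (up_ren g) (\<sigma> # \<Gamma>) (bind v) (\<sigma> # \<Gamma>') (bind v')"
  by (auto simp: dren_def split: nat.splits)

lemma decode_ren:
  "dW R Sig \<Gamma> v W V \<sigma> \<Longrightarrow> dren f g \<Gamma> v \<Gamma>' v' \<Longrightarrow> dW R Sig \<Gamma>' v' (ren f W) (ren g V) \<sigma>"
  "dK R Sig \<Gamma> v \<kappa> \<rho> K Vs \<sigma> \<Longrightarrow> dren f g \<Gamma> v \<Gamma>' v' \<Longrightarrow>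
    dK R Sig \<Gamma>' v' (f \<kappa>) \<rho> (ren f K) (map (ren g) Vs) \<sigma>"
  "dA R Sig \<Gamma> v \<kappa> \<rho> A M \<Longrightarrow> dren f g \<Gamma> v \<Gamma>' v' \<Longrightarrow> dA R Sig \<Gamma>' v' (f \<kappa>) \<rho> (ren f A) (ren g M)"
  "dT R Sig \<Gamma> v T M \<tau> \<Longrightarrow> dren f g \<Gamma> v \<Gamma>' v' \<Longrightarrow> dT R Sig \<Gamma>' v' (ren f T) (ren g M) \<tau>"
proof (induction arbitrary: f g \<Gamma>' v' and f g \<Gamma>' v' and f g \<Gamma>' v' and f g \<Gamma>' v' rule: dW_dK_dA_dT.inducts)
  case (Con \<Gamma> v c)
  then show ?case by (simp add: dW_dK_dA_dT.Con)
next
  case (Var v i j \<Gamma>)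
  then have "v' (f i) = Some (g j)" "g j < length \<Gamma>'" "\<Gamma>' ! g j = \<Gamma> ! j" by (auto simp: dren_def)
  with dW_dK_dA_dT.Var[of v' "f i" "g j" \<Gamma>'] show ?case by simp
next
  case (Lam \<Gamma> v \<tau> K Vs \<sigma>)
  from dW_dK_dA_dT.Lam[OF Lam.IH(2)[OF dren_hide[OF Lam.prems], simplified]]
  show ?case by (simp add: ren_fills ren_up_lift comp_def)
next
  case (Box \<Gamma> v Ws us B V \<tau>)
  let ?us = "map (map_prod (ren g) id) us"
  have "list_all2 (\<lambda>W u. dW R Sig \<Gamma>' v' W (fst u) (Nec (snd u))) (map (ren f) Ws) ?us"
    using Box by (auto simp: list_all2_conv_all_nth)
  moreover have "map snd ?us = map snd us" "map fst ?us = map (ren g) (map fst us)" by simp_all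
  ultimately show ?case using dW_dK_dA_dT.Box[of R Sig \<Gamma>' v' "map (ren f) Ws" ?us B V \<tau>] Box.IH(2)
    by (simp del: map_map)
next
  case (KVar \<Gamma> v \<kappa> \<rho>)
  then show ?case by (simp add: dW_dK_dA_dT.KVar)
next
  case (KLam \<sigma> \<Gamma> v \<kappa> \<rho> A M)
  from dW_dK_dA_dT.KLam[OF KLam.IH(2)[OF dren_bind[OF KLam.prems], simplified]] show ?case by simp
next
  case (KApp \<Gamma> v W V \<sigma> \<sigma>' \<kappa> \<rho> K Vs)
  from dW_dK_dA_dT.KApp[OF KApp.IH(2)[OF KApp.prems] KApp.IH(4)[OF KApp.prems]] show ?case by simp
next
  case (AVal \<Gamma> v \<kappa> \<rho> K Vs \<sigma> W V)
  from dW_dK_dA_dT.AVal[OF AVal.IH(2)[OF AVal.prems] AVal.IH(4)[OF AVal.prems]] show ?case by (simp add: ren_fills)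
next
  case (ATerm \<Gamma> v T M \<sigma> \<kappa> \<rho> K Vs)
  from dW_dK_dA_dT.ATerm[OF ATerm.IH(2)[OF ATerm.prems] ATerm.IH(4)[OF ATerm.prems]] show ?case by (simp add: ren_fills)
next
  case (TLam \<Gamma> v \<tau> A M)
  from dW_dK_dA_dT.TLam[OF TLam.IH(2)[OF dren_hide[OF TLam.prems], simplified]] show ?case by simp
qed

lemma dren_lift_hide: "dren Suc (\<lambda>i. i) \<Gamma> v \<Gamma> (hide v)"
  by (auto simp: dren_def)

lemma dren_lift_bind: "dren Suc Suc \<Gamma> v (\<sigma> # \<Gamma>) (bind v)"
  by (auto simp: dren_def)

lemma dW_lift_hide: "dW R Sig \<Gamma> v W V \<sigma> \<Longrightarrow> dW R Sig \<Gamma> (hide v) (lift W) V \<sigma>"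
  using decode_ren(1)[OF _ dren_lift_hide] by simp

lemma dW_lift_bind: "dW R Sig \<Gamma> v W V \<sigma> \<Longrightarrow> dW R Sig (\<alpha> # \<Gamma>) (bind v) (lift W) (lift V) \<sigma>"
  using decode_ren(1)[OF _ dren_lift_bind] .

lemma dK_lift_bind: "dK R Sig \<Gamma> v \<kappa> \<rho> K Vs \<sigma> \<Longrightarrow>
    dK R Sig (\<alpha> # \<Gamma>) (bind v) (Suc \<kappa>) \<rho> (lift K) (map lift Vs) \<sigma>"
  using decode_ren(2)[OF _ dren_lift_bind] .

lemma dT_lift_hide: "dT R Sig \<Gamma> v T M \<sigma> \<Longrightarrow> dT R Sig \<Gamma> (hide v) (lift T) M \<sigma>"
  using decode_ren(4)[OF _ dren_lift_hide] by simp

lemma dT_lift_bind: "dT R Sig \<Gamma> v T M \<sigma> \<Longrightarrow> dT R Sig (\<alpha> # \<Gamma>) (bind v) (lift T) (lift M) \<sigma>"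
  using decode_ren(4)[OF _ dren_lift_bind] .

text \<open>Reflects decodability instead of preserving it. Injectivity of \<open>f\<close> is what
  recovers the live continuation variable from its image.\<close>

definition drenI :: "(nat \<Rightarrow> nat) \<Rightarrow> (nat \<Rightarrow> nat) \<Rightarrow> 'p ty list \<Rightarrow> (nat \<Rightarrow> nat option) \<Rightarrow>
    'p ty list \<Rightarrow> (nat \<Rightarrow> nat option) \<Rightarrow> bool" where
  "drenI f g \<Gamma> v \<Gamma>' v' \<longleftrightarrow> inj f \<and> (\<forall>i j'. v' (f i) = Some j' \<longrightarrow> j' < length \<Gamma>' \<longrightarrow>
     (\<exists>j. v i = Some j \<and> j' = g j \<and> j < length \<Gamma> \<and> \<Gamma>' ! j' = \<Gamma> ! j))"

lemma drenI_hide: "drenI f g \<Gamma> v \<Gamma>' v' \<Longrightarrow> drenI (up_ren f) g \<Gamma> (hide v) \<Gamma>' (hide v')"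
  unfolding drenI_def
proof (intro conjI allI impI; elim conjE)
  fix i j' assume a: "hide v' (up_ren f i) = Some j'" "j' < length \<Gamma>'"
    "\<forall>i j'. v' (f i) = Some j' \<longrightarrow> j' < length \<Gamma>' \<longrightarrow> (\<exists>j. v i = Some j \<and> j' = g j \<and> j < length \<Gamma> \<and> \<Gamma>' ! j' = \<Gamma> ! j)"
  then show "\<exists>j. hide v i = Some j \<and> j' = g j \<and> j < length \<Gamma> \<and> \<Gamma>' ! j' = \<Gamma> ! j" by (cases i) auto
qed (rule inj_up_ren)

lemma drenI_bind: "drenI f g \<Gamma> v \<Gamma>' v' \<Longrightarrow> drenI (up_ren f) (up_ren g) (\<sigma> # \<Gamma>) (bind v) (\<sigma> # \<Gamma>') (bind v')"
  unfolding drenI_def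
proof (intro conjI allI impI; elim conjE)
  fix i j' assume a: "bind v' (up_ren f i) = Some j'" "j' < length (\<sigma> # \<Gamma>')"
    "\<forall>i j'. v' (f i) = Some j' \<longrightarrow> j' < length \<Gamma>' \<longrightarrow> (\<exists>j. v i = Some j \<and> j' = g j \<and> j < length \<Gamma> \<and> \<Gamma>' ! j' = \<Gamma> ! j)"
  then show "\<exists>j. bind v i = Some j \<and> j' = up_ren g j \<and> j < length (\<sigma> # \<Gamma>) \<and> (\<sigma> # \<Gamma>') ! j' = (\<sigma> # \<Gamma>) ! j"
  proof (cases i)
    case (Suc k)
    with a obtain l' where l': "j' = Suc l'" "v' (f k) = Some l'" "l' < length \<Gamma>'" by auto
    with a(3) obtain l where "v k = Some l" "l' = g l" "l < length \<Gamma>" "\<Gamma>' ! l' = \<Gamma> ! l" by blast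
    with Suc l' show ?thesis by (intro exI[of _ "Suc l"]) simp
  qed auto
qed (rule inj_up_ren)

text \<open>For eta steps: the contractum occurs lifted inside the redex, and its decoding has to be
  pulled back to the smaller context.\<close>

lemma decode_ren_inv:
  fixes Sig :: "'c \<Rightarrow> 'p ty"
  shows
  "dW R Sig \<Gamma>' v' W' V' \<sigma> \<Longrightarrow> W' = ren f W \<Longrightarrow> drenI f g \<Gamma> v \<Gamma>' v' \<Longrightarrow>
    \<exists>V. V' = ren g V \<and> dW R Sig \<Gamma> v W V \<sigma>"
  "dK R Sig \<Gamma>' v' \<kappa>' \<rho> K' Vs' \<sigma> \<Longrightarrow> K' = ren f K \<Longrightarrow> \<kappa>' = f \<kappa> \<Longrightarrow> drenI f g \<Gamma> v \<Gamma>' v' \<Longrightarrow>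
    \<exists>Vs. Vs' = map (ren g) Vs \<and> dK R Sig \<Gamma> v \<kappa> \<rho> K Vs \<sigma>"
  "dA R Sig \<Gamma>' v' \<kappa>' \<rho> A' M' \<Longrightarrow> A' = ren f A \<Longrightarrow> \<kappa>' = f \<kappa> \<Longrightarrow> drenI f g \<Gamma> v \<Gamma>' v' \<Longrightarrow>
    \<exists>M. M' = ren g M \<and> dA R Sig \<Gamma> v \<kappa> \<rho> A M"
  "dT R Sig \<Gamma>' v' T' M' \<tau> \<Longrightarrow> T' = ren f T \<Longrightarrow> drenI f g \<Gamma> v \<Gamma>' v' \<Longrightarrow>
    \<exists>M. M' = ren g M \<and> dT R Sig \<Gamma> v T M \<tau>"
proof (induction arbitrary: f g \<Gamma> v W and f g \<Gamma> v K \<kappa> and f g \<Gamma> v A \<kappa> and f g \<Gamma> v T rule: dW_dK_dA_dT.inducts)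
  case (Con \<Gamma>' v' c)
  then have "W = Con c" by (cases W) auto
  then show ?case by (intro exI[of _ "Con c"]) (simp add: dW_dK_dA_dT.Con)
next
  case (Var v' i j' \<Gamma>')
  then obtain k where W: "W = Var k" "i = f k" by (cases W) auto
  with Var obtain j where "v k = Some j" "j' = g j" "j < length \<Gamma>" "\<Gamma>' ! j' = \<Gamma> ! j"
    unfolding drenI_def by blast
  with W dW_dK_dA_dT.Var[of v k j \<Gamma> R Sig] show ?case by (intro exI[of _ "Var j"]) simp
next
  case (Lam \<Gamma>' v' \<tau> K' Vs' \<sigma>)
  then obtain K where W: "W = Lam (cont_ty R \<tau>) K" "K' = ren (up_ren f) K" by (cases W) auto
  from Lam.IH(2)[OF W(2) _ drenI_hide[OF Lam.prems(2)], of 0] obtain Vs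
    where Vs: "Vs' = map (ren g) Vs" "dK R Sig \<Gamma> (hide v) 0 \<tau> K Vs \<sigma>" by auto
  from dW_dK_dA_dT.Lam[OF Vs(2)] show ?case unfolding W Vs(1)
    by (intro exI[of _ "Lam \<sigma> (fills (map lift Vs) (Var 0))"]) (simp add: ren_fills ren_up_lift comp_def)
next
  case (Box \<Gamma>' v' Ws' us' B V \<tau>)
  then obtain Ws where W: "W = Box (map (cps_ty R) (map snd us')) Ws B" "Ws' = map (ren f) Ws" by (cases W) auto
  have "\<exists>us. us' = map (map_prod (ren g) id) us \<and> list_all2 (\<lambda>W u. dW R Sig \<Gamma> v W (fst u) (Nec (snd u))) Ws us"
    using Box.IH(1) W(2)
  proof (induction Ws' us' arbitrary: Ws rule: list_all2_induct)
    case (Cons W' Ws' u' us')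
    then obtain W Ws2 where Ws: "Ws = W # Ws2" "W' = ren f W" "Ws' = map (ren f) Ws2" by auto
    with Cons(1) Box.prems(2) obtain X where X: "fst u' = ren g X" "dW R Sig \<Gamma> v W X (Nec (snd u'))" by blast
    from Cons(3)[OF Ws(3)] obtain us where "us' = map (map_prod (ren g) id) us"
      "list_all2 (\<lambda>W u. dW R Sig \<Gamma> v W (fst u) (Nec (snd u))) Ws2 us" by blast
    with X Ws show ?case by (intro exI[of _ "(X, snd u') # us"]) (auto simp: prod_eq_iff)
  qed simp
  then obtain us where us: "us' = map (map_prod (ren g) id) us"
    "list_all2 (\<lambda>W u. dW R Sig \<Gamma> v W (fst u) (Nec (snd u))) Ws us" by blast
  have eq: "map snd us' = map snd us" "map fst us' = map (ren g) (map fst us)" unfolding us(1) by simp_all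
  have "dW R Sig \<Gamma> v W (Box (map snd us) (map fst us) V) (Nec \<tau>)"
    using dW_dK_dA_dT.Box[OF us(2)] Box.IH(2) unfolding W eq .
  moreover have "Box (map snd us') (map fst us') V = ren g (Box (map snd us) (map fst us) V)"
    unfolding eq by simp
  ultimately show ?case by blast
next
  case (KVar \<Gamma>' v' \<kappa>' \<rho>)
  then obtain i where "K = Var i" "f i = f \<kappa>" by (cases K) auto
  with KVar have "K = Var \<kappa>" unfolding drenI_def by (auto dest: injD)
  then show ?case by (auto intro: dW_dK_dA_dT.KVar)
next
  case (KLam \<sigma> \<Gamma>' v' \<kappa>' \<rho> A' M')
  then obtain A where K: "K = Lam (cps_ty R \<sigma>) A" "A' = ren (up_ren f) A" by (cases K) auto
  from KLam.IH(2)[OF K(2) _ drenI_bind[OF KLam.prems(3)], of "Suc \<kappa>"] KLam.prems(2) obtain M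
    where M: "M' = ren (up_ren g) M" "dA R Sig (\<sigma> # \<Gamma>) (bind v) (Suc \<kappa>) \<rho> A M" by auto
  from dW_dK_dA_dT.KLam[OF M(2)] show ?case unfolding K M(1) by (intro exI[of _ "[Lam \<sigma> M]"]) simp
next
  case (KApp \<Gamma>' v' W' V' \<sigma> \<sigma>' \<kappa>' \<rho> K' Vs')
  then obtain W K2 where K: "K = App W K2" "W' = ren f W" "K' = ren f K2" by (cases K) auto
  from KApp.IH(2)[OF K(2) KApp.prems(3)] KApp.IH(4)[OF K(3) KApp.prems(2) KApp.prems(3)]
  obtain V Vs where "V' = ren g V" "dW R Sig \<Gamma> v W V (\<sigma> \<rightarrow> \<sigma>')" "Vs' = map (ren g) Vs" "dK R Sig \<Gamma> v \<kappa> \<rho> K2 Vs \<sigma>'"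
    by blast
  then show ?case unfolding K by (intro exI[of _ "Vs @ [V]"]) (auto intro: dW_dK_dA_dT.KApp)
next
  case (AVal \<Gamma>' v' \<kappa>' \<rho> K' Vs' \<sigma> W' V')
  then obtain K W where A: "A = App K W" "K' = ren f K" "W' = ren f W" by (cases A) auto
  from AVal.IH(4)[OF A(3) AVal.prems(3)] AVal.IH(2)[OF A(2) AVal.prems(2) AVal.prems(3)]
  obtain V Vs where "V' = ren g V" "dW R Sig \<Gamma> v W V \<sigma>" "Vs' = map (ren g) Vs" "dK R Sig \<Gamma> v \<kappa> \<rho> K Vs \<sigma>"
    by blast
  then show ?case unfolding A by (intro exI[of _ "fills Vs V"]) (auto simp: ren_fills intro: dW_dK_dA_dT.AVal)
next
  case (ATerm \<Gamma>' v' T' M' \<sigma> \<kappa>' \<rho> K' Vs')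
  then obtain K T where A: "A = App T K" "K' = ren f K" "T' = ren f T" by (cases A) auto
  from ATerm.IH(2)[OF A(3) ATerm.prems(3)] ATerm.IH(4)[OF A(2) ATerm.prems(2) ATerm.prems(3)]
  obtain M Vs where "M' = ren g M" "dT R Sig \<Gamma> v T M \<sigma>" "Vs' = map (ren g) Vs" "dK R Sig \<Gamma> v \<kappa> \<rho> K Vs \<sigma>"
    by blast
  then show ?case unfolding A by (intro exI[of _ "fills Vs M"]) (auto simp: ren_fills intro: dW_dK_dA_dT.ATerm)
next
  case (TLam \<Gamma>' v' \<tau> A' M')
  then obtain A where T: "T = Lam (cont_ty R \<tau>) A" "A' = ren (up_ren f) A" by (cases T) auto
  from TLam.IH(2)[OF T(2) _ drenI_hide[OF TLam.prems(2)], of 0] obtain M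
    where M: "M' = ren g M" "dA R Sig \<Gamma> (hide v) 0 \<tau> A M" by auto
  from dW_dK_dA_dT.TLam[OF M(2)] show ?case unfolding T M(1) by blast
qed

lemma dT_lift_hide_inv: "dT R Sig \<Gamma> (hide v) (lift T) M \<tau> \<Longrightarrow> dT R Sig \<Gamma> v T M \<tau>"
  using decode_ren_inv(4)[of R Sig \<Gamma> "hide v" "lift T" M \<tau> Suc T "\<lambda>i. i" \<Gamma> v] by (auto simp: drenI_def)

lemma dW_lift_hide_inv: "dW R Sig \<Gamma> (hide v) (lift W) V \<tau> \<Longrightarrow> dW R Sig \<Gamma> v W V \<tau>"
  using decode_ren_inv(1)[of R Sig \<Gamma> "hide v" "lift W" V \<tau> Suc W "\<lambda>i. i" \<Gamma> v] by (auto simp: drenI_def)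

lemma dK_lift_bind_inv: "dK R Sig (\<alpha> # \<Gamma>) (bind v) (Suc \<kappa>) \<rho> (lift K) Vs \<sigma> \<Longrightarrow>
    \<exists>Us. Vs = map lift Us \<and> dK R Sig \<Gamma> v \<kappa> \<rho> K Us \<sigma>"
  by (rule decode_ren_inv(2)[where f = Suc and \<Gamma>' = "\<alpha> # \<Gamma>"]) (auto simp: drenI_def)

text \<open>Constrains value variables only. The live continuation variable is treated separately:
  it goes to a variable in \<open>decode_sub\<close> and to a continuation in
  \<open>decode_ksub\<close>.\<close>

definition dsub :: "'p \<Rightarrow> ('c \<Rightarrow> 'p ty) \<Rightarrow> (nat \<Rightarrow> ('p, 'c) tm) \<Rightarrow> (nat \<Rightarrow> ('p, 'c) tm) \<Rightarrow>
    'p ty list \<Rightarrow> (nat \<Rightarrow> nat option) \<Rightarrow> 'p ty list \<Rightarrow> (nat \<Rightarrow> nat option) \<Rightarrow> bool" where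
  "dsub R Sig \<theta> s \<Gamma> v \<Gamma>' v' \<longleftrightarrow> (\<forall>i j. v i = Some j \<longrightarrow> j < length \<Gamma> \<longrightarrow> dW R Sig \<Gamma>' v' (\<theta> i) (s j) (\<Gamma> ! j))"

lemma dsub_hide: "dsub R Sig \<theta> s \<Gamma> v \<Gamma>' v' \<Longrightarrow> dsub R Sig (up_sub \<theta>) s \<Gamma> (hide v) \<Gamma>' (hide v')"
  unfolding dsub_def
proof (intro allI impI)
  fix i j assume "\<forall>i j. v i = Some j \<longrightarrow> j < length \<Gamma> \<longrightarrow> dW R Sig \<Gamma>' v' (\<theta> i) (s j) (\<Gamma> ! j)"
    "hide v i = Some j" "j < length \<Gamma>"
  then show "dW R Sig \<Gamma>' (hide v') (up_sub \<theta> i) (s j) (\<Gamma> ! j)" by (cases i) (auto intro: dW_lift_hide)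
qed

lemma dsub_bind: "dsub R Sig \<theta> s \<Gamma> v \<Gamma>' v' \<Longrightarrow> dsub R Sig (up_sub \<theta>) (up_sub s) (\<sigma> # \<Gamma>) (bind v) (\<sigma> # \<Gamma>') (bind v')"
  unfolding dsub_def
proof (intro allI impI)
  fix i j assume a: "\<forall>i j. v i = Some j \<longrightarrow> j < length \<Gamma> \<longrightarrow> dW R Sig \<Gamma>' v' (\<theta> i) (s j) (\<Gamma> ! j)"
    "bind v i = Some j" "j < length (\<sigma> # \<Gamma>)"
  show "dW R Sig (\<sigma> # \<Gamma>') (bind v') (up_sub \<theta> i) (up_sub s j) ((\<sigma> # \<Gamma>) ! j)"
  proof (cases i)
    case 0
    with a dW_dK_dA_dT.Var[of "bind v'" 0 0 "\<sigma> # \<Gamma>'" R Sig] show ?thesis by simp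
  next
    case (Suc k)
    with a obtain z where "v k = Some z" "j = Suc z" "z < length \<Gamma>" by auto
    with a(1) Suc show ?thesis by (simp add: dW_lift_bind)
  qed
qed

lemma decode_sub:
  fixes Sig :: "'c \<Rightarrow> 'p ty"
  shows
  "dW R Sig \<Gamma> v W V \<sigma> \<Longrightarrow> dsub R Sig \<theta> s \<Gamma> v \<Gamma>' v' \<Longrightarrow> dW R Sig \<Gamma>' v' (sub \<theta> W) (sub s V) \<sigma>"
  "dK R Sig \<Gamma> v \<kappa> \<rho> K Vs \<sigma> \<Longrightarrow> dsub R Sig \<theta> s \<Gamma> v \<Gamma>' v' \<Longrightarrow> \<theta> \<kappa> = Var \<kappa>' \<Longrightarrow>
    dK R Sig \<Gamma>' v' \<kappa>' \<rho> (sub \<theta> K) (map (sub s) Vs) \<sigma>"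
  "dA R Sig \<Gamma> v \<kappa> \<rho> A M \<Longrightarrow> dsub R Sig \<theta> s \<Gamma> v \<Gamma>' v' \<Longrightarrow> \<theta> \<kappa> = Var \<kappa>' \<Longrightarrow>
    dA R Sig \<Gamma>' v' \<kappa>' \<rho> (sub \<theta> A) (sub s M)"
  "dT R Sig \<Gamma> v T M \<tau> \<Longrightarrow> dsub R Sig \<theta> s \<Gamma> v \<Gamma>' v' \<Longrightarrow> dT R Sig \<Gamma>' v' (sub \<theta> T) (sub s M) \<tau>"
proof (induction arbitrary: \<theta> s \<Gamma>' v' and \<theta> s \<Gamma>' v' \<kappa>' and \<theta> s \<Gamma>' v' \<kappa>' and \<theta> s \<Gamma>' v' rule: dW_dK_dA_dT.inducts)
  case (Con \<Gamma> v c)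
  then show ?case by (simp add: dW_dK_dA_dT.Con)
next
  case (Var v i j \<Gamma>)
  then show ?case by (simp add: dsub_def)
next
  case (Lam \<Gamma> v \<tau> K Vs \<sigma>)
  have "dK R Sig \<Gamma>' (hide v') 0 \<tau> (sub (up_sub \<theta>) K) (map (sub s) Vs) \<sigma>"
    by (rule Lam.IH(2)[OF dsub_hide[OF Lam.prems]]) simp
  from dW_dK_dA_dT.Lam[OF this] show ?case by (simp add: sub_fills sub_up_lift comp_def)
next
  case (Box \<Gamma> v Ws us B V \<tau>)
  let ?us = "map (map_prod (sub s) id) us"
  have "list_all2 (\<lambda>W u. dW R Sig \<Gamma>' v' W (fst u) (Nec (snd u))) (map (sub \<theta>) Ws) ?us"
    using Box by (auto simp: list_all2_conv_all_nth)
  moreover have "map snd ?us = map snd us" "map fst ?us = map (sub s) (map fst us)" by simp_all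
  ultimately show ?case using dW_dK_dA_dT.Box[of R Sig \<Gamma>' v' "map (sub \<theta>) Ws" ?us B V \<tau>] Box.IH(2)
    by (simp del: map_map)
next
  case (KVar \<Gamma> v \<kappa> \<rho>)
  then show ?case by (simp add: dW_dK_dA_dT.KVar)
next
  case (KLam \<sigma> \<Gamma> v \<kappa> \<rho> A M)
  have "dA R Sig (\<sigma> # \<Gamma>') (bind v') (Suc \<kappa>') \<rho> (sub (up_sub \<theta>) A) (sub (up_sub s) M)"
    by (rule KLam.IH(2)[OF dsub_bind[OF KLam.prems(1)]]) (simp add: KLam.prems(2))
  from dW_dK_dA_dT.KLam[OF this] show ?case by simp
next
  case (KApp \<Gamma> v W V \<sigma> \<sigma>' \<kappa> \<rho> K Vs)
  from dW_dK_dA_dT.KApp[OF KApp.IH(2)[OF KApp.prems(1)] KApp.IH(4)[OF KApp.prems]] show ?case by simp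
next
  case (AVal \<Gamma> v \<kappa> \<rho> K Vs \<sigma> W V)
  from dW_dK_dA_dT.AVal[OF AVal.IH(2)[OF AVal.prems] AVal.IH(4)[OF AVal.prems(1)]] show ?case by (simp add: sub_fills)
next
  case (ATerm \<Gamma> v T M \<sigma> \<kappa> \<rho> K Vs)
  from dW_dK_dA_dT.ATerm[OF ATerm.IH(2)[OF ATerm.prems(1)] ATerm.IH(4)[OF ATerm.prems]] show ?case by (simp add: sub_fills)
next
  case (TLam \<Gamma> v \<tau> A M)
  have "dA R Sig \<Gamma>' (hide v') 0 \<tau> (sub (up_sub \<theta>) A) (sub s M)"
    by (rule TLam.IH(2)[OF dsub_hide[OF TLam.prems]]) simp
  from dW_dK_dA_dT.TLam[OF this] show ?case by simp
qed

text \<open>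
  Substituting a continuation for the live continuation variable composes the stacks, but only up
  to \<open>\<beta>\<^sub>v\<close> and lifting: in \<open>(\<lambda>x. A)[k := K]\<close> the stack of \<open>K\<close> ends up inside the abstraction.
\<close>

lemma decode_ksub:
  fixes Sig :: "'c \<Rightarrow> 'p ty"
  shows "dW R Sig \<Gamma> v W V \<sigma> \<Longrightarrow> True"
  "dK R Sig \<Gamma> v \<kappa> \<rho> K1 Vs1 \<sigma> \<Longrightarrow> dsub R Sig \<theta> Var \<Gamma> v \<Gamma> v' \<Longrightarrow> dK R Sig \<Gamma> v' \<kappa>' \<rho>' (\<theta> \<kappa>) Vs \<rho> \<Longrightarrow>
    \<exists>Vs'. dK R Sig \<Gamma> v' \<kappa>' \<rho>' (sub \<theta> K1) Vs' \<sigma> \<and> keq Sig \<Gamma> \<sigma> \<rho>' Vs' (Vs @ Vs1)"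
  "dA R Sig \<Gamma> v \<kappa> \<rho> A M \<Longrightarrow> dsub R Sig \<theta> Var \<Gamma> v \<Gamma> v' \<Longrightarrow> dK R Sig \<Gamma> v' \<kappa>' \<rho>' (\<theta> \<kappa>) Vs \<rho> \<Longrightarrow>
    \<exists>M'. dA R Sig \<Gamma> v' \<kappa>' \<rho>' (sub \<theta> A) M' \<and> eqv Sig \<Gamma> \<rho>' M' (fills Vs M)"
  "dT R Sig \<Gamma> v T M \<tau> \<Longrightarrow> True"
proof (induction arbitrary: and \<theta> v' \<kappa>' \<rho>' Vs and \<theta> v' \<kappa>' \<rho>' Vs rule: dW_dK_dA_dT.inducts)
  case (KVar \<Gamma> v \<kappa> \<rho>)
  then show ?case by (auto intro: keq_refl decode_typing)
next
  case (KLam \<sigma> \<Gamma> v \<kappa> \<rho> A M)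
  have "dsub R Sig (up_sub \<theta>) Var (\<sigma> # \<Gamma>) (bind v) (\<sigma> # \<Gamma>) (bind v')"
    using dsub_bind[OF KLam.prems(1)] by simp
  from KLam.IH(2)[OF this, of "Suc \<kappa>'" \<rho>' "map lift Vs"] dK_lift_bind[OF KLam.prems(2), of \<sigma>] obtain M'
    where M': "dA R Sig (\<sigma> # \<Gamma>) (bind v') (Suc \<kappa>') \<rho>' (sub (up_sub \<theta>) A) M'"
      "eqv Sig (\<sigma> # \<Gamma>) \<rho>' M' (fills (map lift Vs) M)" by auto
  note Vs = decode_typing(2)[OF KLam.prems(2)] and M = decode_typing(3)[OF KLam.IH(1)]
  \<comment> \<open>Two stacks have to agree on a fresh variable: one whose only entry is the
    abstraction of \<open>M'\<close>, with \<open>Vs\<close> absorbed in the body, and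
    \<open>Vs\<close> followed by the abstraction of \<open>M\<close>. Beta at the variable
    identifies them.\<close>
  have "eqv Sig (\<sigma> # \<Gamma>) \<rho>' (fills (map lift Vs) (App (lift (Lam \<sigma> M)) (Var 0))) (fills (map lift Vs) M)"
    by (rule eqv_fills[OF _ eqv_beta_Var[OF M]]) (use Vs in simp)
  with M'(2) have "eqv Sig (\<sigma> # \<Gamma>) \<rho>' M' (fills (map lift (Vs @ [Lam \<sigma> M])) (Var 0))"
    using veq_sym veq_trans by (simp del: ren.simps) blast
  then have "keq Sig \<Gamma> \<sigma> \<rho>' [Lam \<sigma> M'] (Vs @ [Lam \<sigma> M])"
    by (rule keq_single) (use M' Vs M decode_typing(3) in \<open>auto simp: stack_append\<close>)
  with dW_dK_dA_dT.KLam[OF M'(1)] show ?case by auto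
next
  case (KApp \<Gamma> v W V \<sigma> \<sigma>' \<kappa> \<rho> K Us)
  from KApp.IH(4)[OF KApp.prems] obtain Vs' where Vs': "dK R Sig \<Gamma> v' \<kappa>' \<rho>' (sub \<theta> K) Vs' \<sigma>'"
    "keq Sig \<Gamma> \<sigma>' \<rho>' Vs' (Vs @ Us)" by blast
  \<comment> \<open>A value does not use the live continuation variable, so its decoding is
    unchanged; on the source side the substitution is the identity.\<close>
  have "dW R Sig \<Gamma> v' (sub \<theta> W) V (\<sigma> \<rightarrow> \<sigma>')"
    using decode_sub(1)[OF KApp.IH(1) KApp.prems(1)] by simp
  from dW_dK_dA_dT.KApp[OF this Vs'(1)] keq_append[OF Vs'(2), of \<sigma> "[V]"] decode_typing(1)[OF KApp.IH(1)]
  show ?case by auto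
next
  case (AVal \<Gamma> v \<kappa> \<rho> K Us \<sigma> W V)
  from AVal.IH(2)[OF AVal.prems] obtain Vs' where Vs': "dK R Sig \<Gamma> v' \<kappa>' \<rho>' (sub \<theta> K) Vs' \<sigma>"
    "keq Sig \<Gamma> \<sigma> \<rho>' Vs' (Vs @ Us)" by blast
  have "dW R Sig \<Gamma> v' (sub \<theta> W) V \<sigma>"
    using decode_sub(1)[OF AVal.IH(3) AVal.prems(1)] by simp
  from dW_dK_dA_dT.AVal[OF Vs'(1) this] keq_fills[OF Vs'(2), of V] decode_typing(1)[OF AVal.IH(3)]
  show ?case by auto
next
  case (ATerm \<Gamma> v T M \<sigma> \<kappa> \<rho> K Us)
  from ATerm.IH(4)[OF ATerm.prems] obtain Vs' where Vs': "dK R Sig \<Gamma> v' \<kappa>' \<rho>' (sub \<theta> K) Vs' \<sigma>"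
    "keq Sig \<Gamma> \<sigma> \<rho>' Vs' (Vs @ Us)" by blast
  have "dT R Sig \<Gamma> v' (sub \<theta> T) M \<sigma>"
    using decode_sub(4)[OF ATerm.IH(1) ATerm.prems(1)] by simp
  from dW_dK_dA_dT.ATerm[OF this Vs'(1)] keq_fills[OF Vs'(2), of M] decode_typing(4)[OF ATerm.IH(1)]
  show ?case by auto
qed simp_all

subsection \<open>Reduction in the image\<close>

lemma cbn_red_Con [simp]: "\<not> cbn_red (Con c) X"
  by (auto simp: cbn_red_def elim: compat.cases cbn_root.cases)

lemma cbn_red_Var [simp]: "\<not> cbn_red (Var i) X"
  by (auto simp: cbn_red_def elim: compat.cases cbn_root.cases)

lemma cbn_red_Lam_cases:
  assumes "cbn_red (Lam \<sigma> A) X"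
  obtains A' where "X = Lam \<sigma> A'" "cbn_red A A'"
  | "A = App (lift X) (Var 0)"
  using assms unfolding cbn_red_def by (cases rule: compat.cases) (auto elim: cbn_root.cases)

lemma cbn_red_App_cases:
  assumes "cbn_red (App M N) X"
  obtains M' where "X = App M' N" "cbn_red M M'"
  | N' where "X = App M N'" "cbn_red N N'"
  | \<sigma> P where "M = Lam \<sigma> P" "X = sub0 N P"
  using assms unfolding cbn_red_def by (cases rule: compat.cases) (auto elim: cbn_root.cases)

lemma cbn_red_Box_cases:
  assumes "cbn_red (Box ts Ns M) X"
  obtains Ps N N' Qs where "Ns = Ps @ N # Qs" "X = Box ts (Ps @ N' # Qs) M" "cbn_red N N'"
  | M' where "X = Box ts Ns M'" "cbn_red M M'"
  | \<sigma> where "ts = [\<sigma>]" "Ns = [X]" "M = Var 0"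
  | ws \<sigma> zs Ps ys Ls N Qs where "ts = ws @ \<sigma> # zs" "Ns = Ps @ Box ys Ls N # Qs"
      "length ws = length Ps" "length ys = length Ls"
      "X = Box (ws @ ys @ zs) (Ps @ Ls @ Qs) (flat_sub (length ws) (length ys) N M)"
  using assms unfolding cbn_red_def by (cases rule: compat.cases) (auto elim!: cbn_root.cases)

lemma dA_sub0:
  assumes "dA R Sig (\<sigma> # \<Gamma>) (bind v) (Suc \<kappa>) \<rho> A M" "dW R Sig \<Gamma> v W V \<sigma>"
  shows "dA R Sig \<Gamma> v \<kappa> \<rho> (sub0 W A) (sub0 V M)"
  unfolding sub0_def
proof (rule decode_sub(3)[OF assms(1)])
  show "dsub R Sig (case_nat W Var) (case_nat V Var) (\<sigma> # \<Gamma>) (bind v) \<Gamma> v"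
    unfolding dsub_def
  proof (intro allI impI)
    fix i j assume "bind v i = Some j" "j < length (\<sigma> # \<Gamma>)"
    then show "dW R Sig \<Gamma> v (case_nat W Var i) (case_nat V Var j) ((\<sigma> # \<Gamma>) ! j)"
      using assms(2) by (cases i) (auto intro: dW_dK_dA_dT.Var)
  qed
qed simp

text \<open>Index \<open>0\<close> is hidden, so any \<open>K\<close> may be put there.\<close>

lemma dsub_cont: "dsub R Sig (case_nat K Var) Var \<Gamma> (hide v) \<Gamma> v"
  by (auto simp: dsub_def split: nat.splits intro: dW_dK_dA_dT.Var)

lemma dW_flat_sub:
  assumes "dW R Sig (ws @ \<sigma> # zs) Some B V \<tau>" "dW R Sig ys Some N U \<sigma>"
  shows "dW R Sig (ws @ ys @ zs) Some (flat_sub (length ws) (length ys) N B) (flat_sub (length ws) (length ys) U V) \<tau>"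
  unfolding flat_sub_def
proof (rule decode_sub(1)[OF assms(1)], unfold dsub_def, intro allI impI)
  fix i j assume a: "Some i = Some j" "j < length (ws @ \<sigma> # zs)"
  let ?n = "length ws" and ?m = "length ys" and ?\<Gamma> = "ws @ ys @ zs"
  have N: "dW R Sig ?\<Gamma> Some (ren (\<lambda>j. ?n + j) N) (ren (\<lambda>j. ?n + j) U) \<sigma>"
    by (rule decode_ren(1)[OF assms(2)]) (auto simp: dren_def nth_append)
  have Var: "dW R Sig ?\<Gamma> Some (Var i) (Var i) (?\<Gamma> ! i)" if "i < length ?\<Gamma>" for i
    by (rule dW_dK_dA_dT.Var) (use that in auto)
  consider "i < ?n" | "i = ?n" | "i > ?n" by linarith
  then show "dW R Sig ?\<Gamma> Some
      (if i < ?n then Var i else if i = ?n then ren (\<lambda>j. ?n + j) N else Var (i - 1 + ?m))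
      (if j < ?n then Var j else if j = ?n then ren (\<lambda>j. ?n + j) U else Var (j - 1 + ?m)) ((ws @ \<sigma> # zs) ! j)"
  proof cases
    case 1
    with a Var[of i] show ?thesis by (simp add: nth_append)
  next
    case 2
    with a N show ?thesis by (simp add: nth_append)
  next
    case 3
    then obtain d where i: "i = ?n + Suc d" using less_imp_Suc_add by auto
    then have "i - 1 + ?m = ?n + (?m + d)" by simp
    then have "?\<Gamma> ! (i - 1 + ?m) = (ws @ \<sigma> # zs) ! i"
      unfolding i by (simp only: nth_append_length_plus nth_Cons_Suc)
    with 3 a Var[of "i - 1 + ?m"] show ?thesis by simp
  qed
qed

lemma keq_sym: "keq Sig \<Gamma> \<sigma> \<rho> Vs Ws \<Longrightarrow> keq Sig \<Gamma> \<sigma> \<rho> Ws Vs"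
  unfolding keq_def using veq_sym by blast

lemma keq_trans: "keq Sig \<Gamma> \<sigma> \<rho> Us Vs \<Longrightarrow> keq Sig \<Gamma> \<sigma> \<rho> Vs Ws \<Longrightarrow> keq Sig \<Gamma> \<sigma> \<rho> Us Ws"
  unfolding keq_def using veq_trans by blast

lemma keq_prepend:
  assumes "keq Sig \<Gamma> \<sigma> \<sigma>' Us Ws" "stack Sig \<Gamma> \<sigma>' Vs \<rho>"
  shows "keq Sig \<Gamma> \<sigma> \<rho> (Vs @ Us) (Vs @ Ws)"
  using assms by (auto simp: keq_def stack_append intro!: eqv_fills[of _ _ \<sigma>'])

lemma keq_snoc:
  assumes "veq Q Sig \<Gamma> (\<sigma> \<rightarrow> \<sigma>') V V'" "stack Sig \<Gamma> \<sigma>' Vs \<rho>" "\<And>M. Q (lift M) = Q M"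
    and "cbv_typing Sig \<Gamma> V (\<sigma> \<rightarrow> \<sigma>')" "cbv_typing Sig \<Gamma> V' (\<sigma> \<rightarrow> \<sigma>')" "is_val V" "is_val V'"
  shows "keq Sig \<Gamma> \<sigma> \<rho> (Vs @ [V]) (Vs @ [V'])"
proof -
  have "eqv Sig (\<sigma> # \<Gamma>) \<sigma>' (App (lift V) (Var 0)) (App (lift V') (Var 0))"
    by (rule veq_appL[OF veq_lift[OF assms(1,3)]]) simp
  with assms have "keq Sig \<Gamma> \<sigma> \<sigma>' [V] [V']" by (auto simp: keq_def)
  from keq_prepend[OF this assms(2)] show ?thesis .
qed

text \<open>Each kind of target redex has its source reading. Eta on a value is
  \<open>eta_v\<close>, and eta on a continuation is absorbed by \<open>keq\<close>; beta with a
  value is \<open>beta_v\<close>; beta with a continuation composes stacks as in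
  \<open>decode_ksub\<close>; the box rules correspond to those of the source. Values are related
  through values only, since they may be box bodies.\<close>

lemma decode_step:
  fixes Sig :: "'c \<Rightarrow> 'p ty"
  shows
  "dW R Sig \<Gamma> v W V \<sigma> \<Longrightarrow> cbn_red W W' \<Longrightarrow> \<exists>V'. dW R Sig \<Gamma> v W' V' \<sigma> \<and> veq is_val Sig \<Gamma> \<sigma> V V'"
  "dK R Sig \<Gamma> v \<kappa> \<rho> K Vs \<sigma> \<Longrightarrow> cbn_red K K' \<Longrightarrow> \<exists>Vs'. dK R Sig \<Gamma> v \<kappa> \<rho> K' Vs' \<sigma> \<and> keq Sig \<Gamma> \<sigma> \<rho> Vs Vs'"
  "dA R Sig \<Gamma> v \<kappa> \<rho> A M \<Longrightarrow> cbn_red A A' \<Longrightarrow> \<exists>M'. dA R Sig \<Gamma> v \<kappa> \<rho> A' M' \<and> eqv Sig \<Gamma> \<rho> M M'"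
  "dT R Sig \<Gamma> v T M \<tau> \<Longrightarrow> cbn_red T T' \<Longrightarrow> \<exists>M'. dT R Sig \<Gamma> v T' M' \<tau> \<and> eqv Sig \<Gamma> \<tau> M M'"
proof (induction arbitrary: W' and K' and A' and T' rule: dW_dK_dA_dT.inducts)
  case (Lam \<Gamma> v \<tau> K Vs \<sigma>)
  from Lam.prems show ?case
  proof (cases rule: cbn_red_Lam_cases)
    case (1 K')
    from Lam.IH(2)[OF 1(2)] obtain Vs' where Vs': "dK R Sig \<Gamma> (hide v) 0 \<tau> K' Vs' \<sigma>" "keq Sig \<Gamma> \<sigma> \<tau> Vs Vs'"
      by blast
    have "veq is_val Sig \<Gamma> (\<sigma> \<rightarrow> \<tau>) (Lam \<sigma> (fills (map lift Vs) (Var 0))) (Lam \<sigma> (fills (map lift Vs') (Var 0)))"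
      using Vs'(2) unfolding keq_def by (intro veq_Lam) (elim conjE)
    with dW_dK_dA_dT.Lam[OF Vs'(1)] show ?thesis unfolding 1(1) by (intro exI conjI)
  next
    case 2
    \<comment> \<open>The argument \<open>Var 0\<close> is the live continuation, whose stack is
      empty. So the whole stack is one value, and the decoding is an eta redex.\<close>
    from Lam.IH(1)[unfolded 2] obtain V where V: "Vs = [V]" "dW R Sig \<Gamma> (hide v) (lift W') V (\<sigma> \<rightarrow> \<tau>)"
      by (auto elim!: dK_AppE dK_VarE)
    note W' = dW_lift_hide_inv[OF V(2)]
    have "veq is_val Sig \<Gamma> (\<sigma> \<rightarrow> \<tau>) (Lam \<sigma> (App (lift V) (Var 0))) V"
      by (rule veq_step) (use decode_typing(1)[OF W'] in \<open>auto intro: cbv_root.eta_v\<close>)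
    with W' V show ?thesis by auto
  qed
next
  case (Box \<Gamma> v Ws us B V \<tau>)
  have B: "dW R Sig (map snd us) Some B V \<tau>" using Box.IH(2) .
  have tV: "cbv_typing Sig (map snd us) V \<tau>" "is_val V" using decode_typing(1)[OF B] by auto
  have l: "list_all2 (\<lambda>W u. dW R Sig \<Gamma> v W (fst u) (Nec (snd u))) Ws us"
    using Box.IH(1) by (rule list_all2_mono) blast
  have "list_all2 (\<lambda>W u. cbv_typing Sig \<Gamma> (fst u) (Nec (snd u)) \<and> is_val (fst u)) Ws us"
    using l by (rule list_all2_mono) (rule decode_typing(1))
  then have tus: "\<forall>u \<in> set us. cbv_typing Sig \<Gamma> (fst u) (Nec (snd u)) \<and> is_val (fst u)"
    by (induction rule: list_all2_induct) auto
  have targs: "list_all2 (\<lambda>N \<sigma>. cbv_typing Sig \<Gamma> N (Nec \<sigma>)) (map fst us') (map snd us')"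
    if "set us' \<subseteq> set us" for us'
    using that tus by (auto simp: list_all2_map1 list_all2_map2 list_all2_same)
  from Box.prems show ?case
  proof (cases rule: cbn_red_Box_cases)
    case (1 Ps N N' Qs)
    from l[unfolded 1(1)] obtain vs1 u' vs2 where vs: "us = vs1 @ u' # vs2"
      "list_all2 (\<lambda>W u. dW R Sig \<Gamma> v W (fst u) (Nec (snd u))) Ps vs1" "dW R Sig \<Gamma> v N (fst u') (Nec (snd u'))"
      "list_all2 (\<lambda>W u. dW R Sig \<Gamma> v W (fst u) (Nec (snd u))) Qs vs2"
      by (auto simp: list_all2_append1 list_all2_Cons1)
    have "list_all2 (\<lambda>W u. dW R Sig \<Gamma> v W (fst u) (Nec (snd u)) \<and> (\<forall>x. cbn_red W x \<longrightarrow>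
       (\<exists>V'. dW R Sig \<Gamma> v x V' (Nec (snd u)) \<and> veq is_val Sig \<Gamma> (Nec (snd u)) (fst u) V'))) (Ps @ N # Qs) (vs1 @ u' # vs2)"
      using Box.IH(1) unfolding 1(1) vs(1)[symmetric] .
    with list_all2_lengthD[OF vs(2)] 1(3) obtain V' where V': "dW R Sig \<Gamma> v N' V' (Nec (snd u'))"
      "veq is_val Sig \<Gamma> (Nec (snd u')) (fst u') V'"
      by (auto simp: list_all2_append)
    let ?us = "vs1 @ (V', snd u') # vs2"
    have snd: "map snd ?us = map snd us" by (simp add: vs)
    have "dW R Sig \<Gamma> v (Box (map (cps_ty R) (map snd ?us)) (Ps @ N' # Qs) B) (Box (map snd ?us) (map fst ?us) V) (Nec \<tau>)"
      by (rule dW_dK_dA_dT.Box) (use vs V' B snd in \<open>simp_all add: list_all2_appendI\<close>)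
    moreover have "veq is_val Sig \<Gamma> (Nec \<tau>)
       (Box (map snd vs1 @ snd u' # map snd vs2) (map fst vs1 @ fst u' # map fst vs2) V)
       (Box (map snd vs1 @ snd u' # map snd vs2) (map fst vs1 @ V' # map fst vs2) V)"
      by (rule veq_boxArg[OF V'(2)]) (use targs tV tus vs in auto)
    ultimately show ?thesis using 1 snd vs(1) by auto
  next
    case (2 B')
    from Box.IH(3)[OF 2(2)] obtain V' where V': "dW R Sig (map snd us) Some B' V' \<tau>"
      "veq is_val Sig (map snd us) \<tau> V V'" by blast
    have "veq is_val Sig \<Gamma> (Nec \<tau>) (Box (map snd us) (map fst us) V) (Box (map snd us) (map fst us) V')"
      by (rule veq_boxBody[OF V'(2)]) (use targs tus in auto)
    with dW_dK_dA_dT.Box[OF l V'(1)] 2 show ?thesis by blast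
  next
    case (3 \<sigma>)
    then obtain u where u: "us = [u]" by auto
    with 3 B have V: "V = Var 0" "\<tau> = snd u" by (auto elim: dW_VarE)
    from l u 3 have W': "dW R Sig \<Gamma> v W' (fst u) (Nec (snd u))" by simp
    have "veq is_val Sig \<Gamma> (Nec \<tau>) (Box [snd u] [fst u] (Var 0)) (fst u)"
      by (rule veq_step) (use V tus u in \<open>auto intro: cbv_root.box_id_v\<close>)
    with W' V u show ?thesis by auto
  next
    case (4 ws \<sigma> zs Ps ys Ls N Qs)
    from l[unfolded 4(2)] obtain us1 u us2 where us: "us = us1 @ u # us2"
      and u1: "list_all2 (\<lambda>W u. dW R Sig \<Gamma> v W (fst u) (Nec (snd u))) Ps us1"
      and u: "dW R Sig \<Gamma> v (Box ys Ls N) (fst u) (Nec (snd u))"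
      and u2: "list_all2 (\<lambda>W u. dW R Sig \<Gamma> v W (fst u) (Nec (snd u))) Qs us2"
      by (auto simp: list_all2_append1 list_all2_Cons1)
    have "length ws = length us1" using 4 list_all2_lengthD[OF u1] by simp
    with 4(1) us have ws: "ws = map (cps_ty R) (map snd us1)" and zs: "zs = map (cps_ty R) (map snd us2)"
      by auto
    from u obtain us3 U where ys: "ys = map (cps_ty R) (map snd us3)" and fu: "fst u = Box (map snd us3) (map fst us3) U"
      and u3: "list_all2 (\<lambda>W u. dW R Sig \<Gamma> v W (fst u) (Nec (snd u))) Ls us3"
      and N: "dW R Sig (map snd us3) Some N U (snd u)"
      by (auto elim: dW_BoxE)
    let ?us = "us1 @ us3 @ us2"
    let ?V = "flat_sub (length us1) (length us3) U V"
    have body: "dW R Sig (map snd ?us) Some (flat_sub (length us1) (length us3) N B) ?V \<tau>"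
      using dW_flat_sub[of R Sig "map snd us1" "snd u" "map snd us2" B V \<tau> "map snd us3" N U] B N us by simp
    have "list_all2 (\<lambda>W u. dW R Sig \<Gamma> v W (fst u) (Nec (snd u))) (Ps @ Ls @ Qs) ?us"
      using u1 u2 u3 by (simp add: list_all2_appendI)
    from dW_dK_dA_dT.Box[OF this body]
    have d: "dW R Sig \<Gamma> v W' (Box (map snd ?us) (map fst ?us) ?V) (Nec \<tau>)"
      unfolding 4(5) ws zs ys by simp
    \<comment> \<open>All arguments in the image decode to values and so does the inner body, as the
      flattening rule of the source demands.\<close>
    have "cbv_root (Box (map snd us1 @ snd u # map snd us2) (map fst us1 @ Box (map snd us3) (map fst us3) U # map fst us2) V)
        (Box (map snd us1 @ map snd us3 @ map snd us2) (map fst us1 @ map fst us3 @ map fst us2)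
          (flat_sub (length (map snd us1)) (length (map snd us3)) U V))"
      by (rule cbv_root.box_flat_v) (use us tus decode_typing(1)[OF N] in auto)
    then have root: "cbv_root (Box (map snd us) (map fst us) V) (Box (map snd ?us) (map fst ?us) ?V)"
      by (simp add: us fu)
    have "veq is_val Sig \<Gamma> (Nec \<tau>) (Box (map snd us) (map fst us) V) (Box (map snd ?us) (map fst ?us) ?V)"
      by (rule veq_step[OF root])
        (use decode_typing(1)[OF d] decode_typing(1)[OF dW_dK_dA_dT.Box[OF l B]] in auto)
    with d show ?thesis by blast
  qed
next
  case (KLam \<sigma> \<Gamma> v \<kappa> \<rho> A M)
  note M = decode_typing(3)[OF KLam.IH(1)]
  from KLam.prems show ?case
  proof (cases rule: cbn_red_Lam_cases)
    case (1 A')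
    from KLam.IH(2)[OF 1(2)] obtain M' where M': "dA R Sig (\<sigma> # \<Gamma>) (bind v) (Suc \<kappa>) \<rho> A' M'"
      "eqv Sig (\<sigma> # \<Gamma>) \<rho> M M'" by blast
    note tM' = decode_typing(3)[OF M'(1)]
    have "eqv Sig (\<sigma> # \<Gamma>) \<rho> M (fills (map lift [Lam \<sigma> M']) (Var 0))"
      using veq_trans[OF M'(2) veq_sym[OF eqv_beta_Var[OF tM']]] by simp
    then have "keq Sig \<Gamma> \<sigma> \<rho> [Lam \<sigma> M] [Lam \<sigma> M']"
      by (rule keq_single) (use M tM' in auto)
    with dW_dK_dA_dT.KLam[OF M'(1)] 1 show ?thesis by blast
  next
    case 2
    \<comment> \<open>\<open>Var 0\<close> is the bound value variable and differs from the live
      continuation \<open>Suc \<kappa>\<close>, so the body must be a continuation applied to a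
      value.\<close>
    from KLam.IH(1)[unfolded 2] obtain Vs where Vs: "dK R Sig (\<sigma> # \<Gamma>) (bind v) (Suc \<kappa>) \<rho> (lift K') Vs \<sigma>"
      "M = fills Vs (Var 0)"
      by (auto elim!: dA_AppE dK_VarE dW_VarE)
    from dK_lift_bind_inv[OF Vs(1)] obtain Us where Us: "Vs = map lift Us" "dK R Sig \<Gamma> v \<kappa> \<rho> K' Us \<sigma>" by blast
    have "keq Sig \<Gamma> \<sigma> \<rho> [Lam \<sigma> M] Us"
      by (rule keq_single) (use Us Vs M decode_typing(2)[OF Us(2)] in auto)
    with Us show ?thesis by blast
  qed
next
  case (KApp \<Gamma> v W V \<sigma> \<sigma>' \<kappa> \<rho> K Vs)
  note tV = decode_typing(1)[OF KApp.IH(1)] and tVs = decode_typing(2)[OF KApp.IH(3)]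
  from KApp.prems show ?case
  proof (cases rule: cbn_red_App_cases)
    case (1 W')
    from KApp.IH(2)[OF 1(2)] obtain V' where V': "dW R Sig \<Gamma> v W' V' (\<sigma> \<rightarrow> \<sigma>')" "veq is_val Sig \<Gamma> (\<sigma> \<rightarrow> \<sigma>') V V'"
      by blast
    have "keq Sig \<Gamma> \<sigma> \<rho> (Vs @ [V]) (Vs @ [V'])"
      by (rule keq_snoc[OF V'(2) tVs]) (use tV decode_typing(1)[OF V'(1)] in auto)
    with dW_dK_dA_dT.KApp[OF V'(1) KApp.IH(3)] 1 show ?thesis by blast
  next
    case (2 K2)
    from KApp.IH(4)[OF 2(2)] obtain Vs' where Vs': "dK R Sig \<Gamma> v \<kappa> \<rho> K2 Vs' \<sigma>'" "keq Sig \<Gamma> \<sigma>' \<rho> Vs Vs'" by blast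
    have "keq Sig \<Gamma> \<sigma> \<rho> (Vs @ [V]) (Vs' @ [V])"
      by (rule keq_append[OF Vs'(2)]) (use tV in auto)
    with dW_dK_dA_dT.KApp[OF KApp.IH(1) Vs'(1)] 2 show ?thesis by blast
  next
    case (3 \<alpha> K1)
    from KApp.IH(1)[unfolded 3(1)] obtain Vs1 where Vs1: "V = Lam \<sigma> (fills (map lift Vs1) (Var 0))"
      "dK R Sig \<Gamma> (hide v) 0 \<sigma>' K1 Vs1 \<sigma>" by (auto elim!: dW_LamE)
    from decode_ksub(2)[OF Vs1(2) dsub_cont[of _ _ K], of \<kappa> \<rho> Vs] KApp.IH(3) obtain Vs'
      where Vs': "dK R Sig \<Gamma> v \<kappa> \<rho> (sub0 K K1) Vs' \<sigma>" "keq Sig \<Gamma> \<sigma> \<rho> Vs' (Vs @ Vs1)"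
      unfolding sub0_def by auto
    \<comment> \<open>\<open>V\<close> is the function that applies \<open>Vs1\<close> to its
      argument; pushing it amounts to pushing \<open>Vs1\<close>, which is what substituting
      \<open>K\<close> into \<open>K1\<close> does.\<close>
    have "keq Sig \<Gamma> \<sigma> \<sigma>' [V] Vs1" unfolding Vs1(1)
      by (rule keq_single) (use tV Vs1 decode_typing(2)[OF Vs1(2)] in auto)
    from keq_trans[OF keq_prepend[OF this tVs] keq_sym[OF Vs'(2)]] Vs'(1) 3 show ?thesis by blast
  qed
next
  case (AVal \<Gamma> v \<kappa> \<rho> K Vs \<sigma> W V)
  note tV = decode_typing(1)[OF AVal.IH(3)] and tVs = decode_typing(2)[OF AVal.IH(1)]
  from AVal.prems show ?case
  proof (cases rule: cbn_red_App_cases)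
    case (1 K')
    from AVal.IH(2)[OF 1(2)] obtain Vs' where Vs': "dK R Sig \<Gamma> v \<kappa> \<rho> K' Vs' \<sigma>" "keq Sig \<Gamma> \<sigma> \<rho> Vs Vs'" by blast
    with dW_dK_dA_dT.AVal[OF Vs'(1) AVal.IH(3)] keq_fills[OF Vs'(2), of V] tV 1 show ?thesis by blast
  next
    case (2 W')
    from AVal.IH(4)[OF 2(2)] obtain V' where V': "dW R Sig \<Gamma> v W' V' \<sigma>" "veq is_val Sig \<Gamma> \<sigma> V V'" by blast
    with dW_dK_dA_dT.AVal[OF AVal.IH(1) V'(1)] eqv_fills[OF tVs V'(2)] 2 show ?thesis by blast
  next
    case (3 \<alpha> A)
    from AVal.IH(1)[unfolded 3(1)] obtain M where M: "Vs = [Lam \<sigma> M]" "dA R Sig (\<sigma> # \<Gamma>) (bind v) (Suc \<kappa>) \<rho> A M"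
      by (auto elim!: dK_LamE)
    have "eqv Sig \<Gamma> \<rho> (fills Vs V) (sub0 V M)"
      using eqv_beta_v[of V Sig \<sigma> \<Gamma> M \<rho>] tV decode_typing(3)[OF M(2)] M(1) by simp
    with dA_sub0[OF M(2) AVal.IH(3)] 3 show ?thesis by blast
  qed
next
  case (ATerm \<Gamma> v T M \<sigma> \<kappa> \<rho> K Vs)
  note tM = decode_typing(4)[OF ATerm.IH(1)] and tVs = decode_typing(2)[OF ATerm.IH(3)]
  from ATerm.prems show ?case
  proof (cases rule: cbn_red_App_cases)
    case (1 T')
    from ATerm.IH(2)[OF 1(2)] obtain M' where M': "dT R Sig \<Gamma> v T' M' \<sigma>" "eqv Sig \<Gamma> \<sigma> M M'" by blast
    with dW_dK_dA_dT.ATerm[OF M'(1) ATerm.IH(3)] eqv_fills[OF tVs M'(2)] 1 show ?thesis by blast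
  next
    case (2 K')
    from ATerm.IH(4)[OF 2(2)] obtain Vs' where Vs': "dK R Sig \<Gamma> v \<kappa> \<rho> K' Vs' \<sigma>" "keq Sig \<Gamma> \<sigma> \<rho> Vs Vs'" by blast
    with dW_dK_dA_dT.ATerm[OF ATerm.IH(1) Vs'(1)] keq_fills[OF Vs'(2) tM] 2 show ?thesis by blast
  next
    case (3 \<alpha> A)
    \<comment> \<open>An administrative step: running a term with \<open>K\<close> substitutes
      \<open>K\<close> for its continuation, which puts the stack of \<open>K\<close> around the
      decoding.\<close>
    from ATerm.IH(1)[unfolded 3(1)] have A: "dA R Sig \<Gamma> (hide v) 0 \<sigma> A M" by (auto elim!: dT_E)
    from decode_ksub(3)[OF A dsub_cont[of _ _ K], of \<kappa> \<rho> Vs] ATerm.IH(3) obtain M'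
      where "dA R Sig \<Gamma> v \<kappa> \<rho> (sub0 K A) M'" "eqv Sig \<Gamma> \<rho> M' (fills Vs M)"
      unfolding sub0_def by auto
    with 3 veq_sym show ?thesis by blast
  qed
next
  case (TLam \<Gamma> v \<tau> A M)
  from TLam.prems show ?case
  proof (cases rule: cbn_red_Lam_cases)
    case (1 A')
    from TLam.IH(2)[OF 1(2)] obtain M' where M': "dA R Sig \<Gamma> (hide v) 0 \<tau> A' M'" "eqv Sig \<Gamma> \<tau> M M'"
      by blast
    from dW_dK_dA_dT.TLam[OF M'(1)] M'(2) show ?thesis unfolding 1(1) by (intro exI conjI)
  next
    case 2
    \<comment> \<open>\<open>Var 0\<close> is hidden as a value, so it can only be the live
      continuation; its stack is empty, and the decoding does not change.\<close>
    from TLam.IH(1)[unfolded 2] have "dT R Sig \<Gamma> (hide v) (lift T') M \<tau>"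
      by (auto elim!: dA_AppE dK_VarE elim: dW_VarE)
    from dT_lift_hide_inv[OF this] veq_refl[of "\<lambda>_. True" Sig \<Gamma> \<tau> M] show ?thesis by blast
  qed
qed simp_all

lemma decode_steps:
  assumes "cbn_red\<^sup>*\<^sup>* T T'" "dT R Sig \<Gamma> v T M \<tau>"
  shows "\<exists>M'. dT R Sig \<Gamma> v T' M' \<tau> \<and> eqv Sig \<Gamma> \<tau> M M'"
  using assms(1)
proof (induction rule: rtranclp_induct)
  case base
  show ?case using assms(2) veq_refl by blast
next
  case (step T' T'')
  then obtain M' where "dT R Sig \<Gamma> v T' M' \<tau>" "eqv Sig \<Gamma> \<tau> M M'" by blast
  with decode_step(4)[OF this(1) step(2)] veq_trans show ?case by blast
qed


section \<open>Decoding the CPS transform of a term\<close>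

text \<open>
  A version of \<open>cps_seq\<close> for boxes in which the values \<open>Ws\<close> of the arguments computed so far are
  explicit, so that it commutes with substitution and can be entered at any argument.
\<close>

primrec box_seq :: "'p ty list \<Rightarrow> ('p, 'c) tm \<Rightarrow> ('p, 'c) args \<Rightarrow> (nat \<Rightarrow> ('p, 'c) tm) \<Rightarrow>
    ('p, 'c) tm list \<Rightarrow> ('p, 'c) tm \<Rightarrow> ('p, 'c) tm" where
  "box_seq ts B [] \<theta> Ws K = App K (Box ts Ws B)"
| "box_seq ts B (p # ps) \<theta> Ws K = App (sub \<theta> (snd p))
     (Lam (fst p) (box_seq ts B ps (lift \<circ> \<theta>) (map lift Ws @ [Var 0]) (lift K)))"

text \<open>In \<open>cps_seq\<close> the final box is fixed in advance, with indices counted from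
  the innermost scope. The shift by \<open>length ps\<close> is the number of binders still to be
  crossed.\<close>

lemma cps_seq_box_seq:
  "cps_seq d ps (App (Var (\<kappa> + length ps)) (Box ts (map (ren (\<lambda>i. i + length ps)) Ws @ map Var (rev [0..<length ps])) B))
   = box_seq ts B ps (\<lambda>i. Var (i + d)) Ws (Var \<kappa>)"
proof (induction ps arbitrary: d Ws \<kappa>)
  case (Cons p ps)
  have "ren (\<lambda>i. i + d) (snd p) = sub (\<lambda>i. Var (i + d)) (snd p)"
    by (simp add: ren_as_sub comp_def)
  with Cons[of "Suc d" "Suc \<kappa>" "map lift Ws @ [Var 0]"] show ?case
    by (simp add: ren_ren comp_def)
qed (simp add: map_idI)

lemma sub_box_seq: "sub s (box_seq ts B ps \<theta> Ws K) = box_seq ts B ps (sub s \<circ> \<theta>) (map (sub s) Ws) (sub s K)"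
proof (induction ps arbitrary: s \<theta> Ws K)
  case (Cons p ps)
  have "sub (up_sub s) \<circ> (lift \<circ> \<theta>) = lift \<circ> (sub s \<circ> \<theta>)" by (auto simp: sub_up_lift)
  with Cons show ?case by (simp add: sub_up_lift sub_sub comp_def)
qed simp

lemma cps_Box_eq:
  assumes "length ts = length Ms"
  shows "cps R Sig \<Gamma> (Box ts Ms V) = Lam (cont_ty R (Nec (ty_of Sig ts V)))
    (box_seq (map (cps_ty R) ts) (cps_val R Sig ts V)
      (zip (map (\<lambda>\<sigma>. cps_ty R (Nec \<sigma>)) ts) (map (cps R Sig \<Gamma>) Ms)) (\<lambda>i. Var (Suc i)) [] (Var 0))"
  using cps_seq_box_seq[of 1 "zip (map (\<lambda>\<sigma>. cps_ty R (Nec \<sigma>)) ts) (map (cps R Sig \<Gamma>) Ms)" 0 "map (cps_ty R) ts" "[]"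
      "cps_val R Sig ts V"] assms
  by (simp add: Let_def)

text \<open>The argument of \<open>eqv_let_fills\<close>, with a box context in place of
  \<open>V [ ]\<close>; the arguments on the left are values, so lifting applies.\<close>

lemma eqv_box_let:
  assumes "list_all2 (\<lambda>N \<sigma>. cbv_typing Sig \<Gamma> N (Nec \<sigma>)) Vs ts" "\<forall>V \<in> set Vs. is_val V"
    "cbv_typing Sig \<Gamma> N (Nec \<sigma>)" "list_all2 (\<lambda>N \<sigma>. cbv_typing Sig \<Gamma> N (Nec \<sigma>)) Ns ss"
    "cbv_typing Sig (ts @ \<sigma> # ss) V \<tau>" "is_val V"
  shows "eqv Sig \<Gamma> (Nec \<tau>)
    (App (Lam (Nec \<sigma>) (Box (ts @ \<sigma> # ss) (map lift Vs @ Var 0 # map lift Ns) V)) N)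
    (Box (ts @ \<sigma> # ss) (Vs @ N # Ns) V)"
proof -
  let ?N = "App (Lam (Nec \<sigma>) (Var 0)) N"
  let ?C = "CBox (ts @ \<sigma> # ss) Vs Ns V"
  have lift: "list_all2 (\<lambda>N \<sigma>. cbv_typing Sig (\<alpha> # \<Gamma>) N (Nec \<sigma>)) (map lift Ms) us"
    if "list_all2 (\<lambda>N \<sigma>. cbv_typing Sig \<Gamma> N (Nec \<sigma>)) Ms us" for \<alpha> Ms us
    using that by (simp add: list_all2_map1)
  have "eqv Sig \<Gamma> (Nec \<tau>) (plug ?C ?N) (App (Lam (Nec \<sigma>) (plug (lift_sctx ?C) (Var 0))) N)"
    by (rule veq_step[OF cbv_root.lift]) (use assms in \<open>auto intro!: list_all2_appendI lift\<close>)
  moreover have "eqv Sig \<Gamma> (Nec \<tau>) (plug ?C ?N) (Box (ts @ \<sigma> # ss) (Vs @ N # Ns) V)"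
    using veq_boxArg[OF eqv_ident[OF assms(3)] assms(1,4,5,6)] by simp
  ultimately have "eqv Sig \<Gamma> (Nec \<tau>) (App (Lam (Nec \<sigma>) (plug (lift_sctx ?C) (Var 0))) N) (Box (ts @ \<sigma> # ss) (Vs @ N # Ns) V)"
    using veq_sym veq_trans by blast
  then show ?thesis by simp
qed

text \<open>The decoding is a nest of redexes, one for each argument in \<open>us\<close>. The
  induction hypothesis removes the inner ones, and \<open>eqv_box_let\<close> then removes the
  outermost. The list \<open>ws\<close> holds the arguments already passed.\<close>

lemma decode_box_seq:
  fixes Sig :: "'c \<Rightarrow> 'p ty"
  assumes "list_all2 (\<lambda>p u. fst p = cps_ty R (Nec (snd u)) \<and> dT R Sig \<Gamma>\<^sub>0 v\<^sub>0 (snd p) (fst u) (Nec (snd u))) ps us"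
    and "dsub R Sig \<theta> s \<Gamma>\<^sub>0 v\<^sub>0 \<Gamma> v"
    and "list_all2 (\<lambda>W u. dW R Sig \<Gamma> v W (fst u) (Nec (snd u))) Ws ws"
    and "dW R Sig (map snd (ws @ us)) Some B V \<tau>"
  shows "\<exists>M. dA R Sig \<Gamma> v \<kappa> (Nec \<tau>) (box_seq (map (cps_ty R) (map snd (ws @ us))) B ps \<theta> Ws (Var \<kappa>)) M \<and>
    eqv Sig \<Gamma> (Nec \<tau>) M (Box (map snd (ws @ us)) (map fst ws @ map (sub s) (map fst us)) V)"
  using assms
proof (induction arbitrary: \<theta> s \<Gamma> v Ws ws \<kappa> rule: list_all2_induct)
  case Nil
  have "dW R Sig (map snd ws) Some B V \<tau>" using Nil(3) by simp
  from dW_dK_dA_dT.AVal[OF dW_dK_dA_dT.KVar dW_dK_dA_dT.Box[OF Nil(2) this], of \<kappa>]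
  show ?case by (intro exI[of _ "Box (map snd ws) (map fst ws) V"]) simp
next
  case (Cons p ps u us)
  let ?\<sigma> = "Nec (snd u)" and ?N = "sub s (fst u)"
  have T: "dT R Sig \<Gamma> v (sub \<theta> (snd p)) ?N ?\<sigma>"
    using decode_sub(4)[OF _ Cons.prems(1)] Cons.hyps(1) by blast
  \<comment> \<open>The argument now being evaluated enters the box as the variable just bound; the
    earlier ones are lifted past it.\<close>
  let ?ws = "map (map_prod lift id) ws @ [(Var 0, snd u)]"
  have ds: "dsub R Sig (lift \<circ> \<theta>) (lift \<circ> s) \<Gamma>\<^sub>0 v\<^sub>0 (?\<sigma> # \<Gamma>) (bind v)"
    using Cons.prems(1) by (auto simp: dsub_def intro: dW_lift_bind)
  have v0: "dW R Sig (?\<sigma> # \<Gamma>) (bind v) (Var 0) (Var 0) ?\<sigma>"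
    using dW_dK_dA_dT.Var[of "bind v" 0 0 "?\<sigma> # \<Gamma>" R Sig] by simp
  have Ws: "list_all2 (\<lambda>W u. dW R Sig (?\<sigma> # \<Gamma>) (bind v) W (fst u) (Nec (snd u))) (map lift Ws @ [Var 0]) ?ws"
    using Cons.prems(2) v0
    by (auto simp: list_all2_map1 list_all2_map2 intro!: list_all2_appendI dW_lift_bind elim!: list_all2_mono)
  have snd: "map snd (?ws @ us) = map snd (ws @ u # us)" by simp
  have "dW R Sig (map snd (?ws @ us)) Some B V \<tau>" unfolding snd by (rule Cons.prems(3))
  from Cons.IH[OF ds Ws this, of "Suc \<kappa>"] obtain M
    where M: "dA R Sig (?\<sigma> # \<Gamma>) (bind v) (Suc \<kappa>) (Nec \<tau>)
        (box_seq (map (cps_ty R) (map snd (?ws @ us))) B ps (lift \<circ> \<theta>) (map lift Ws @ [Var 0]) (Var (Suc \<kappa>))) M"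
      "eqv Sig (?\<sigma> # \<Gamma>) (Nec \<tau>) M (Box (map snd (?ws @ us)) (map fst ?ws @ map (sub (lift \<circ> s)) (map fst us)) V)"
    by blast
  have fst: "map fst ?ws @ map (sub (lift \<circ> s)) (map fst us)
      = map lift (map fst ws) @ Var 0 # map lift (map (sub s) (map fst us))"
    by (simp add: ren_sub)
  have K: "dK R Sig \<Gamma> v \<kappa> (Nec \<tau>) (Lam (fst p) (box_seq (map (cps_ty R) (map snd (ws @ u # us))) B ps (lift \<circ> \<theta>) (map lift Ws @ [Var 0]) (Var (Suc \<kappa>))))
      [Lam ?\<sigma> M] ?\<sigma>"
    using dW_dK_dA_dT.KLam[OF M(1)] Cons.hyps(1) unfolding snd by simp
  from dW_dK_dA_dT.ATerm[OF T K]
  have d: "dA R Sig \<Gamma> v \<kappa> (Nec \<tau>) (box_seq (map (cps_ty R) (map snd (ws @ u # us))) B (p # ps) \<theta> Ws (Var \<kappa>)) (App (Lam ?\<sigma> M) ?N)"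
    by simp
  have "list_all2 (\<lambda>W u. cbv_typing Sig \<Gamma> (fst u) (Nec (snd u)) \<and> is_val (fst u)) Ws ws"
    using Cons.prems(2) by (rule list_all2_mono) (rule decode_typing(1))
  then have tws: "list_all2 (\<lambda>N \<sigma>. cbv_typing Sig \<Gamma> N (Nec \<sigma>)) (map fst ws) (map snd ws)" "\<forall>V \<in> set (map fst ws). is_val V"
    by (induction rule: list_all2_induct) auto
  have "list_all2 (\<lambda>p u. cbv_typing Sig \<Gamma> (sub s (fst u)) (Nec (snd u))) ps us"
    using Cons.hyps(2)
    by (rule list_all2_mono) (elim conjE, rule decode_typing(4)[OF decode_sub(4)[OF _ Cons.prems(1)]])
  then have tus: "list_all2 (\<lambda>N \<sigma>. cbv_typing Sig \<Gamma> N (Nec \<sigma>)) (map (sub s) (map fst us)) (map snd us)"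
    by (induction rule: list_all2_induct) auto
  have "eqv Sig \<Gamma> (Nec \<tau>) (App (Lam ?\<sigma> M) ?N)
      (App (Lam ?\<sigma> (Box (map snd ws @ snd u # map snd us) (map lift (map fst ws) @ Var 0 # map lift (map (sub s) (map fst us))) V)) ?N)"
    using M(2) decode_typing(4)[OF T] unfolding fst snd by (auto intro!: veq_appL veq_Lam)
  also have "eqv Sig \<Gamma> (Nec \<tau>) \<dots> (Box (map snd ws @ snd u # map snd us) (map fst ws @ ?N # map (sub s) (map fst us)) V)"
    by (rule eqv_box_let[OF tws decode_typing(4)[OF T] tus])
      (use decode_typing(1)[OF Cons.prems(3)] in auto)
  finally show ?case using d by auto
qed

text \<open>Arguments are exchanged one by one from the left, with \<open>ps\<close> those already
  exchanged. An entry of \<open>us\<close> packs the old argument, the new one and the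
  annotation.\<close>

lemma veq_boxArgs:
  assumes "\<And>Ns. (\<forall>N \<in> set Ns. Q N) \<Longrightarrow> Q (Box ts Ns V)"
    and "cbv_typing Sig ts V \<tau>" "is_val V" "ts = map snd ps @ map snd us"
    and "\<forall>p \<in> set ps. cbv_typing Sig \<Gamma> (fst p) (Nec (snd p)) \<and> Q (fst p)"
    and "\<forall>u \<in> set us. veq Q Sig \<Gamma> (Nec (snd u)) (fst (fst u)) (snd (fst u)) \<and>
      cbv_typing Sig \<Gamma> (fst (fst u)) (Nec (snd u)) \<and> cbv_typing Sig \<Gamma> (snd (fst u)) (Nec (snd u)) \<and>
      Q (fst (fst u)) \<and> Q (snd (fst u))"
  shows "veq Q Sig \<Gamma> (Nec \<tau>) (Box ts (map fst ps @ map (\<lambda>u. fst (fst u)) us) V)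
    (Box ts (map fst ps @ map (\<lambda>u. snd (fst u)) us) V)"
  using assms(4-)
proof (induction us arbitrary: ps)
  case (Cons u us)
  have "veq Q Sig \<Gamma> (Nec \<tau>) (Box (map snd ps @ snd u # map snd us) (map fst ps @ fst (fst u) # map (\<lambda>u. fst (fst u)) us) V)
     (Box (map snd ps @ snd u # map snd us) (map fst ps @ snd (fst u) # map (\<lambda>u. fst (fst u)) us) V)"
  proof (rule veq_boxArg)
    show "veq Q Sig \<Gamma> (Nec (snd u)) (fst (fst u)) (snd (fst u))" using Cons.prems by auto
    show "cbv_typing Sig (map snd ps @ snd u # map snd us) V \<tau>" using Cons.prems assms(2) by simp
    show "Q (Box (map snd ps @ snd u # map snd us) (map fst ps @ N # map (\<lambda>u. fst (fst u)) us) V)" if "Q N" for N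
      using that assms(1)[of "map fst ps @ N # map (\<lambda>u. fst (fst u)) us"] Cons.prems by auto
  qed (use Cons.prems assms(3) in \<open>auto simp: list_all2_map1 list_all2_map2 list_all2_same\<close>)
  also have "veq Q Sig \<Gamma> (Nec \<tau>) (Box (map snd ps @ snd u # map snd us) (map fst ps @ snd (fst u) # map (\<lambda>u. fst (fst u)) us) V)
     (Box (map snd ps @ snd u # map snd us) (map fst ps @ snd (fst u) # map (\<lambda>u. snd (fst u)) us) V)"
    using Cons.IH[of "ps @ [(snd (fst u), snd u)]"] Cons.prems by simp
  finally show ?case using Cons.prems(1) by simp
qed simp

lemma veq_boxArgs_nth:
  assumes "\<And>Ns. (\<forall>N \<in> set Ns. Q N) \<Longrightarrow> Q (Box ts Ns V)"
    and "cbv_typing Sig ts V \<tau>" "is_val V" "length Ns = length ts" "length Ns' = length ts"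
    and "\<And>i. i < length ts \<Longrightarrow> veq Q Sig \<Gamma> (Nec (ts ! i)) (Ns ! i) (Ns' ! i) \<and>
      cbv_typing Sig \<Gamma> (Ns ! i) (Nec (ts ! i)) \<and> cbv_typing Sig \<Gamma> (Ns' ! i) (Nec (ts ! i)) \<and> Q (Ns ! i) \<and> Q (Ns' ! i)"
  shows "veq Q Sig \<Gamma> (Nec \<tau>) (Box ts Ns V) (Box ts Ns' V)"
proof -
  let ?us = "zip (zip Ns Ns') ts"
  have "map snd ?us = ts" "map (\<lambda>u. fst (fst u)) ?us = Ns" "map (\<lambda>u. snd (fst u)) ?us = Ns'"
    using assms(4,5) by (auto intro!: nth_equalityI)
  moreover have "\<forall>u \<in> set ?us. veq Q Sig \<Gamma> (Nec (snd u)) (fst (fst u)) (snd (fst u)) \<and>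
      cbv_typing Sig \<Gamma> (fst (fst u)) (Nec (snd u)) \<and> cbv_typing Sig \<Gamma> (snd (fst u)) (Nec (snd u)) \<and>
      Q (fst (fst u)) \<and> Q (snd (fst u))"
  proof
    fix u assume "u \<in> set ?us"
    then obtain i where "i < length ts" "u = ((Ns ! i, Ns' ! i), ts ! i)"
      using assms(4,5) by (auto simp: set_zip)
    with assms(6) show "veq Q Sig \<Gamma> (Nec (snd u)) (fst (fst u)) (snd (fst u)) \<and>
      cbv_typing Sig \<Gamma> (fst (fst u)) (Nec (snd u)) \<and> cbv_typing Sig \<Gamma> (snd (fst u)) (Nec (snd u)) \<and>
      Q (fst (fst u)) \<and> Q (snd (fst u))" by simp
  qed
  ultimately show ?thesis
    using veq_boxArgs[of Q ts V Sig \<tau> "[]" ?us \<Gamma>, OF assms(1-3)] by simp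
qed

lemma list_all2_ex_list:
  "list_all2 (\<lambda>x y. \<exists>z. P x y z) xs ys \<Longrightarrow> \<exists>zs. length zs = length xs \<and> (\<forall>i < length xs. P (xs ! i) (ys ! i) (zs ! i))"
  unfolding list_all2_conv_all_nth by (intro exI[of _ "map (\<lambda>i. SOME z. P (xs ! i) (ys ! i) z) [0..<length xs]"])
    (auto intro: someI_ex)

text \<open>Decoding a transform yields extra redexes: one in every abstraction, one for the
  function part of every application, one for every box argument. All of them disappear by source
  equations. The value half is needed for box bodies, and for box arguments when the box itself is a
  value.\<close>

lemma decode_cps:
  fixes Sig :: "'c \<Rightarrow> 'p ty"
  shows "typing Sig \<Gamma> M \<tau> \<Longrightarrow> restricted M \<Longrightarrow>
   (\<exists>M'. dT R Sig \<Gamma> Some (cps R Sig \<Gamma> M) M' \<tau> \<and> eqv Sig \<Gamma> \<tau> M' M) \<and>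
   (is_val M \<longrightarrow> (\<exists>V'. dW R Sig \<Gamma> Some (cps_val R Sig \<Gamma> M) V' \<tau> \<and> veq is_val Sig \<Gamma> \<tau> V' M))"
proof (induction rule: typing.induct)
  case (Con \<Gamma> c)
  have "dW R Sig \<Gamma> v (Con c) (Con c) (Sig c)" for v by (rule dW_dK_dA_dT.Con)
  from this[of Some] dW_dK_dA_dT.TLam[OF dW_dK_dA_dT.AVal[OF dW_dK_dA_dT.KVar this]] show ?case
    by (auto intro: veq_refl)
next
  case (Var i \<Gamma>)
  have W: "dW R Sig \<Gamma> Some (Var i) (Var i) (\<Gamma> ! i)" using Var by (intro dW_dK_dA_dT.Var) auto
  from W dW_dK_dA_dT.TLam[OF dW_dK_dA_dT.AVal[OF dW_dK_dA_dT.KVar dW_lift_hide[OF W]]] show ?case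
    by (auto intro: veq_refl)
next
  case (Lam \<sigma> \<Gamma> M \<tau>)
  have ty: "ty_of Sig (\<sigma> # \<Gamma>) M = \<tau>" by (rule ty_of_typing) fact
  from Lam obtain M' where M': "dT R Sig (\<sigma> # \<Gamma>) Some (cps R Sig (\<sigma> # \<Gamma>) M) M' \<tau>" "eqv Sig (\<sigma> # \<Gamma>) \<tau> M' M" by auto
  let ?L = "Lam \<sigma> (fills (map lift [Lam \<sigma> M']) (Var 0))"
  \<comment> \<open>Between \<open>x\<close> at index \<open>0\<close> and the rest of the context
    the target has the continuation at index \<open>1\<close>, which the source does not see; hence
    the identity on the source side.\<close>
  have "dren (up_ren Suc) (\<lambda>i. i) (\<sigma> # \<Gamma>) Some (\<sigma> # \<Gamma>) (bind (hide Some))"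
    unfolding dren_def
  proof (intro allI impI)
    fix i j assume "Some i = Some j" "j < length (\<sigma> # \<Gamma>)"
    then show "bind (hide Some) (up_ren Suc i) = Some j \<and> j < length (\<sigma> # \<Gamma>) \<and> (\<sigma> # \<Gamma>) ! j = (\<sigma> # \<Gamma>) ! j"
      by (cases i) auto
  qed
  from decode_ren(4)[OF M'(1) this]
  have T: "dT R Sig (\<sigma> # \<Gamma>) (bind (hide Some)) (ren (up_ren Suc) (cps R Sig (\<sigma> # \<Gamma>) M)) M' \<tau>" by simp
  have "dA R Sig (\<sigma> # \<Gamma>) (bind (hide Some)) (Suc 0) \<tau> (App (ren (up_ren Suc) (cps R Sig (\<sigma> # \<Gamma>) M)) (Var 1)) M'"
    using dW_dK_dA_dT.ATerm[OF T dW_dK_dA_dT.KVar[of R Sig _ _ "Suc 0"]] by simp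
  from dW_dK_dA_dT.Lam[OF dW_dK_dA_dT.KLam[OF this]]
  have W: "dW R Sig \<Gamma> Some (cps_val R Sig \<Gamma> (Lam \<sigma> M)) ?L (\<sigma> \<rightarrow> \<tau>)" by (simp add: ty)
  have "eqv Sig (\<sigma> # \<Gamma>) \<tau> (fills (map lift [Lam \<sigma> M']) (Var 0)) M"
    using veq_trans[OF eqv_beta_Var[OF decode_typing(4)[OF M'(1)]] M'(2)] by simp
  then have e: "veq is_val Sig \<Gamma> (\<sigma> \<rightarrow> \<tau>) ?L (Lam \<sigma> M)" by (rule veq_Lam)
  have "dT R Sig \<Gamma> Some (cps R Sig \<Gamma> (Lam \<sigma> M)) (fills [] ?L) (\<sigma> \<rightarrow> \<tau>)"
    using dW_dK_dA_dT.TLam[OF dW_dK_dA_dT.AVal[OF dW_dK_dA_dT.KVar dW_lift_hide[OF W]]] by (simp add: ty)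
  with W e veq_weaken[OF e] show ?case unfolding fills_simps(1) by blast
next
  case (App \<Gamma> M \<sigma> \<tau> N)
  have ty: "ty_of Sig \<Gamma> M = \<sigma> \<rightarrow> \<tau>" by (rule ty_of_typing) fact
  from App obtain M' N' where M': "dT R Sig \<Gamma> Some (cps R Sig \<Gamma> M) M' (\<sigma> \<rightarrow> \<tau>)" "eqv Sig \<Gamma> (\<sigma> \<rightarrow> \<tau>) M' M"
    and N': "dT R Sig \<Gamma> Some (cps R Sig \<Gamma> N) N' \<sigma>" "eqv Sig \<Gamma> \<sigma> N' N" by auto
  note tM' = decode_typing(4)[OF M'(1)] and tN' = decode_typing(4)[OF N'(1)]
  let ?\<alpha> = "\<sigma> \<rightarrow> \<tau>"
  have v0: "dW R Sig (?\<alpha> # \<Gamma>) (bind (hide Some)) (Var 0) (Var 0) ?\<alpha>"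
    using dW_dK_dA_dT.Var[of "bind (hide Some)" 0 0 "?\<alpha> # \<Gamma>" R Sig] by simp
  have K0: "dK R Sig (?\<alpha> # \<Gamma>) (bind (hide Some)) (Suc 0) \<tau> (App (Var 0) (Var 1)) [Var 0] \<sigma>"
    using dW_dK_dA_dT.KApp[OF v0 dW_dK_dA_dT.KVar[of R Sig _ _ "Suc 0"]] by simp
  let ?B = "App (Var 0) (lift N')"
  have "dA R Sig (?\<alpha> # \<Gamma>) (bind (hide Some)) (Suc 0) \<tau> (App (lift (lift (cps R Sig \<Gamma> N))) (App (Var 0) (Var 1))) ?B"
    using dW_dK_dA_dT.ATerm[OF dT_lift_bind[OF dT_lift_hide[OF N'(1)]] K0] by simp
  from dW_dK_dA_dT.TLam[OF dW_dK_dA_dT.ATerm[OF dT_lift_hide[OF M'(1)] dW_dK_dA_dT.KLam[OF this]]]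
  have d: "dT R Sig \<Gamma> Some (cps R Sig \<Gamma> (App M N)) (App (Lam ?\<alpha> ?B) M') \<tau>"
    by (simp add: ty)
  \<comment> \<open>The decoding binds the function part to a variable and applies it to
    \<open>N'\<close>. Lifting an identity redex out of the context \<open>[ ] N'\<close> shows it
    equal to \<open>App M' N'\<close>.\<close>
  have "eqv Sig \<Gamma> \<tau> (plug (CFun N') (App (Lam ?\<alpha> (Var 0)) M')) (App (Lam ?\<alpha> (plug (lift_sctx (CFun N')) (Var 0))) M')"
    by (rule veq_step[OF cbv_root.lift]) (use tM' tN' in auto)
  moreover have "eqv Sig \<Gamma> \<tau> (plug (CFun N') (App (Lam ?\<alpha> (Var 0)) M')) (App M' N')"
    unfolding plug.simps using eqv_ident[OF tM'] tN' by (rule veq_appL)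
  moreover have "eqv Sig \<Gamma> \<tau> (App M' N') (App M N)"
    using veq_trans[OF veq_appR[OF N'(2) tM'] veq_appL[OF M'(2), of N]] App by (simp add: cbv_typing_def)
  ultimately have "eqv Sig \<Gamma> \<tau> (App (Lam ?\<alpha> ?B) M') (App M N)"
    unfolding plug.simps lift_sctx.simps using veq_sym veq_trans by blast
  with d show ?case by auto
next
  case (Box \<Gamma> Ns ts B \<tau>)
  let ?n = "length ts"
  have l: "length Ns = ?n" using list_all2_lengthD[OF Box.IH(1)] .
  have B: "is_val B" "restricted B" using Box.prems by auto
  with Box.IH(2) obtain V where V: "dW R Sig ts Some (cps_val R Sig ts B) V \<tau>" "veq is_val Sig ts \<tau> V B" by blast
  note tV = decode_typing(1)[OF V(1)]
  have ty: "ty_of Sig ts B = \<tau>" by (rule ty_of_typing) fact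
  have tN: "cbv_typing Sig \<Gamma> (Ns ! i) (Nec (ts ! i))" if "i < ?n" for i
    using list_all2_nthD2[OF Box.IH(1) that] Box.prems that l by (auto simp: cbv_typing_def)
  have IH: "(\<exists>M'. dT R Sig \<Gamma> Some (cps R Sig \<Gamma> (Ns ! i)) M' (Nec (ts ! i)) \<and> eqv Sig \<Gamma> (Nec (ts ! i)) M' (Ns ! i)) \<and>
    (is_val (Ns ! i) \<longrightarrow> (\<exists>V'. dW R Sig \<Gamma> Some (cps_val R Sig \<Gamma> (Ns ! i)) V' (Nec (ts ! i)) \<and> veq is_val Sig \<Gamma> (Nec (ts ! i)) V' (Ns ! i)))"
    if "i < ?n" for i
    using list_all2_nthD2[OF Box.IH(1) that] Box.prems that l by auto
  \<comment> \<open>If the box is a value, its equation must pass through values only, to be usable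
    again inside another box.\<close>
  have body: "veq is_val Sig \<Gamma> (Nec \<tau>) (Box ts Ns V) (Box ts Ns B)" if "is_val (Box ts Ns B)"
    by (rule veq_boxBody[OF V(2)]) (use tN l that in \<open>auto simp: list_all2_conv_all_nth\<close>)
  have body': "eqv Sig \<Gamma> (Nec \<tau>) (Box ts Ns V) (Box ts Ns B)"
    by (rule veq_boxBody[OF V(2)]) (use tN l in \<open>auto simp: list_all2_conv_all_nth\<close>)
  have "list_all2 (\<lambda>N \<sigma>. \<exists>M'. dT R Sig \<Gamma> Some (cps R Sig \<Gamma> N) M' (Nec \<sigma>) \<and> eqv Sig \<Gamma> (Nec \<sigma>) M' N) Ns ts"
    using IH l by (auto simp: list_all2_conv_all_nth)
  from list_all2_ex_list[OF this] obtain Ms where Ms: "length Ms = ?n"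
    "\<And>i. i < ?n \<Longrightarrow> dT R Sig \<Gamma> Some (cps R Sig \<Gamma> (Ns ! i)) (Ms ! i) (Nec (ts ! i))"
    "\<And>i. i < ?n \<Longrightarrow> eqv Sig \<Gamma> (Nec (ts ! i)) (Ms ! i) (Ns ! i)" using l by auto
  let ?us = "zip Ms ts"
  have us: "map snd ?us = ts" "map fst ?us = Ms" using Ms(1) by simp_all
  have "list_all2 (\<lambda>p u. fst p = cps_ty R (Nec (snd u)) \<and> dT R Sig \<Gamma> Some (snd p) (fst u) (Nec (snd u)))
      (zip (map (\<lambda>\<sigma>. cps_ty R (Nec \<sigma>)) ts) (map (cps R Sig \<Gamma>) Ns)) ?us"
    using Ms l by (auto simp: list_all2_conv_all_nth)
  moreover have "dsub R Sig (\<lambda>i. Var (Suc i)) Var \<Gamma> Some \<Gamma> (hide Some)"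
    by (auto simp: dsub_def intro: dW_dK_dA_dT.Var)
  ultimately obtain M where M: "dA R Sig \<Gamma> (hide Some) 0 (Nec \<tau>)
     (box_seq (map (cps_ty R) ts) (cps_val R Sig ts B) (zip (map (\<lambda>\<sigma>. cps_ty R (Nec \<sigma>)) ts) (map (cps R Sig \<Gamma>) Ns)) (\<lambda>i. Var (Suc i)) [] (Var 0)) M"
     "eqv Sig \<Gamma> (Nec \<tau>) M (Box ts Ms V)"
    using decode_box_seq[of R Sig \<Gamma> Some _ ?us "\<lambda>i. Var (Suc i)" Var \<Gamma> "hide Some" "[]" "[]" "cps_val R Sig ts B" V \<tau> 0] V(1) us
    by (auto simp: map_idI)
  have tM: "cbv_typing Sig \<Gamma> (Ms ! i) (Nec (ts ! i))" if "i < ?n" for i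
    using decode_typing(4)[OF Ms(2)[OF that]] .
  have "eqv Sig \<Gamma> (Nec \<tau>) (Box ts Ms V) (Box ts Ns V)"
    by (rule veq_boxArgs_nth) (use tV Ms tM tN l in auto)
  with M(2) body' have e: "eqv Sig \<Gamma> (Nec \<tau>) M (Box ts Ns B)" using veq_trans by blast
  have "dT R Sig \<Gamma> Some (cps R Sig \<Gamma> (Box ts Ns B)) M (Nec \<tau>)"
    using dW_dK_dA_dT.TLam[OF M(1)] l by (simp add: cps_Box_eq ty del: cps.simps)
  moreover have "\<exists>V'. dW R Sig \<Gamma> Some (cps_val R Sig \<Gamma> (Box ts Ns B)) V' (Nec \<tau>) \<and> veq is_val Sig \<Gamma> (Nec \<tau>) V' (Box ts Ns B)"
    if val: "is_val (Box ts Ns B)"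
  proof -
    have "list_all2 (\<lambda>N \<sigma>. \<exists>V'. dW R Sig \<Gamma> Some (cps_val R Sig \<Gamma> N) V' (Nec \<sigma>) \<and> veq is_val Sig \<Gamma> (Nec \<sigma>) V' N) Ns ts"
      using IH l val by (auto simp: list_all2_conv_all_nth)
    from list_all2_ex_list[OF this] obtain Vs where Vs: "length Vs = ?n"
      "\<And>i. i < ?n \<Longrightarrow> dW R Sig \<Gamma> Some (cps_val R Sig \<Gamma> (Ns ! i)) (Vs ! i) (Nec (ts ! i))"
      "\<And>i. i < ?n \<Longrightarrow> veq is_val Sig \<Gamma> (Nec (ts ! i)) (Vs ! i) (Ns ! i)" using l by auto
    let ?us = "zip Vs ts"
    have us: "map snd ?us = ts" "map fst ?us = Vs" using Vs(1) by simp_all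
    have "list_all2 (\<lambda>W u. dW R Sig \<Gamma> Some W (fst u) (Nec (snd u))) (map (cps_val R Sig \<Gamma>) Ns) ?us"
      using Vs l by (auto simp: list_all2_conv_all_nth)
    from dW_dK_dA_dT.Box[OF this, unfolded us, OF V(1)]
    have "dW R Sig \<Gamma> Some (cps_val R Sig \<Gamma> (Box ts Ns B)) (Box ts Vs V) (Nec \<tau>)" by simp
    moreover have "veq is_val Sig \<Gamma> (Nec \<tau>) (Box ts Vs V) (Box ts Ns V)"
      by (rule veq_boxArgs_nth) (use tV Vs tN l val decode_typing(1)[OF Vs(2)] in auto)
    ultimately show ?thesis using body[OF val] veq_trans by blast
  qed
  ultimately show ?case using e by blast
qed

section \<open>Typing of the CPS transform\<close>

abbreviation cps_sig :: "'p \<Rightarrow> ('c \<Rightarrow> 'p ty) \<Rightarrow> 'c \<Rightarrow> 'p ty" where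
  "cps_sig R Sig \<equiv> cps_ty R \<circ> Sig"

abbreviation cps_ctx :: "'p \<Rightarrow> 'p ty list \<Rightarrow> 'p ty list" where
  "cps_ctx R \<Gamma> \<equiv> map (cps_ty R) \<Gamma>"

lemma typing_box_seq:
  assumes "list_all2 (\<lambda>p t. fst p = Nec t \<and> typing S \<Delta>\<^sub>0 (snd p) ((Nec t \<rightarrow> \<rho>) \<rightarrow> \<rho>)) ps us"
    and "\<And>i. i < length \<Delta>\<^sub>0 \<Longrightarrow> typing S \<Delta> (\<theta> i) (\<Delta>\<^sub>0 ! i)"
    and "list_all2 (\<lambda>W t. typing S \<Delta> W (Nec t)) Ws ws"
    and "typing S \<Delta> K (Nec \<tau> \<rightarrow> \<rho>)" "typing S (ws @ us) B \<tau>"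
  shows "typing S \<Delta> (box_seq (ws @ us) B ps \<theta> Ws K) \<rho>"
  using assms
proof (induction arbitrary: \<Delta> \<theta> Ws ws K rule: list_all2_induct)
  case Nil
  then show ?case by auto
next
  case (Cons p ps t us)
  have "typing S (Nec t # \<Delta>) (box_seq ((ws @ [t]) @ us) B ps (lift \<circ> \<theta>) (map lift Ws @ [Var 0]) (lift K)) \<rho>"
  proof (rule Cons.IH)
    show "list_all2 (\<lambda>W u. typing S (Nec t # \<Delta>) W (Nec u)) (map lift Ws @ [Var 0]) (ws @ [t])"
      using Cons.prems(2) by (auto simp: list_all2_map1 intro!: list_all2_appendI)
  qed (use Cons.prems in auto)
  moreover have "typing S \<Delta> (sub \<theta> (snd p)) ((Nec t \<rightarrow> \<rho>) \<rightarrow> \<rho>)"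
    using Cons.hyps(1) Cons.prems(1) by (auto intro: typing_sub)
  ultimately show ?case using Cons.hyps(1) by auto
qed

lemma typing_cps_cps_val:
  assumes S: "\<And>c. S c = cps_ty R (Sig c)"
  shows "typing Sig \<Gamma> M \<tau> \<Longrightarrow> restricted M \<Longrightarrow>
    typing S (cps_ctx R \<Gamma>) (cps R Sig \<Gamma> M) (cps_cty R \<tau>) \<and>
    (is_val M \<longrightarrow> typing S (cps_ctx R \<Gamma>) (cps_val R Sig \<Gamma> M) (cps_ty R \<tau>))"
proof (induction rule: typing.induct)
  case (Lam \<sigma> \<Gamma> M \<tau>)
  have ty: "ty_of Sig (\<sigma> # \<Gamma>) M = \<tau>" by (rule ty_of_typing) fact
  have "restricted M" using Lam.prems by simp
  from Lam.IH[OF this] have "typing S (cps_ctx R (\<sigma> # \<Gamma>)) (cps R Sig (\<sigma> # \<Gamma>) M) (cps_cty R \<tau>)" ..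
  then have "typing S (cps_ty R \<sigma> # cont_ty R \<tau> # cps_ctx R \<Gamma>) (ren (up_ren Suc) (cps R Sig (\<sigma> # \<Gamma>) M)) (cps_cty R \<tau>)"
  proof (rule typing_ren)
    fix i assume "i < length (cps_ctx R (\<sigma> # \<Gamma>))"
    then show "up_ren Suc i < length (cps_ty R \<sigma> # cont_ty R \<tau> # cps_ctx R \<Gamma>) \<and>
      (cps_ty R \<sigma> # cont_ty R \<tau> # cps_ctx R \<Gamma>) ! up_ren Suc i = cps_ctx R (\<sigma> # \<Gamma>) ! i" by (cases i) auto
  qed
  then have "typing S (cps_ctx R \<Gamma>) (cps_val R Sig \<Gamma> (Lam \<sigma> M)) (cps_ty R (\<sigma> \<rightarrow> \<tau>))"
    by (auto simp: ty cps_cty_def)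
  moreover from this have "typing S (cps_ctx R \<Gamma>) (cps R Sig \<Gamma> (Lam \<sigma> M)) (cps_cty R (\<sigma> \<rightarrow> \<tau>))"
    by (simp add: ty cps_cty_def del: cps_val.simps)
  ultimately show ?case by blast
next
  case (App \<Gamma> M \<sigma> \<tau> N)
  have "ty_of Sig \<Gamma> M = \<sigma> \<rightarrow> \<tau>" by (rule ty_of_typing) fact
  with App show ?case by (auto simp: cps_cty_def)
next
  case (Box \<Gamma> Ns ts B \<tau>)
  have l: "length ts = length Ns" using list_all2_lengthD[OF Box.IH(1)] by simp
  have ty: "ty_of Sig ts B = \<tau>" by (rule ty_of_typing) fact
  let ?ps = "zip (map (\<lambda>\<sigma>. cps_ty R (Nec \<sigma>)) ts) (map (cps R Sig \<Gamma>) Ns)"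
  have "typing S (cont_ty R (Nec \<tau>) # cps_ctx R \<Gamma>)
      (box_seq ([] @ cps_ctx R ts) (cps_val R Sig ts B) ?ps (\<lambda>i. Var (Suc i)) [] (Var 0)) (TConst R)"
  proof (rule typing_box_seq[where \<Delta>\<^sub>0 = "cps_ctx R \<Gamma>" and \<tau> = "cps_ty R \<tau>"])
    show "list_all2 (\<lambda>p t. fst p = Nec t \<and> typing S (cps_ctx R \<Gamma>) (snd p) ((Nec t \<rightarrow> TConst R) \<rightarrow> TConst R)) ?ps (cps_ctx R ts)"
      using Box.IH(1) Box.prems l by (auto simp: list_all2_conv_all_nth cps_cty_def)
  qed (use Box in auto)
  then have "typing S (cps_ctx R \<Gamma>) (cps R Sig \<Gamma> (Box ts Ns B)) (cps_cty R (Nec \<tau>))"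
    by (simp add: cps_Box_eq[OF l] ty cps_cty_def del: cps.simps)
  moreover have "typing S (cps_ctx R \<Gamma>) (cps_val R Sig \<Gamma> (Box ts Ns B)) (cps_ty R (Nec \<tau>))"
    if "is_val (Box ts Ns B)"
    using that Box l by (auto simp: list_all2_conv_all_nth)
  ultimately show ?case by blast
qed (auto simp: cps_cty_def S)

lemma typing_cps:
  "cbv_typing Sig \<Gamma> M \<tau> \<Longrightarrow> typing (cps_sig R Sig) (cps_ctx R \<Gamma>) (cps R Sig \<Gamma> M) (cps_cty R \<tau>)"
  using typing_cps_cps_val[of "cps_sig R Sig" R Sig \<Gamma> M \<tau>] by (simp add: cbv_typing_def)


section \<open>Soundness of the CPS transformation\<close>

abbreviation nred :: "('p, 'c) tm \<Rightarrow> ('p, 'c) tm \<Rightarrow> bool" where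
  "nred \<equiv> cbn_red\<^sup>*\<^sup>*"

lemmas nred_Lam = compat_rtranclp_Lam[of cbn_root, folded cbn_red_def]
lemmas nred_App = compat_rtranclp_App[of cbn_root, folded cbn_red_def]
lemmas nred_Box = compat_rtranclp_Box[of cbn_root, folded cbn_red_def]

lemma nred_beta: "nred (App (Lam \<sigma> M) N) (sub0 N M)"
  unfolding cbn_red_def by (intro r_into_rtranclp compat.root cbn_root.beta)

lemma nred_eta: "nred (Lam \<sigma> (App (lift M) (Var 0))) M"
  unfolding cbn_red_def by (intro r_into_rtranclp compat.root cbn_root.eta)

lemma nred_sub: "nred M N \<Longrightarrow> nred (sub s M) (sub s N)"
  unfolding cbn_red_def by (erule rtranclp_map) (erule compat_sub, erule cbn_root_sub)

lemma nred_lift: "nred M N \<Longrightarrow> nred (lift M) (lift N)"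
  unfolding ren_as_sub by (rule nred_sub)

lemma nred_box_seq:
  assumes "list_all2 (\<lambda>p q. fst p = fst q \<and> nred (snd p) (snd q)) ps qs" "nred B B'"
  shows "nred (box_seq ts B ps \<theta> Ws K) (box_seq ts B' qs \<theta> Ws K)"
  using assms(1)
proof (induction arbitrary: \<theta> Ws K rule: list_all2_induct)
  case Nil
  show ?case using assms(2)
    by (auto intro!: nred_App nred_Box list.rel_refl)
next
  case (Cons p ps q qs)
  then show ?case by (auto intro!: nred_App nred_Lam nred_sub)
qed

lemma box_seq_map: "box_seq ts B (map (map_prod id (sub s)) ps) \<theta> Ws K = box_seq ts B ps (sub \<theta> \<circ> s) Ws K"
proof (induction ps arbitrary: \<theta> Ws K)
  case (Cons p ps)
  have "(\<lambda>a. sub (\<lambda>i. lift (\<theta> i)) (s a)) = (\<lambda>a. lift (sub \<theta> (s a)))" by (simp add: ren_sub comp_def)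
  with Cons show ?case by (simp add: sub_sub comp_def)
qed simp

section \<open>The CPS transforms under renaming and substitution\<close>

definition typed_ren :: "(nat \<Rightarrow> nat) \<Rightarrow> 'p ty list \<Rightarrow> 'p ty list \<Rightarrow> bool" where
  "typed_ren f \<Gamma> \<Delta> \<longleftrightarrow> (\<forall>i < length \<Gamma>. f i < length \<Delta> \<and> \<Delta> ! f i = \<Gamma> ! i)"

lemma typed_ren_up: "typed_ren f \<Gamma> \<Delta> \<Longrightarrow> typed_ren (up_ren f) (\<sigma> # \<Gamma>) (\<sigma> # \<Delta>)"
  unfolding typed_ren_def
proof (intro allI impI)
  fix i assume "\<forall>i < length \<Gamma>. f i < length \<Delta> \<and> \<Delta> ! f i = \<Gamma> ! i" "i < length (\<sigma> # \<Gamma>)"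
  then show "up_ren f i < length (\<sigma> # \<Delta>) \<and> (\<sigma> # \<Delta>) ! up_ren f i = (\<sigma> # \<Gamma>) ! i" by (cases i) auto
qed

lemma ty_of_ren: "typing Sig \<Gamma> M \<tau> \<Longrightarrow> typed_ren f \<Gamma> \<Delta> \<Longrightarrow> ty_of Sig \<Delta> (ren f M) = \<tau>"
  by (rule ty_of_typing, erule typing_ren) (auto simp: typed_ren_def)

text \<open>Typing is assumed because the transforms compute annotations by \<open>ty_of\<close>,
  which a type-preserving renaming leaves unchanged on typed terms.\<close>

lemma cps_ren:
  "typing Sig \<Gamma> M \<tau> \<Longrightarrow> typed_ren f \<Gamma> \<Delta> \<Longrightarrow>
    cps R Sig \<Delta> (ren f M) = ren f (cps R Sig \<Gamma> M) \<and>
    (is_val M \<longrightarrow> cps_val R Sig \<Delta> (ren f M) = ren f (cps_val R Sig \<Gamma> M))"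
proof (induction arbitrary: f \<Delta> rule: typing.induct)
  case (Var i \<Gamma>)
  then show ?case by (auto simp: typed_ren_def)
next
  case (Lam \<sigma> \<Gamma> M \<tau>)
  have ty: "ty_of Sig (\<sigma> # \<Gamma>) M = \<tau>" by (rule ty_of_typing) fact
  have ty': "ty_of Sig (\<sigma> # \<Delta>) (ren (up_ren f) M) = \<tau>" using Lam.hyps typed_ren_up[OF Lam.prems] by (rule ty_of_ren)
  have up: "up_ren Suc \<circ> up_ren f = up_ren (up_ren f) \<circ> up_ren Suc"
  proof -
    have "Suc \<circ> f = up_ren f \<circ> Suc" by auto
    then show ?thesis by (simp only: up_ren_comp)
  qed
  have "ren (up_ren Suc) (ren (up_ren f) X) = ren (up_ren (up_ren f)) (ren (up_ren Suc) X)" for X :: "('b, 'a) tm"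
    by (simp only: ren_ren up)
  with Lam.IH[OF typed_ren_up[OF Lam.prems]]
  have val: "cps_val R Sig \<Delta> (ren f (Lam \<sigma> M)) = ren f (cps_val R Sig \<Gamma> (Lam \<sigma> M))"
    by (simp add: ty ty')
  have "cps R Sig \<Delta> (ren f (Lam \<sigma> M)) = Lam (cont_ty R (\<sigma> \<rightarrow> \<tau>)) (App (Var 0) (lift (cps_val R Sig \<Delta> (ren f (Lam \<sigma> M)))))"
    by (simp add: ty')
  also have "\<dots> = ren f (Lam (cont_ty R (\<sigma> \<rightarrow> \<tau>)) (App (Var 0) (lift (cps_val R Sig \<Gamma> (Lam \<sigma> M)))))"
    unfolding val by (simp add: ren_up_lift del: cps_val.simps)
  also have "\<dots> = ren f (cps R Sig \<Gamma> (Lam \<sigma> M))" by (simp add: ty)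
  finally show ?case using val by blast
next
  case (App \<Gamma> M \<sigma> \<tau> N)
  have ty: "ty_of Sig \<Gamma> M = \<sigma> \<rightarrow> \<tau>" by (rule ty_of_typing) fact
  have ty': "ty_of Sig \<Delta> (ren f M) = \<sigma> \<rightarrow> \<tau>" using App.hyps(1) App.prems by (rule ty_of_ren)
  show ?case using App.IH(1,2)[OF App.prems] by (simp add: ty ty' ren_up_lift)
next
  case (Box \<Gamma> Ns ts B \<tau>)
  have l: "length ts = length Ns" using list_all2_lengthD[OF Box.IH(1)] by simp
  have IH: "cps R Sig \<Delta> (ren f N) = ren f (cps R Sig \<Gamma> N) \<and>
    (is_val N \<longrightarrow> cps_val R Sig \<Delta> (ren f N) = ren f (cps_val R Sig \<Gamma> N))" if "N \<in> set Ns" for N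
  proof -
    from that obtain i where i: "i < length Ns" "N = Ns ! i" by (auto simp: in_set_conv_nth)
    from list_all2_nthD[OF Box.IH(1) i(1)] i(2) Box.prems show ?thesis by blast
  qed
  let ?ps = "zip (map (\<lambda>\<sigma>. cps_ty R (Nec \<sigma>)) ts) (map (cps R Sig \<Gamma>) Ns)"
  have ps: "zip (map (\<lambda>\<sigma>. cps_ty R (Nec \<sigma>)) ts) (map (cps R Sig \<Delta>) (map (ren f) Ns))
      = map (map_prod id (sub (Var \<circ> f))) ?ps"
  proof (rule nth_equalityI)
    fix i assume "i < length (zip (map (\<lambda>\<sigma>. cps_ty R (Nec \<sigma>)) ts) (map (cps R Sig \<Delta>) (map (ren f) Ns)))"
    then have "i < length ts" "i < length Ns" by simp_all
    with IH[of "Ns ! i"] show "zip (map (\<lambda>\<sigma>. cps_ty R (Nec \<sigma>)) ts) (map (cps R Sig \<Delta>) (map (ren f) Ns)) ! i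
        = map (map_prod id (sub (Var \<circ> f))) ?ps ! i"
      by (simp add: ren_as_sub[symmetric])
  qed simp
  have "box_seq (cps_ctx R ts) (cps_val R Sig ts B) (zip (map (\<lambda>\<sigma>. cps_ty R (Nec \<sigma>)) ts) (map (cps R Sig \<Delta>) (map (ren f) Ns)))
      (\<lambda>i. Var (Suc i)) [] (Var 0)
    = ren (up_ren f) (box_seq (cps_ctx R ts) (cps_val R Sig ts B) ?ps (\<lambda>i. Var (Suc i)) [] (Var 0))"
    by (simp only: ps box_seq_map ren_as_sub[of "up_ren f"] sub_box_seq) (simp add: comp_def)
  then have "cps R Sig \<Delta> (ren f (Box ts Ns B)) = ren f (cps R Sig \<Gamma> (Box ts Ns B))"
    using l by (simp add: cps_Box_eq del: cps.simps map_map cps_ty.simps)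
  with IH show ?case by auto
qed auto

lemma typed_ren_lift [simp]: "typed_ren Suc \<Gamma> (\<alpha> # \<Gamma>)"
  by (simp add: typed_ren_def)

lemma cps_lift: "cbv_typing Sig \<Gamma> M \<tau> \<Longrightarrow> cps R Sig (\<alpha> # \<Gamma>) (lift M) = lift (cps R Sig \<Gamma> M)"
  using cps_ren[of Sig \<Gamma> M \<tau> Suc "\<alpha> # \<Gamma>" R] by (auto simp: cbv_typing_def)

lemma cps_val_lift:
  "cbv_typing Sig \<Gamma> V \<tau> \<Longrightarrow> is_val V \<Longrightarrow> cps_val R Sig (\<alpha> # \<Gamma>) (lift V) = lift (cps_val R Sig \<Gamma> V)"
  using cps_ren[of Sig \<Gamma> V \<tau> Suc "\<alpha> # \<Gamma>" R] by (auto simp: cbv_typing_def)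

abbreviation box_args :: "'p \<Rightarrow> ('c \<Rightarrow> 'p ty) \<Rightarrow> 'p ty list \<Rightarrow> 'p ty list \<Rightarrow> ('p, 'c) tm list \<Rightarrow> ('p, 'c) args" where
  "box_args R Sig \<Gamma> ts Ms \<equiv> zip (map (\<lambda>\<sigma>. cps_ty R (Nec \<sigma>)) ts) (map (cps R Sig \<Gamma>) Ms)"

lemma nred_value_cont:
  assumes "nred M (Lam \<alpha> (App (Var 0) (lift W)))"
  shows "nred (App (sub \<theta> M) K) (App K (sub \<theta> W))"
proof -
  have "nred (App (sub \<theta> M) K) (App (sub \<theta> (Lam \<alpha> (App (Var 0) (lift W)))) K)"
    by (intro nred_App nred_sub assms) simp
  also have "nred \<dots> (sub0 K (App (Var 0) (lift (sub \<theta> W))))"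
    using nred_beta by (simp add: sub_up_lift)
  also have "\<dots> = App K (sub \<theta> W)" using sub0_lift[of K] by (simp add: sub0_def)
  finally show ?thesis .
qed

lemma nred_box_seq_vals:
  assumes "list_all2 (\<lambda>p W. \<exists>\<alpha>. nred (snd p) (Lam \<alpha> (App (Var 0) (lift W)))) ps Us"
  shows "nred (box_seq ts B (ps @ qs) \<theta> Ws K) (box_seq ts B qs \<theta> (Ws @ map (sub \<theta>) Us) K)"
  using assms
proof (induction arbitrary: Ws rule: list_all2_induct)
  case (Cons p ps U Us)
  then obtain \<alpha> where U: "nred (snd p) (Lam \<alpha> (App (Var 0) (lift U)))" by blast
  let ?B = "box_seq ts B (ps @ qs) (lift \<circ> \<theta>) (map lift Ws @ [Var 0]) (lift K)"
  have 1: "nred (box_seq ts B ((p # ps) @ qs) \<theta> Ws K) (App (Lam (fst p) ?B) (sub \<theta> U))"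
    using nred_value_cont[OF U] by simp
  have 2: "sub0 (sub \<theta> U) ?B = box_seq ts B (ps @ qs) \<theta> (Ws @ [sub \<theta> U]) K"
    by (simp add: sub0_def sub_box_seq sub_ren comp_def)
  have 3: "nred (box_seq ts B (ps @ qs) \<theta> (Ws @ [sub \<theta> U]) K) (box_seq ts B qs \<theta> (Ws @ map (sub \<theta>) (U # Us)) K)"
    using Cons.IH[of "Ws @ [sub \<theta> U]"] by simp
  from rtranclp_trans[OF rtranclp_trans[OF 1 nred_beta[of "fst p" ?B "sub \<theta> U", unfolded 2]] 3] show ?case .
qed simp

text \<open>For a box value the two sides are different terms: its transform first runs the
  arguments one after the other, and only administrative reduction assembles the box from their
  values.\<close>

lemma nred_cps_val:
  "typing Sig \<Gamma> V \<tau> \<Longrightarrow> is_val V \<Longrightarrow>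
    nred (cps R Sig \<Gamma> V) (Lam (cont_ty R \<tau>) (App (Var 0) (lift (cps_val R Sig \<Gamma> V))))"
proof (induction rule: typing.induct)
  case (Lam \<sigma> \<Gamma> M \<tau>)
  have "ty_of Sig (\<sigma> # \<Gamma>) M = \<tau>" by (rule ty_of_typing) fact
  then show ?case by simp
next
  case (Box \<Gamma> Ns ts B \<tau>)
  have l: "length ts = length Ns" using list_all2_lengthD[OF Box.IH(1)] by simp
  have ty: "ty_of Sig ts B = \<tau>" by (rule ty_of_typing) fact
  have "list_all2 (\<lambda>p W. \<exists>\<alpha>. nred (snd p) (Lam \<alpha> (App (Var 0) (lift W)))) (box_args R Sig \<Gamma> ts Ns) (map (cps_val R Sig \<Gamma>) Ns)"
  proof (rule list_all2_all_nthI)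
    fix i assume "i < length (box_args R Sig \<Gamma> ts Ns)"
    then have i: "i < length Ns" by simp
    with list_all2_nthD[OF Box.IH(1) i] Box.prems l
    have "nred (cps R Sig \<Gamma> (Ns ! i)) (Lam (cont_ty R (Nec (ts ! i))) (App (Var 0) (lift (cps_val R Sig \<Gamma> (Ns ! i)))))" by simp
    with i l show "\<exists>\<alpha>. nred (snd (box_args R Sig \<Gamma> ts Ns ! i)) (Lam \<alpha> (App (Var 0) (lift (map (cps_val R Sig \<Gamma>) Ns ! i))))"
      by auto
  qed (use l in simp)
  from nred_box_seq_vals[OF this, of "cps_ctx R ts" "cps_val R Sig ts B" "[]" "\<lambda>i. Var (Suc i)" "[]" "Var 0"]
  have "nred (box_seq (cps_ctx R ts) (cps_val R Sig ts B) (box_args R Sig \<Gamma> ts Ns) (\<lambda>i. Var (Suc i)) [] (Var 0))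
    (App (Var 0) (lift (cps_val R Sig \<Gamma> (Box ts Ns B))))"
    by (simp add: ren_as_sub comp_def)
  then show ?case by (simp add: cps_Box_eq[OF l] ty nred_Lam del: cps.simps cps_val.simps)
qed auto

lemma nred_cps_val_cont:
  assumes "cbv_typing Sig \<Gamma> V \<tau>" "is_val V"
  shows "nred (App (cps R Sig \<Gamma> V) K) (App K (cps_val R Sig \<Gamma> V))"
  using nred_value_cont[OF nred_cps_val[of Sig \<Gamma> V \<tau> R], of Var K] assms by (simp add: cbv_typing_def)

text \<open>A reduction rather than an equation because of the variable case: if a box value is
  substituted, the left-hand side is its full transform, while the right-hand side hands
  \<open>cps_val\<close> of it directly to the continuation.\<close>

lemma cps_sub:
  "typing Sig \<Gamma> M \<tau> \<Longrightarrow> restricted M \<Longrightarrow>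
    (\<And>i. i < length \<Gamma> \<Longrightarrow> cbv_typing Sig \<Delta> (s i) (\<Gamma> ! i) \<and> is_val (s i) \<and> t i = cps_val R Sig \<Delta> (s i)) \<Longrightarrow>
    nred (cps R Sig \<Delta> (sub s M)) (sub t (cps R Sig \<Gamma> M)) \<and>
    (is_val M \<longrightarrow> nred (cps_val R Sig \<Delta> (sub s M)) (sub t (cps_val R Sig \<Gamma> M)))"
proof (induction arbitrary: s t \<Delta> rule: typing.induct)
  case (Var i \<Gamma>)
  then have "cbv_typing Sig \<Delta> (s i) (\<Gamma> ! i)" "is_val (s i)" "t i = cps_val R Sig \<Delta> (s i)" by auto
  with nred_cps_val[of Sig \<Delta> "s i" "\<Gamma> ! i" R] show ?case by (simp add: cbv_typing_def)
next
  case (Lam \<sigma> \<Gamma> M \<tau>)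
  have up: "cbv_typing Sig (\<sigma> # \<Delta>) (up_sub s i) ((\<sigma> # \<Gamma>) ! i) \<and> is_val (up_sub s i) \<and>
      up_sub t i = cps_val R Sig (\<sigma> # \<Delta>) (up_sub s i)" if "i < length (\<sigma> # \<Gamma>)" for i
  proof (cases i)
    case (Suc j)
    then have "cbv_typing Sig \<Delta> (s j) (\<Gamma> ! j)" "is_val (s j)" "t j = cps_val R Sig \<Delta> (s j)" using Lam.prems(2) that by auto
    with Suc show ?thesis by (simp add: cps_val_lift)
  qed simp
  have ty: "ty_of Sig (\<sigma> # \<Gamma>) M = \<tau>" by (rule ty_of_typing) fact
  have "typing Sig (\<sigma> # \<Delta>) (sub (up_sub s) M) \<tau>"
    by (rule typing_sub[OF Lam.hyps]) (use up in \<open>auto simp: cbv_typing_def\<close>)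
  then have ty': "ty_of Sig (\<sigma> # \<Delta>) (sub (up_sub s) M) = \<tau>" by (rule ty_of_typing)
  have "restricted M" using Lam.prems(1) by simp
  from Lam.IH[OF this up] have IH: "nred (cps R Sig (\<sigma> # \<Delta>) (sub (up_sub s) M)) (sub (up_sub t) (cps R Sig (\<sigma> # \<Gamma>) M))"
    by blast
  have "ren (up_ren Suc) (sub (up_sub t) X) = sub (up_sub (up_sub t)) (ren (up_ren Suc) X)" for X :: "('b, 'a) tm"
  proof -
    have "lift \<circ> t = up_sub t \<circ> Suc" by auto
    then show ?thesis by (simp only: ren_sub sub_ren ren_up_sub up_sub_up_ren)
  qed
  with nred_sub[OF IH, of "Var \<circ> up_ren Suc"]
  have val: "nred (cps_val R Sig \<Delta> (sub s (Lam \<sigma> M))) (sub t (cps_val R Sig \<Gamma> (Lam \<sigma> M)))"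
    by (simp add: ty ty' ren_as_sub[symmetric] nred_Lam nred_App)
  have "cps R Sig \<Delta> (sub s (Lam \<sigma> M)) = Lam (cont_ty R (\<sigma> \<rightarrow> \<tau>)) (App (Var 0) (lift (cps_val R Sig \<Delta> (sub s (Lam \<sigma> M)))))"
    by (simp add: ty')
  moreover have "sub t (cps R Sig \<Gamma> (Lam \<sigma> M)) = Lam (cont_ty R (\<sigma> \<rightarrow> \<tau>)) (App (Var 0) (lift (sub t (cps_val R Sig \<Gamma> (Lam \<sigma> M)))))"
    by (simp add: ty sub_up_lift del: cps_val.simps)
  ultimately have "nred (cps R Sig \<Delta> (sub s (Lam \<sigma> M))) (sub t (cps R Sig \<Gamma> (Lam \<sigma> M)))"
    by (simp only:) (intro nred_Lam nred_App nred_lift val rtranclp.rtrancl_refl)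
  with val show ?case by blast
next
  case (App \<Gamma> M \<sigma> \<tau> N)
  have ty: "ty_of Sig \<Gamma> M = \<sigma> \<rightarrow> \<tau>" by (rule ty_of_typing) fact
  have "typing Sig \<Delta> (sub s M) (\<sigma> \<rightarrow> \<tau>)"
    by (rule typing_sub[OF App.hyps(1)]) (use App.prems(2) in \<open>auto simp: cbv_typing_def\<close>)
  then have ty': "ty_of Sig \<Delta> (sub s M) = \<sigma> \<rightarrow> \<tau>" by (rule ty_of_typing)
  have "restricted M" "restricted N" using App.prems by auto
  from App.IH(1)[OF this(1) App.prems(2)] App.IH(2)[OF this(2) App.prems(2)]
  have "nred (cps R Sig \<Delta> (sub s M)) (sub t (cps R Sig \<Gamma> M))" "nred (cps R Sig \<Delta> (sub s N)) (sub t (cps R Sig \<Gamma> N))"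
    by blast+
  then show ?case by (auto simp: ty ty' sub_up_lift intro!: nred_Lam nred_App nred_lift)
next
  case (Box \<Gamma> Ns ts B \<tau>)
  have l: "length ts = length Ns" using list_all2_lengthD[OF Box.IH(1)] by simp
  have IH: "nred (cps R Sig \<Delta> (sub s N)) (sub t (cps R Sig \<Gamma> N)) \<and>
    (is_val N \<longrightarrow> nred (cps_val R Sig \<Delta> (sub s N)) (sub t (cps_val R Sig \<Gamma> N)))" if "N \<in> set Ns" for N
  proof -
    from that obtain i where i: "i < length Ns" "N = Ns ! i" by (auto simp: in_set_conv_nth)
    from that Box.prems(1) have "restricted N" by simp
    with list_all2_nthD[OF Box.IH(1) i(1)] i(2) Box.prems(2) show ?thesis by blast
  qed
  have "list_all2 (\<lambda>p q. fst p = fst q \<and> nred (snd p) (snd q)) (box_args R Sig \<Delta> ts (map (sub s) Ns))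
      (map (map_prod id (sub t)) (box_args R Sig \<Gamma> ts Ns))"
    by (rule list_all2_all_nthI) (use IH l in auto)
  from nred_box_seq[OF this, of "cps_val R Sig ts B" "cps_val R Sig ts B" "cps_ctx R ts" "\<lambda>i. Var (Suc i)" "[]" "Var 0"]
  have "nred (box_seq (cps_ctx R ts) (cps_val R Sig ts B) (box_args R Sig \<Delta> ts (map (sub s) Ns)) (\<lambda>i. Var (Suc i)) [] (Var 0))
     (sub (up_sub t) (box_seq (cps_ctx R ts) (cps_val R Sig ts B) (box_args R Sig \<Gamma> ts Ns) (\<lambda>i. Var (Suc i)) [] (Var 0)))"
    by (simp add: box_seq_map sub_box_seq comp_def ren_as_sub)
  then have "nred (cps R Sig \<Delta> (sub s (Box ts Ns B))) (sub t (cps R Sig \<Gamma> (Box ts Ns B)))"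
    using l by (simp add: cps_Box_eq nred_Lam del: cps.simps)
  moreover have "nred (cps_val R Sig \<Delta> (sub s (Box ts Ns B))) (sub t (cps_val R Sig \<Gamma> (Box ts Ns B)))"
    if "is_val (Box ts Ns B)"
    using IH that by (auto intro!: nred_Box list_all2_all_nthI)
  ultimately show ?case by blast
qed auto

lemma cps_sub0:
  assumes "cbv_typing Sig (\<sigma> # \<Gamma>) M \<tau>" "cbv_typing Sig \<Gamma> V \<sigma>" "is_val V"
  shows "nred (cps R Sig \<Gamma> (sub0 V M)) (sub0 (cps_val R Sig \<Gamma> V) (cps R Sig (\<sigma> # \<Gamma>) M))"
proof -
  have "cbv_typing Sig \<Gamma> (case_nat V Var i) ((\<sigma> # \<Gamma>) ! i) \<and> is_val (case_nat V Var i) \<and>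
      case_nat (cps_val R Sig \<Gamma> V) Var i = cps_val R Sig \<Gamma> (case_nat V Var i)" if "i < length (\<sigma> # \<Gamma>)" for i
    using that assms(2,3) by (cases i) auto
  from cps_sub[OF _ _ this] assms(1) show ?thesis unfolding cbv_typing_def sub0_def by blast
qed

lemma cps_val_flat_sub:
  assumes "cbv_typing Sig (ws @ \<sigma> # zs) M \<tau>" "is_val M" "cbv_typing Sig ys V \<sigma>" "is_val V"
  shows "nred (cps_val R Sig (ws @ ys @ zs) (flat_sub (length ws) (length ys) V M))
    (flat_sub (length ws) (length ys) (cps_val R Sig ys V) (cps_val R Sig (ws @ \<sigma> # zs) M))"
proof -
  let ?n = "length ws" and ?m = "length ys" and ?\<Gamma> = "ws @ ys @ zs"
  let ?s = "\<lambda>V i. if i < ?n then Var i else if i = ?n then ren (\<lambda>j. ?n + j) V else Var (i - 1 + ?m)"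
  have ren: "typed_ren (\<lambda>j. ?n + j) ys ?\<Gamma>" by (simp add: typed_ren_def nth_append)
  have tV: "typing Sig ?\<Gamma> (ren (\<lambda>j. ?n + j) V) \<sigma>"
    by (rule typing_ren[of _ ys]) (use assms(3) in \<open>auto simp: nth_append cbv_typing_def\<close>)
  have cV: "cps_val R Sig ?\<Gamma> (ren (\<lambda>j. ?n + j) V) = ren (\<lambda>j. ?n + j) (cps_val R Sig ys V)"
    using cps_ren[OF _ ren, of Sig V \<sigma> R] assms(3,4) by (simp add: cbv_typing_def)
  have "cbv_typing Sig ?\<Gamma> (?s V i) ((ws @ \<sigma> # zs) ! i) \<and> is_val (?s V i) \<and>
      ?s (cps_val R Sig ys V) i = cps_val R Sig ?\<Gamma> (?s V i)" if "i < length (ws @ \<sigma> # zs)" for i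
    using that tV cV assms(3,4) by (auto simp: nth_append nth_Cons' cbv_typing_def)
  from cps_sub[OF _ _ this] assms(1,2) show ?thesis unfolding cbv_typing_def flat_sub_def by blast
qed

section \<open>Running a transform with a given continuation\<close>

lemma nred_cps_App:
  "nred (App (cps R Sig \<Gamma> (App M N)) K)
    (App (cps R Sig \<Gamma> M) (Lam (cps_ty R (ty_of Sig \<Gamma> M)) (App (lift (cps R Sig \<Gamma> N)) (App (Var 0) (lift K)))))"
proof -
  have "sub0 K (App (lift (cps R Sig \<Gamma> M))
         (Lam (cps_ty R (ty_of Sig \<Gamma> M)) (App (lift (lift (cps R Sig \<Gamma> N))) (App (Var 0) (Var 1)))))
    = App (cps R Sig \<Gamma> M) (Lam (cps_ty R (ty_of Sig \<Gamma> M)) (App (lift (cps R Sig \<Gamma> N)) (App (Var 0) (lift K))))"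
    by (simp add: sub0_def sub_up_lift) (simp add: sub_ren comp_def)
  with nred_beta[of _ _ K] show ?thesis by (simp only: cps.simps) metis
qed

text \<open>The normal form for comparisons: the argument is run first, and its value is bound while
  the body runs with \<open>K\<close>. Source redexes on either side of a rule are brought to this
  shape.\<close>

lemma nred_cps_redex:
  assumes "cbv_typing Sig \<Gamma> (Lam \<sigma> M) \<tau>"
  shows "nred (App (cps R Sig \<Gamma> (App (Lam \<sigma> M) N)) K)
    (App (cps R Sig \<Gamma> N) (Lam (cps_ty R \<sigma>) (App (cps R Sig (\<sigma> # \<Gamma>) M) (lift K))))"
proof -
  let ?W = "cps_val R Sig \<Gamma> (Lam \<sigma> M)" and ?B = "App (lift (cps R Sig \<Gamma> N)) (App (Var 0) (lift K))"
  let ?L = "Lam (cps_ty R (ty_of Sig \<Gamma> (Lam \<sigma> M))) ?B"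
  have 1: "nred (App (cps R Sig \<Gamma> (Lam \<sigma> M)) ?L) (App ?L ?W)"
    by (rule nred_cps_val_cont[OF assms]) simp
  have "sub0 W ?B = App (cps R Sig \<Gamma> N) (App W K)" for W
    by (simp add: sub0_def) (simp add: sub_ren comp_def)
  with nred_beta[of _ ?B ?W] have 2: "nred (App ?L ?W) (App (cps R Sig \<Gamma> N) (App ?W K))" by metis
  have "sub (up_sub (case_nat K Var)) (ren (up_ren Suc) X) = X" for X
  proof -
    have "case_nat K Var \<circ> Suc = Var" by auto
    then show ?thesis by (simp add: sub_ren up_sub_up_ren)
  qed
  then have "sub0 K (Lam (cps_ty R \<sigma>) (App (ren (up_ren Suc) (cps R Sig (\<sigma> # \<Gamma>) M)) (Var 1)))
    = Lam (cps_ty R \<sigma>) (App (cps R Sig (\<sigma> # \<Gamma>) M) (lift K))"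
    by (simp add: sub0_def)
  with nred_beta[of _ _ K] have "nred (App ?W K) (Lam (cps_ty R \<sigma>) (App (cps R Sig (\<sigma> # \<Gamma>) M) (lift K)))"
    by (simp only: cps_val.simps) metis
  then have 3: "nred (App (cps R Sig \<Gamma> N) (App ?W K))
     (App (cps R Sig \<Gamma> N) (Lam (cps_ty R \<sigma>) (App (cps R Sig (\<sigma> # \<Gamma>) M) (lift K))))"
    by (intro nred_App rtranclp.rtrancl_refl)
  from rtranclp_trans[OF nred_cps_App rtranclp_trans[OF 1 rtranclp_trans[OF 2 3]]] show ?thesis .
qed

lemma nred_cps_Box:
  assumes "length ts = length Ms"
  shows "nred (App (cps R Sig \<Gamma> (Box ts Ms V)) K)
    (box_seq (cps_ctx R ts) (cps_val R Sig ts V) (box_args R Sig \<Gamma> ts Ms) Var [] K)"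
proof -
  have "sub0 K (box_seq (cps_ctx R ts) (cps_val R Sig ts V) (box_args R Sig \<Gamma> ts Ms) (\<lambda>i. Var (Suc i)) [] (Var 0))
    = box_seq (cps_ctx R ts) (cps_val R Sig ts V) (box_args R Sig \<Gamma> ts Ms) Var [] K"
    by (simp add: sub0_def sub_box_seq comp_def)
  with nred_beta[of _ _ K] show ?thesis by (simp only: cps_Box_eq[OF assms]) metis
qed

lemma nred_box_args_vals:
  assumes "list_all2 (\<lambda>V t. cbv_typing Sig \<Gamma> V (Nec t)) Vs ts" "\<forall>V \<in> set Vs. is_val V"
  shows "nred (box_seq us B (box_args R Sig \<Gamma> ts Vs @ qs) Var Ws K)
    (box_seq us B qs Var (Ws @ map (cps_val R Sig \<Gamma>) Vs) K)"
proof -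
  have "list_all2 (\<lambda>p W. \<exists>\<alpha>. nred (snd p) (Lam \<alpha> (App (Var 0) (lift W)))) (box_args R Sig \<Gamma> ts Vs) (map (cps_val R Sig \<Gamma>) Vs)"
    using assms
  proof (induction rule: list_all2_induct)
    case (Cons V Vs t ts)
    with nred_cps_val[of Sig \<Gamma> V "Nec t" R] show ?case by (auto simp: cbv_typing_def)
  qed simp
  from nred_box_seq_vals[OF this, of us B qs Var Ws K] show ?thesis by (simp add: comp_def)
qed

text \<open>\<open>kctx\<close> is the continuation with which the hole of a simple evaluation context is run.\<close>

primrec kctx :: "'p \<Rightarrow> ('c \<Rightarrow> 'p ty) \<Rightarrow> 'p ty list \<Rightarrow> 'p ty \<Rightarrow> ('p, 'c) sctx \<Rightarrow> ('p, 'c) tm \<Rightarrow> ('p, 'c) tm" where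
  "kctx R Sig \<Gamma> \<sigma> (CFun N) K = Lam (cps_ty R \<sigma>) (App (lift (cps R Sig \<Gamma> N)) (App (Var 0) (lift K)))"
| "kctx R Sig \<Gamma> \<sigma> (CArg V) K = App (cps_val R Sig \<Gamma> V) K"
| "kctx R Sig \<Gamma> \<sigma> (CBox ts Vs Ms B) K = Lam (cps_ty R \<sigma>)
     (box_seq (cps_ctx R ts) (cps_val R Sig ts B) (box_args R Sig \<Gamma> (drop (Suc (length Vs)) ts) Ms)
       (\<lambda>i. Var (Suc i)) (map lift (map (cps_val R Sig \<Gamma>) Vs) @ [Var 0]) (lift K))"

lemma cbv_typing_plug_hole: "cbv_typing Sig \<Gamma> (plug C M) \<tau> \<Longrightarrow> \<exists>\<sigma>. cbv_typing Sig \<Gamma> M \<sigma>"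
  by (cases C) (auto simp: list_all2_append1 list_all2_Cons1)

lemma cbv_typing_CBox:
  assumes "cbv_typing Sig \<Gamma> (Box ts (Vs @ M # Ms) B) \<tau>"
  obtains ts1 t ts2 \<rho> where "ts = ts1 @ t # ts2" "\<tau> = Nec \<rho>"
    "list_all2 (\<lambda>N \<sigma>. cbv_typing Sig \<Gamma> N (Nec \<sigma>)) Vs ts1" "cbv_typing Sig \<Gamma> M (Nec t)"
    "list_all2 (\<lambda>N \<sigma>. cbv_typing Sig \<Gamma> N (Nec \<sigma>)) Ms ts2" "cbv_typing Sig ts B \<rho>" "is_val B"
    "length ts1 = length Vs"
proof -
  from assms obtain ts1 t ts2 \<rho> where *: "ts = ts1 @ t # ts2" "\<tau> = Nec \<rho>"
    "list_all2 (\<lambda>N \<sigma>. cbv_typing Sig \<Gamma> N (Nec \<sigma>)) Vs ts1" "cbv_typing Sig \<Gamma> M (Nec t)"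
    "list_all2 (\<lambda>N \<sigma>. cbv_typing Sig \<Gamma> N (Nec \<sigma>)) Ms ts2" "cbv_typing Sig ts B \<rho>" "is_val B"
    by (auto simp: list_all2_append1 list_all2_Cons1)
  from that[OF this] list_all2_lengthD[OF *(3)] show ?thesis by simp
qed

lemma cbv_typing_plug_lift:
  assumes "cbv_typing Sig \<Gamma> (plug C M) \<tau>" "cbv_typing Sig \<Gamma> M \<sigma>" "cbv_typing Sig (\<alpha> # \<Gamma>) M' \<sigma>"
  shows "cbv_typing Sig (\<alpha> # \<Gamma>) (plug (lift_sctx C) M') \<tau>"
proof (cases C)
  case (CFun N)
  with assms(1) obtain \<sigma>' where "cbv_typing Sig \<Gamma> M (\<sigma>' \<rightarrow> \<tau>)" "cbv_typing Sig \<Gamma> N \<sigma>'" by auto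
  with cbv_typing_unique[OF this(1) assms(2)] CFun assms(3) show ?thesis by auto
next
  case (CArg V)
  with assms(1) obtain \<sigma>' where "cbv_typing Sig \<Gamma> V (\<sigma>' \<rightarrow> \<tau>)" "cbv_typing Sig \<Gamma> M \<sigma>'" by auto
  with cbv_typing_unique[OF this(2) assms(2)] CArg assms(3) show ?thesis by auto
next
  case (CBox ts Vs Ms B)
  from assms(1)[unfolded CBox plug.simps] show ?thesis
  proof (rule cbv_typing_CBox)
    fix ts1 t ts2 \<rho>
    assume a: "ts = ts1 @ t # ts2" "\<tau> = Nec \<rho>"
      "list_all2 (\<lambda>N \<sigma>. cbv_typing Sig \<Gamma> N (Nec \<sigma>)) Vs ts1" "cbv_typing Sig \<Gamma> M (Nec t)"
      "list_all2 (\<lambda>N \<sigma>. cbv_typing Sig \<Gamma> N (Nec \<sigma>)) Ms ts2" "cbv_typing Sig ts B \<rho>" "is_val B"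
    with cbv_typing_unique[OF a(4) assms(2)] CBox assms(3) show ?thesis
      by (auto simp: list_all2_map1 intro!: list_all2_appendI)
  qed
qed

text \<open>Everything to be evaluated before the hole is a value, so administrative reduction
  brings the transform of the hole to the front.\<close>

lemma nred_plug:
  assumes "sctx_ok C" "cbv_typing Sig \<Gamma> (plug C M) \<tau>" "cbv_typing Sig \<Gamma> M \<sigma>"
  shows "nred (App (cps R Sig \<Gamma> (plug C M)) K) (App (cps R Sig \<Gamma> M) (kctx R Sig \<Gamma> \<sigma> C K))"
proof (cases C)
  case (CFun N)
  have "ty_of Sig \<Gamma> M = \<sigma>" using assms(3) ty_of_typing unfolding cbv_typing_def by blast
  with CFun nred_cps_App[of R Sig \<Gamma> M N K] show ?thesis by (simp only: plug.simps kctx.simps)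
next
  case (CArg V)
  let ?B = "App (lift (cps R Sig \<Gamma> M)) (App (Var 0) (lift K))"
  let ?L = "Lam (cps_ty R (ty_of Sig \<Gamma> V)) ?B"
  from assms CArg obtain \<rho> where V: "cbv_typing Sig \<Gamma> V \<rho>" "is_val V" by auto
  have "sub0 W ?B = App (cps R Sig \<Gamma> M) (App W K)" for W
    by (simp add: sub0_def) (simp add: sub_ren comp_def)
  with nred_beta[of _ ?B] have "nred (App ?L W) (App (cps R Sig \<Gamma> M) (App W K))" for W by metis
  from rtranclp_trans[OF nred_cps_App rtranclp_trans[OF nred_cps_val_cont[OF V] this]] CArg
  show ?thesis by (simp only: plug.simps kctx.simps)
next
  case (CBox ts Vs Ms B)
  from assms(2)[unfolded CBox plug.simps] show ?thesis
  proof (rule cbv_typing_CBox)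
    fix ts1 t ts2 \<rho>
    assume a: "ts = ts1 @ t # ts2" "\<tau> = Nec \<rho>"
      "list_all2 (\<lambda>N \<sigma>. cbv_typing Sig \<Gamma> N (Nec \<sigma>)) Vs ts1" "cbv_typing Sig \<Gamma> M (Nec t)"
      "list_all2 (\<lambda>N \<sigma>. cbv_typing Sig \<Gamma> N (Nec \<sigma>)) Ms ts2" "cbv_typing Sig ts B \<rho>" "is_val B" "length ts1 = length Vs"
    have \<sigma>: "\<sigma> = Nec t" by (rule cbv_typing_unique[OF assms(3) a(4)])
    have l: "length ts = length (Vs @ M # Ms)" using a(1,8) list_all2_lengthD[OF a(5)] by simp
    let ?B = "cps_val R Sig ts B"
    have args: "box_args R Sig \<Gamma> ts (Vs @ M # Ms) = box_args R Sig \<Gamma> ts1 Vs @ (cps_ty R (Nec t), cps R Sig \<Gamma> M) # box_args R Sig \<Gamma> ts2 Ms"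
      using a(1,8) by simp
    have vals: "\<forall>V \<in> set Vs. is_val V" using assms(1) CBox by simp
    have "nred (App (cps R Sig \<Gamma> (Box ts (Vs @ M # Ms) B)) K)
        (box_seq (cps_ctx R ts) ?B (box_args R Sig \<Gamma> ts1 Vs @ (cps_ty R (Nec t), cps R Sig \<Gamma> M) # box_args R Sig \<Gamma> ts2 Ms) Var [] K)"
      using nred_cps_Box[OF l, of R Sig \<Gamma> B K] unfolding args .
    from rtranclp_trans[OF this nred_box_args_vals[OF a(3) vals]]
    have "nred (App (cps R Sig \<Gamma> (Box ts (Vs @ M # Ms) B)) K)
      (box_seq (cps_ctx R ts) ?B ((cps_ty R (Nec t), cps R Sig \<Gamma> M) # box_args R Sig \<Gamma> ts2 Ms) Var ([] @ map (cps_val R Sig \<Gamma>) Vs) K)" .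
    moreover have "drop (Suc (length Vs)) ts = ts2" using a(1,8) by simp
    ultimately show ?thesis using CBox \<sigma> by (simp add: comp_def del: cps.simps)
  qed
qed

lemma ren_box_seq:
  fixes K :: "('p, 'c) tm"
  shows "ren f (box_seq ts B ps \<theta> Ws K) = box_seq ts B ps (ren f \<circ> \<theta>) (map (ren f) Ws) (ren f K)"
proof -
  have "ren f = (sub (Var \<circ> f) :: ('p, 'c) tm \<Rightarrow> _)" by (rule ext) (rule ren_as_sub)
  then show ?thesis by (simp only: sub_box_seq)
qed

lemma lift_kctx:
  assumes "sctx_ok C" "cbv_typing Sig \<Gamma> (plug C M) \<tau>"
  shows "kctx R Sig (\<alpha> # \<Gamma>) \<sigma> (lift_sctx C) (lift K) = lift (kctx R Sig \<Gamma> \<sigma> C K)"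
proof (cases C)
  case (CFun N)
  with assms(2) cps_lift show ?thesis by (fastforce simp: ren_up_lift)
next
  case (CArg V)
  with assms cps_val_lift show ?thesis by fastforce
next
  case (CBox ts Vs Ms B)
  from assms(2)[unfolded CBox plug.simps] show ?thesis
  proof (rule cbv_typing_CBox)
    fix ts1 t ts2 \<rho>
    assume a: "ts = ts1 @ t # ts2" "\<tau> = Nec \<rho>"
      "list_all2 (\<lambda>N \<sigma>. cbv_typing Sig \<Gamma> N (Nec \<sigma>)) Vs ts1" "cbv_typing Sig \<Gamma> M (Nec t)"
      "list_all2 (\<lambda>N \<sigma>. cbv_typing Sig \<Gamma> N (Nec \<sigma>)) Ms ts2" "cbv_typing Sig ts B \<rho>" "is_val B" "length ts1 = length Vs"
    have vals: "\<forall>V \<in> set Vs. is_val V" using assms(1) CBox by simp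
    have Vs: "map (cps_val R Sig (\<alpha> # \<Gamma>)) (map lift Vs) = map lift (map (cps_val R Sig \<Gamma>) Vs)"
      using a(3) vals by (induction rule: list_all2_induct) (auto simp: cps_val_lift)
    have "lift = sub (Var \<circ> Suc)" by (rule ext) (rule ren_as_sub)
    moreover have "box_args R Sig (\<alpha> # \<Gamma>) ts2 (map lift Ms) = map (map_prod id lift) (box_args R Sig \<Gamma> ts2 Ms)"
      using a(5) by (induction rule: list_all2_induct) (auto simp: cps_lift)
    ultimately have Ms: "box_args R Sig (\<alpha> # \<Gamma>) ts2 (map lift Ms) = map (map_prod id (sub (Var \<circ> Suc))) (box_args R Sig \<Gamma> ts2 Ms)"
      by metis
    let ?B = "cps_val R Sig ts B" and ?Ws = "map (cps_val R Sig \<Gamma>) Vs"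
    have drop: "drop (Suc (length Vs)) ts = ts2" using a(1,8) by simp
    have "box_seq (cps_ctx R ts) ?B (box_args R Sig (\<alpha> # \<Gamma>) ts2 (map lift Ms)) (\<lambda>i. Var (Suc i))
        (map lift (map lift ?Ws) @ [Var 0]) (lift (lift K))
      = ren (up_ren Suc) (box_seq (cps_ctx R ts) ?B (box_args R Sig \<Gamma> ts2 Ms) (\<lambda>i. Var (Suc i)) (map lift ?Ws @ [Var 0]) (lift K))"
      unfolding Ms box_seq_map ren_box_seq by (simp add: comp_def ren_up_lift)
    then show ?thesis unfolding CBox by (simp add: drop Vs del: map_map)
  qed
qed

lemma plugs_simps [simp]: "plugs [] M = M" "plugs (C # E) M = plug C (plugs E M)"
  by (simp_all add: plugs_def)

lemma cbv_typing_plugs_hole: "cbv_typing Sig \<Gamma> (plugs E M) \<tau> \<Longrightarrow> \<exists>\<sigma>. cbv_typing Sig \<Gamma> M \<sigma>"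
  by (induction E arbitrary: \<tau>) (auto dest: cbv_typing_plug_hole)

lemma cbv_typing_plugs_lift:
  "cbv_typing Sig \<Gamma> (plugs E M) \<tau> \<Longrightarrow> cbv_typing Sig \<Gamma> M \<sigma> \<Longrightarrow> cbv_typing Sig (\<alpha> # \<Gamma>) M' \<sigma> \<Longrightarrow>
   cbv_typing Sig (\<alpha> # \<Gamma>) (plugs (map lift_sctx E) M') \<tau>"
proof (induction E arbitrary: \<tau>)
  case Nil
  then show ?case using cbv_typing_unique by fastforce
next
  case (Cons C E)
  from Cons.prems(1) obtain \<rho> where \<rho>: "cbv_typing Sig \<Gamma> (plugs E M) \<rho>" using cbv_typing_plug_hole by fastforce
  with Cons have "cbv_typing Sig (\<alpha> # \<Gamma>) (plugs (map lift_sctx E) M') \<rho>" by blast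
  with cbv_typing_plug_lift[OF _ \<rho>] Cons.prems(1) show ?case by simp
qed

text \<open>\<open>L\<close> does not depend on the content of the hole. The second conjunct gives
  this for the context moved under a binder, as it appears on one side of the rules
  \<open>lift\<close>, \<open>flat\<close> and \<open>eval\<close>.\<close>

lemma nred_plugs:
  assumes "\<forall>C \<in> set E. sctx_ok C" "cbv_typing Sig \<Gamma> (plugs E M) \<tau>" "cbv_typing Sig \<Gamma> M \<sigma>"
  shows "\<exists>L. nred (App (cps R Sig \<Gamma> (plugs E M)) K) (App (cps R Sig \<Gamma> M) L) \<and>
    (\<forall>\<alpha> M'. cbv_typing Sig (\<alpha> # \<Gamma>) M' \<sigma> \<longrightarrow>
      nred (App (cps R Sig (\<alpha> # \<Gamma>) (plugs (map lift_sctx E) M')) (lift K)) (App (cps R Sig (\<alpha> # \<Gamma>) M') (lift L)))"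
  using assms(1,2)
proof (induction E arbitrary: K \<tau>)
  case Nil
  show ?case by (rule exI[of _ K]) simp
next
  case (Cons C E)
  from Cons.prems(2) obtain \<rho> where \<rho>: "cbv_typing Sig \<Gamma> (plugs E M) \<rho>" using cbv_typing_plug_hole by fastforce
  have C: "sctx_ok C" "cbv_typing Sig \<Gamma> (plug C (plugs E M)) \<tau>" using Cons.prems by auto
  let ?K = "kctx R Sig \<Gamma> \<rho> C K"
  from Cons.IH[OF _ \<rho>, of ?K] Cons.prems(1) obtain L where L:
    "nred (App (cps R Sig \<Gamma> (plugs E M)) ?K) (App (cps R Sig \<Gamma> M) L)"
    "\<And>\<alpha> M'. cbv_typing Sig (\<alpha> # \<Gamma>) M' \<sigma> \<Longrightarrow>
      nred (App (cps R Sig (\<alpha> # \<Gamma>) (plugs (map lift_sctx E) M')) (lift ?K)) (App (cps R Sig (\<alpha> # \<Gamma>) M') (lift L))"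
    by auto
  show ?case
  proof (intro exI conjI allI impI)
    show "nred (App (cps R Sig \<Gamma> (plugs (C # E) M)) K) (App (cps R Sig \<Gamma> M) L)"
      using rtranclp_trans[OF nred_plug[OF C \<rho>] L(1)] by simp
    fix \<alpha> M' assume M': "cbv_typing Sig (\<alpha> # \<Gamma>) M' \<sigma>"
    note t = cbv_typing_plugs_lift[OF \<rho> assms(3) M']
    have "sctx_ok (lift_sctx C)" using C(1) by (cases C) auto
    from rtranclp_trans[OF nred_plug[OF this cbv_typing_plug_lift[OF C(2) \<rho> t] t, of R "lift K", unfolded lift_kctx[OF C]] L(2)[OF M']]
    show "nred (App (cps R Sig (\<alpha> # \<Gamma>) (plugs (map lift_sctx (C # E)) M')) (lift K)) (App (cps R Sig (\<alpha> # \<Gamma>) M') (lift L))"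
      by simp
  qed
qed

section \<open>Flattening inside an evaluation sequence\<close>

lemma nred_box_seq_open:
  assumes "length ws = length Ws" "length ys = length Us"
  shows "nred (box_seq (ws @ \<sigma> # zs) B ps \<theta> (Ws @ Box ys Us V # Xs) K)
    (box_seq (ws @ ys @ zs) (flat_sub (length ws) (length ys) V B) ps \<theta> (Ws @ Us @ Xs) K)"
  using assms
proof (induction ps arbitrary: \<theta> Ws Us Xs K)
  case Nil
  then have "cbn_root (Box (ws @ \<sigma> # zs) (Ws @ Box ys Us V # Xs) B)
    (Box (ws @ ys @ zs) (Ws @ Us @ Xs) (flat_sub (length ws) (length ys) V B))"
    by (intro cbn_root.box_flat)
  then show ?case unfolding box_seq.simps cbn_red_def append_Nil2
    by (intro r_into_rtranclp compat.appR compat.root)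
next
  case (Cons p ps)
  from Cons.IH[of "map lift Ws" "map lift Us" "lift \<circ> \<theta>" "map lift Xs @ [Var 0]" "lift K"] Cons.prems
  show ?case by (simp add: nred_App nred_Lam comp_def)
qed

text \<open>Once the inner arguments are run, beta passes the inner box to the outer sequence, where
  it can be flattened under the remaining binders at once. The two sequences thus merge into the one
  of the flattened box.\<close>

lemma nred_box_seq_flat:
  assumes "length ws = length Ws" "length ys = length Us + length qs"
  shows "nred (box_seq ys V qs \<theta> Us (Lam \<alpha> (box_seq (ws @ \<sigma> # zs) B ps (lift \<circ> \<theta>) (map lift Ws @ [Var 0]) (lift K))))
    (box_seq (ws @ ys @ zs) (flat_sub (length ws) (length ys) V B) (qs @ ps) \<theta> (Ws @ Us) K)"
  using assms
proof (induction qs arbitrary: \<theta> Ws Us K)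
  case Nil
  let ?B = "box_seq (ws @ \<sigma> # zs) B ps (lift \<circ> \<theta>) (map lift Ws @ [Var 0]) (lift K)"
  have "sub0 (Box ys Us V) ?B = box_seq (ws @ \<sigma> # zs) B ps \<theta> (Ws @ Box ys Us V # []) K"
    by (simp add: sub0_def sub_box_seq sub_ren comp_def)
  with nred_beta[of \<alpha> ?B "Box ys Us V"]
  have 1: "nred (App (Lam \<alpha> ?B) (Box ys Us V)) (box_seq (ws @ \<sigma> # zs) B ps \<theta> (Ws @ Box ys Us V # []) K)"
    by (simp only:)
  have "length ys = length Us" using Nil by simp
  from rtranclp_trans[OF 1 nred_box_seq_open[OF Nil(1) this]]
  show ?case by (simp only: box_seq.simps append_Nil append_Nil2)
next
  case (Cons q qs)
  have "ren (up_ren Suc) (box_seq (ws @ \<sigma> # zs) B ps (lift \<circ> \<theta>) (map lift Ws @ [Var 0]) (lift K))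
    = box_seq (ws @ \<sigma> # zs) B ps (lift \<circ> (lift \<circ> \<theta>)) (map lift (map lift Ws) @ [Var 0]) (lift (lift K))"
    unfolding ren_box_seq by (simp add: comp_def ren_up_lift)
  with Cons.IH[of "map lift Ws" "map lift Us @ [Var 0]" "lift \<circ> \<theta>" "lift K"] Cons.prems
  show ?case by (simp add: nred_App nred_Lam comp_def)
qed

section \<open>Joinability of the two sides of each call-by-value rule\<close>

definition joinable :: "('p, 'c) tm \<Rightarrow> ('p, 'c) tm \<Rightarrow> bool" where
  "joinable M N \<longleftrightarrow> (\<exists>P. nred M P \<and> nred N P)"

lemma joinableI: "nred M P \<Longrightarrow> nred N P \<Longrightarrow> joinable M N"
  unfolding joinable_def by blast

lemma nred_cps_eta_body:
  assumes "cbv_typing Sig \<Gamma> V (\<sigma> \<rightarrow> \<tau>)" "is_val V"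
  shows "nred (App (cps R Sig (\<sigma> # \<Gamma>) (App (lift V) (Var 0))) K) (App (App (lift (cps_val R Sig \<Gamma> V)) K) (Var 0))"
proof -
  have "nred (App (cps R Sig (\<sigma> # \<Gamma>) (plug (CArg (lift V)) (Var 0))) K)
      (App (cps R Sig (\<sigma> # \<Gamma>) (Var 0)) (kctx R Sig (\<sigma> # \<Gamma>) \<sigma> (CArg (lift V)) K))"
    by (rule nred_plug) (use assms in auto)
  moreover have "nred (App (cps R Sig (\<sigma> # \<Gamma>) (Var 0)) K') (App K' (cps_val R Sig (\<sigma> # \<Gamma>) (Var 0)))" for K'
    by (rule nred_cps_val_cont) auto
  ultimately have "nred (App (cps R Sig (\<sigma> # \<Gamma>) (plug (CArg (lift V)) (Var 0))) K)
    (App (kctx R Sig (\<sigma> # \<Gamma>) \<sigma> (CArg (lift V)) K) (cps_val R Sig (\<sigma> # \<Gamma>) (Var 0)))"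
    by (rule rtranclp_trans)
  then show ?thesis by (simp only: plug.simps kctx.simps cps_val_lift[OF assms] cps_val.simps)
qed

text \<open>Bodies of boxes are translated by \<open>cps_val\<close>, so steps between values need
  their own statement. With values on both sides only eta and the two box rules remain.\<close>

lemma cbv_root_cps_val:
  assumes "cbv_root M N" "cbv_typing Sig \<Gamma> M \<tau>" "cbv_typing Sig \<Gamma> N \<tau>" "is_val M" "is_val N"
  shows "joinable (cps_val R Sig \<Gamma> M) (cps_val R Sig \<Gamma> N)"
  using assms(1)
proof (cases rule: cbv_root.cases)
  case (eta_v \<sigma>)
  from eta_v assms(2) obtain \<rho> where t: "cbv_typing Sig (\<sigma> # \<Gamma>) (App (lift N) (Var 0)) \<rho>"
    "cbv_typing Sig \<Gamma> N (\<sigma> \<rightarrow> \<rho>)" by auto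
  let ?W = "cps_val R Sig \<Gamma> N" and ?X = "App (lift N) (Var 0)"
  let ?\<alpha> = "cont_ty R (ty_of Sig (\<sigma> # \<Gamma>) ?X)"
  have "cps R Sig (\<sigma> # \<sigma> # \<Gamma>) (ren (up_ren Suc) ?X) = ren (up_ren Suc) (cps R Sig (\<sigma> # \<Gamma>) ?X)"
    using cps_ren[OF _ typed_ren_up[OF typed_ren_lift], of Sig \<sigma> \<Gamma> ?X \<rho>] t(1)
    unfolding cbv_typing_def by (meson conjunct1)
  moreover have "ren (up_ren Suc) ?X = App (lift (lift N)) (Var 0)" by (simp add: ren_up_lift)
  moreover have "nred (App (cps R Sig (\<sigma> # \<sigma> # \<Gamma>) (App (lift (lift N)) (Var 0))) (Var 1))
    (App (App (lift (cps_val R Sig (\<sigma> # \<Gamma>) (lift N))) (Var 1)) (Var 0))"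
    by (rule nred_cps_eta_body) (use t assms(5) in auto)
  ultimately have "nred (App (ren (up_ren Suc) (cps R Sig (\<sigma> # \<Gamma>) ?X)) (Var 1)) (App (lift (App (lift ?W) (Var 0))) (Var 0))"
    using cps_val_lift[OF t(2) assms(5)] by (simp del: cps.simps)
  then have "nred (Lam ?\<alpha> (Lam (cps_ty R \<sigma>) (App (ren (up_ren Suc) (cps R Sig (\<sigma> # \<Gamma>) ?X)) (Var 1))))
      (Lam ?\<alpha> (Lam (cps_ty R \<sigma>) (App (lift (App (lift ?W) (Var 0))) (Var 0))))"
    by (intro nred_Lam)
  \<comment> \<open>One source eta step costs two target eta steps, over the argument and over the
    continuation.\<close>
  also have "nred (Lam ?\<alpha> (Lam (cps_ty R \<sigma>) (App (lift (App (lift ?W) (Var 0))) (Var 0)))) (Lam ?\<alpha> (App (lift ?W) (Var 0)))"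
    by (intro nred_Lam nred_eta)
  also have "nred (Lam ?\<alpha> (App (lift ?W) (Var 0))) ?W" by (rule nred_eta)
  finally have "nred (cps_val R Sig \<Gamma> M) ?W" using eta_v by (simp only: cps_val.simps)
  then show ?thesis by (rule joinableI) simp
next
  case (box_id_v \<sigma>)
  then have "cps_val R Sig \<Gamma> M = Box [cps_ty R \<sigma>] [cps_val R Sig \<Gamma> N] (Var 0)" by simp
  then have "cbn_red (cps_val R Sig \<Gamma> M) (cps_val R Sig \<Gamma> N)"
    by (auto simp: cbn_red_def intro: compat.root cbn_root.box_id)
  then show ?thesis by (blast intro: joinableI)
next
  case (box_flat_v ws Ws ys Ns V \<sigma> zs Ps B)
  let ?\<Phi> = "map (cps_val R Sig \<Gamma>)" and ?T = "cps_ctx R"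
  let ?P = "Box (?T ws @ ?T ys @ ?T zs) (?\<Phi> Ws @ ?\<Phi> Ns @ ?\<Phi> Ps)
    (flat_sub (length ws) (length ys) (cps_val R Sig ys V) (cps_val R Sig (ws @ \<sigma> # zs) B))"
  from assms(2)[unfolded box_flat_v] obtain \<rho> where B: "cbv_typing Sig (ws @ \<sigma> # zs) B \<rho>" "is_val B"
    and l: "list_all2 (\<lambda>N \<sigma>. cbv_typing Sig \<Gamma> N (Nec \<sigma>)) (Ws @ Box ys Ns V # Ps) (ws @ \<sigma> # zs)" by auto
  from l box_flat_v(3) have V: "cbv_typing Sig ys V \<sigma>" by (auto simp: list_all2_append)
  have "cbn_root (Box (?T ws @ cps_ty R \<sigma> # ?T zs) (?\<Phi> Ws @ Box (?T ys) (?\<Phi> Ns) (cps_val R Sig ys V) # ?\<Phi> Ps) (cps_val R Sig (ws @ \<sigma> # zs) B))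
    (Box (?T ws @ ?T ys @ ?T zs) (?\<Phi> Ws @ ?\<Phi> Ns @ ?\<Phi> Ps)
      (flat_sub (length (?T ws)) (length (?T ys)) (cps_val R Sig ys V) (cps_val R Sig (ws @ \<sigma> # zs) B)))"
    by (rule cbn_root.box_flat) (use box_flat_v in auto)
  then have "cbn_red (cps_val R Sig \<Gamma> M) ?P"
    using box_flat_v by (simp add: cbn_red_def compat.root)
  moreover have "nred (cps_val R Sig \<Gamma> N) ?P"
    using nred_Box[OF list.rel_refl cps_val_flat_sub[OF B V box_flat_v(6)]] box_flat_v by simp
  ultimately show ?thesis by (blast intro: joinableI)
next
  case (lift C \<sigma> A B)
  with assms(4) show ?thesis by (cases C) auto
next
  case (flat C y A \<sigma>)
  with assms(4) show ?thesis by (cases C) auto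
qed (use assms in \<open>auto\<close>)

lemma nred_cps_App_val:
  assumes "cbv_typing Sig \<Gamma> (App V M) \<tau>" "is_val V"
  shows "nred (App (cps R Sig \<Gamma> (App V M)) K) (App (cps R Sig \<Gamma> M) (App (cps_val R Sig \<Gamma> V) K))"
proof -
  from assms obtain \<sigma> where "cbv_typing Sig \<Gamma> M \<sigma>" by auto
  from nred_plug[OF _ _ this, of "CArg V"] assms show ?thesis by (simp del: cps.simps)
qed

lemma nred_cps_Var: "i < length \<Gamma> \<Longrightarrow> nred (App (cps R Sig \<Gamma> (Var i)) K) (App K (Var i))"
  using nred_cps_val_cont[of Sig \<Gamma> "Var i" "\<Gamma> ! i" R K] by (simp del: cps.simps)

lemma nred_App_cong_right: "nred N N' \<Longrightarrow> nred (App M N) (App M N')"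
  by (intro nred_App rtranclp.rtrancl_refl)

lemma nred_cps_redex_step:
  assumes "cbv_typing Sig \<Gamma> (App (Lam \<sigma> M) N) \<tau>"
    and "nred (App (cps R Sig (\<sigma> # \<Gamma>) M) (lift K)) B"
  shows "nred (App (cps R Sig \<Gamma> (App (Lam \<sigma> M) N)) K) (App (cps R Sig \<Gamma> N) (Lam (cps_ty R \<sigma>) B))"
proof -
  from assms(1) obtain \<rho> where "cbv_typing Sig \<Gamma> (Lam \<sigma> M) \<rho>" by auto
  from rtranclp_trans[OF nred_cps_redex[OF this] nred_App_cong_right[OF nred_Lam[OF assms(2)]]]
  show ?thesis .
qed

text \<open>Transforms are compared when applied to an arbitrary continuation, which allows
  administrative redexes to fire; \<open>cbv_root_cps\<close> removes the continuation again by
  extensionality.\<close>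

lemma cbv_root_joinable:
  assumes root: "cbv_root M N" and M: "cbv_typing Sig \<Gamma> M \<tau>" and N: "cbv_typing Sig \<Gamma> N \<tau>"
  shows "joinable (App (cps R Sig \<Gamma> M) K) (App (cps R Sig \<Gamma> N) K)"
  using root
proof (cases rule: cbv_root.cases)
  case (ident \<sigma>)
  have "nred (App (cps R Sig \<Gamma> (App (Lam \<sigma> (Var 0)) N)) K)
      (App (cps R Sig \<Gamma> N) (Lam (cps_ty R \<sigma>) (App (lift K) (Var 0))))"
    by (rule nred_cps_redex_step) (use M ident nred_cps_Var[of 0 "\<sigma> # \<Gamma>"] in \<open>simp_all del: cps.simps\<close>)
  from rtranclp_trans[OF this nred_App_cong_right[OF nred_eta]] show ?thesis
    unfolding ident by (rule joinableI) simp
next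
  case (beta_v V \<sigma> A)
  from M beta_v have t: "cbv_typing Sig (\<sigma> # \<Gamma>) A \<tau>" "cbv_typing Sig \<Gamma> V \<sigma>" by auto
  let ?W = "cps_val R Sig \<Gamma> V" and ?B = "App (cps R Sig (\<sigma> # \<Gamma>) A) (lift K)"
  have 1: "nred (App (cps R Sig \<Gamma> (App (Lam \<sigma> A) V)) K) (App (cps R Sig \<Gamma> V) (Lam (cps_ty R \<sigma>) ?B))"
    by (rule nred_cps_redex_step) (use M beta_v in auto)
  have "sub0 ?W ?B = App (sub0 ?W (cps R Sig (\<sigma> # \<Gamma>) A)) K"
    by (simp add: sub0_def) (simp add: sub_ren comp_def)
  with nred_beta[of "cps_ty R \<sigma>" ?B ?W]
  have 2: "nred (App (Lam (cps_ty R \<sigma>) ?B) ?W) (App (sub0 ?W (cps R Sig (\<sigma> # \<Gamma>) A)) K)" by simp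
  have 3: "nred (App (cps R Sig \<Gamma> (sub0 V A)) K) (App (sub0 ?W (cps R Sig (\<sigma> # \<Gamma>) A)) K)"
    by (intro nred_App cps_sub0[OF t beta_v(3)]) simp
  from rtranclp_trans[OF 1 rtranclp_trans[OF nred_cps_val_cont[OF t(2) beta_v(3)] 2]] 3 show ?thesis
    unfolding beta_v by (rule joinableI)
next
  case (eta_v \<sigma>)
  have "is_val M" using eta_v by simp
  from cbv_root_cps_val[OF root M N this, of R] eta_v obtain P
    where P: "nred (cps_val R Sig \<Gamma> M) P" "nred (cps_val R Sig \<Gamma> N) P" unfolding joinable_def by blast
  show ?thesis
    using rtranclp_trans[OF nred_cps_val_cont[OF M \<open>is_val M\<close>] nred_App_cong_right[OF P(1)]]
      rtranclp_trans[OF nred_cps_val_cont[OF N eta_v(2)] nred_App_cong_right[OF P(2)]]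
    by (rule joinableI)
next
  case (lift C \<sigma> A B)
  let ?H = "App (Lam \<sigma> A) B"
  have M': "cbv_typing Sig \<Gamma> (plugs [C] ?H) \<tau>" using M lift by simp
  from cbv_typing_plugs_hole[OF M'] obtain \<rho> where \<rho>: "cbv_typing Sig \<Gamma> ?H \<rho>" by blast
  from nred_plugs[OF _ M' \<rho>, of R K] lift obtain L
    where L: "nred (App (cps R Sig \<Gamma> M) K) (App (cps R Sig \<Gamma> ?H) L)"
      "\<And>\<alpha> M'. cbv_typing Sig (\<alpha> # \<Gamma>) M' \<rho> \<Longrightarrow>
        nred (App (cps R Sig (\<alpha> # \<Gamma>) (plug (lift_sctx C) M')) (lift K)) (App (cps R Sig (\<alpha> # \<Gamma>) M') (lift L))"
    by (auto simp del: cps.simps)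
  \<comment> \<open>Both sides run \<open>B\<close> first and then \<open>A\<close> with
    continuation \<open>L\<close>.\<close>
  have 1: "nred (App (cps R Sig \<Gamma> ?H) L) (App (cps R Sig \<Gamma> B) (Lam (cps_ty R \<sigma>) (App (cps R Sig (\<sigma> # \<Gamma>) A) (lift L))))"
    by (rule nred_cps_redex_step[OF \<rho>]) simp
  have "cbv_typing Sig (\<sigma> # \<Gamma>) A \<rho>" using \<rho> by auto
  from nred_cps_redex_step[OF N[unfolded lift] L(2)[OF this]]
  have 2: "nred (App (cps R Sig \<Gamma> N) K) (App (cps R Sig \<Gamma> B) (Lam (cps_ty R \<sigma>) (App (cps R Sig (\<sigma> # \<Gamma>) A) (lift L))))"
    unfolding lift .
  from rtranclp_trans[OF L(1) 1] 2 show ?thesis by (rule joinableI)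
next
  case (flat C y A \<sigma>)
  let ?H = "App (Var y) A"
  have M': "cbv_typing Sig \<Gamma> (plugs [C] ?H) \<tau>" using M flat by simp
  from N flat have \<rho>: "cbv_typing Sig \<Gamma> ?H \<sigma>" by auto
  from nred_plugs[OF _ M' \<rho>, of R K] flat obtain L
    where L: "nred (App (cps R Sig \<Gamma> M) K) (App (cps R Sig \<Gamma> ?H) L)"
      "\<And>\<alpha> M'. cbv_typing Sig (\<alpha> # \<Gamma>) M' \<sigma> \<Longrightarrow>
        nred (App (cps R Sig (\<alpha> # \<Gamma>) (plug (lift_sctx C) M')) (lift K)) (App (cps R Sig (\<alpha> # \<Gamma>) M') (lift L))"
    by (auto simp del: cps.simps)
  have "cbv_typing Sig (\<sigma> # \<Gamma>) (Var 0) \<sigma>" by simp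
  from rtranclp_trans[OF L(2)[OF this] nred_cps_Var]
  have "nred (App (cps R Sig (\<sigma> # \<Gamma>) (plug (lift_sctx C) (Var 0))) (lift K)) (App (lift L) (Var 0))" by simp
  \<comment> \<open>Binding the value of the hole and passing it straight to \<open>L\<close> is an
    eta expansion of \<open>L\<close>.\<close>
  from rtranclp_trans[OF nred_cps_redex_step[OF N[unfolded flat] this] nred_App_cong_right[OF nred_eta]]
  have "nred (App (cps R Sig \<Gamma> N) K) (App (cps R Sig \<Gamma> ?H) L)" unfolding flat .
  with L(1) show ?thesis by (rule joinableI)
next
  case (eval E \<sigma> y A)
  let ?H = "App (Var y) A" and ?H' = "App (Var (Suc y)) (Var 0)"
  have N': "cbv_typing Sig \<Gamma> (plugs E ?H) \<tau>" using N eval by simp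
  from cbv_typing_plugs_hole[OF N'] obtain \<rho> where \<rho>: "cbv_typing Sig \<Gamma> ?H \<rho>" by blast
  from nred_plugs[OF _ N' \<rho>, of R K] eval obtain L
    where L: "nred (App (cps R Sig \<Gamma> N) K) (App (cps R Sig \<Gamma> ?H) L)"
      "\<And>\<alpha> M'. cbv_typing Sig (\<alpha> # \<Gamma>) M' \<rho> \<Longrightarrow>
        nred (App (cps R Sig (\<alpha> # \<Gamma>) (plugs (map lift_sctx E) M')) (lift K)) (App (cps R Sig (\<alpha> # \<Gamma>) M') (lift L))"
    by (auto simp del: cps.simps)
  from \<rho> obtain \<sigma>' where "cbv_typing Sig \<Gamma> (Var y) (\<sigma>' \<rightarrow> \<rho>)" "cbv_typing Sig \<Gamma> A \<sigma>'"
    unfolding cbv_typing_simps(4) by blast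
  then have y: "y < length \<Gamma>" "\<Gamma> ! y = \<sigma>' \<rightarrow> \<rho>" "cbv_typing Sig \<Gamma> A \<sigma>'" by simp_all
  from M eval have "cbv_typing Sig \<Gamma> A \<sigma>" by auto
  with y have "\<sigma>' = \<sigma>" using cbv_typing_unique by blast
  with y have H': "cbv_typing Sig (\<sigma> # \<Gamma>) ?H' \<rho>" by auto
  \<comment> \<open>Both sides end up running \<open>A\<close> with the continuation
    \<open>App (Var y) L\<close>; on the side of the redex this continuation first appears eta
    expanded.\<close>
  have "nred (App (cps R Sig (\<sigma> # \<Gamma>) ?H') (lift L)) (App (cps R Sig (\<sigma> # \<Gamma>) (Var 0)) (App (Var (Suc y)) (lift L)))"
    using nred_cps_App_val[OF H', of R "lift L"] by (simp del: cps.simps)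
  from rtranclp_trans[OF L(2)[OF H'] rtranclp_trans[OF this nred_cps_Var]]
  have "nred (App (cps R Sig (\<sigma> # \<Gamma>) (plugs (map lift_sctx E) ?H')) (lift K)) (App (lift (App (Var y) L)) (Var 0))"
    by simp
  from rtranclp_trans[OF nred_cps_redex_step[OF M[unfolded eval] this] nred_App_cong_right[OF nred_eta]]
  have 1: "nred (App (cps R Sig \<Gamma> M) K) (App (cps R Sig \<Gamma> A) (App (Var y) L))" unfolding eval .
  have "nred (App (cps R Sig \<Gamma> ?H) L) (App (cps R Sig \<Gamma> A) (App (Var y) L))"
    using nred_cps_App_val[OF \<rho>, of R L] by (simp del: cps.simps)
  from 1 rtranclp_trans[OF L(1) this] show ?thesis by (rule joinableI)
next
  case (box_id_v \<sigma>)
  have "nred (App (cps R Sig \<Gamma> M) K) (App (cps R Sig \<Gamma> N) (Lam (cps_ty R (Nec \<sigma>)) (App (lift K) (Box [cps_ty R \<sigma>] [Var 0] (Var 0)))))"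
    using nred_cps_Box[of "[\<sigma>]" "[N]" R Sig \<Gamma> "Var 0" K] box_id_v by (simp del: cps.simps)
  moreover have "nred (Box [cps_ty R \<sigma>] [Var 0] (Var 0)) (Var 0)"
    unfolding cbn_red_def by (intro r_into_rtranclp compat.root cbn_root.box_id)
  then have "nred (Lam (cps_ty R (Nec \<sigma>)) (App (lift K) (Box [cps_ty R \<sigma>] [Var 0] (Var 0)))) (Lam (cps_ty R (Nec \<sigma>)) (App (lift K) (Var 0)))"
    by (intro nred_Lam nred_App_cong_right)
  from nred_App_cong_right[OF rtranclp_trans[OF this nred_eta]]
  have "nred (App (cps R Sig \<Gamma> N) (Lam (cps_ty R (Nec \<sigma>)) (App (lift K) (Box [cps_ty R \<sigma>] [Var 0] (Var 0))))) (App (cps R Sig \<Gamma> N) K)" .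
  ultimately have "nred (App (cps R Sig \<Gamma> M) K) (App (cps R Sig \<Gamma> N) K)" by (rule rtranclp_trans)
  then show ?thesis by (rule joinableI) simp
next
  case (box_flat_v ws Ws ys Ns V \<sigma> zs Ps B)
  let ?\<Phi> = "map (cps_val R Sig \<Gamma>)" and ?T = "cps_ctx R"
  let ?I = "Box ys Ns V" and ?BV = "cps_val R Sig ys V" and ?BB = "cps_val R Sig (ws @ \<sigma> # zs) B"
  from M[unfolded box_flat_v] obtain \<rho> where B: "cbv_typing Sig (ws @ \<sigma> # zs) B \<rho>" "is_val B"
    and l: "list_all2 (\<lambda>N \<sigma>. cbv_typing Sig \<Gamma> N (Nec \<sigma>)) (Ws @ ?I # Ps) (ws @ \<sigma> # zs)" by auto
  from l box_flat_v(3) have tW: "list_all2 (\<lambda>N \<sigma>. cbv_typing Sig \<Gamma> N (Nec \<sigma>)) Ws ws"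
    and tI: "cbv_typing Sig \<Gamma> ?I (Nec \<sigma>)" and tP: "list_all2 (\<lambda>N \<sigma>. cbv_typing Sig \<Gamma> N (Nec \<sigma>)) Ps zs"
    by (auto simp: list_all2_append)
  from tI have V: "cbv_typing Sig ys V \<sigma>" by auto
  have lP: "length Ps = length zs" using list_all2_lengthD[OF tP] .
  let ?aP = "box_args R Sig \<Gamma> zs Ps" and ?aN = "box_args R Sig \<Gamma> ys Ns" and ?aW = "box_args R Sig \<Gamma> ws Ws"
  let ?K = "Lam (cps_ty R (Nec \<sigma>)) (box_seq (?T ws @ cps_ty R \<sigma> # ?T zs) ?BB ?aP (lift \<circ> Var) (map lift (?\<Phi> Ws) @ [Var 0]) (lift K))"
  let ?P = "box_seq (?T ws @ ?T ys @ ?T zs) (flat_sub (length (?T ws)) (length (?T ys)) ?BV ?BB) (?aN @ ?aP) Var (?\<Phi> Ws @ []) K"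
  have "nred (App (cps R Sig \<Gamma> (plug (CBox (ws @ \<sigma> # zs) Ws Ps B) ?I)) K)
      (App (cps R Sig \<Gamma> ?I) (kctx R Sig \<Gamma> (Nec \<sigma>) (CBox (ws @ \<sigma> # zs) Ws Ps B) K))"
    by (rule nred_plug[OF _ _ tI]) (use M box_flat_v in simp_all)
  then have 1: "nred (App (cps R Sig \<Gamma> M) K) (App (cps R Sig \<Gamma> ?I) ?K)"
    using box_flat_v by (simp add: comp_def del: cps.simps)
  have 2: "nred (App (cps R Sig \<Gamma> ?I) ?K) (box_seq (?T ys) ?BV ?aN Var [] ?K)"
    by (rule nred_cps_Box) (use box_flat_v in simp)
  have 3: "nred (box_seq (?T ys) ?BV ?aN Var [] ?K) ?P"
    by (rule nred_box_seq_flat) (use box_flat_v in simp_all)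
  let ?F = "flat_sub (length ws) (length ys) V B"
  have args: "box_args R Sig \<Gamma> (ws @ ys @ zs) (Ws @ Ns @ Ps) = ?aW @ ?aN @ ?aP"
    using box_flat_v lP by simp
  have "nred (App (cps R Sig \<Gamma> N) K) (box_seq (?T (ws @ ys @ zs)) (cps_val R Sig (ws @ ys @ zs) ?F) (?aW @ ?aN @ ?aP) Var [] K)"
    using nred_cps_Box[of "ws @ ys @ zs" "Ws @ Ns @ Ps" R Sig \<Gamma> ?F K] box_flat_v lP unfolding args by (simp del: cps.simps)
  moreover have "nred (box_seq (?T (ws @ ys @ zs)) (cps_val R Sig (ws @ ys @ zs) ?F) (?aW @ ?aN @ ?aP) Var [] K)
     (box_seq (?T (ws @ ys @ zs)) (cps_val R Sig (ws @ ys @ zs) ?F) (?aN @ ?aP) Var ([] @ ?\<Phi> Ws) K)"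
    by (rule nred_box_args_vals[OF tW]) (use box_flat_v in simp)
  moreover have "nred (box_seq (?T (ws @ ys @ zs)) (cps_val R Sig (ws @ ys @ zs) ?F) (?aN @ ?aP) Var ([] @ ?\<Phi> Ws) K) ?P"
    using nred_box_seq[OF list.rel_refl cps_val_flat_sub[OF B V box_flat_v(6)]] by simp
  ultimately have "nred (App (cps R Sig \<Gamma> N) K) ?P" by (rule rtranclp_trans[OF rtranclp_trans])
  with rtranclp_trans[OF 1 rtranclp_trans[OF 2 3]] show ?thesis by (rule joinableI)
qed

section \<open>From joinable roots to the equational theory\<close>

lemma tred_cbn_eq: "(tred Sig \<Gamma> \<tau> cbn_red)\<^sup>*\<^sup>* M N \<Longrightarrow> cbn_eq Sig \<Gamma> \<tau> M N"
  unfolding cbn_eq_def tred_def by (rule rtranclp_into_equivclp)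

lemma nred_cbn_eq:
  assumes "nred M P" "typing Sig \<Gamma> M \<tau>"
  shows "cbn_eq Sig \<Gamma> \<tau> M P"
proof -
  have "typing Sig \<Gamma> P \<tau> \<and> (tred Sig \<Gamma> \<tau> cbn_red)\<^sup>*\<^sup>* M P"
    using assms(1) typing_cbn_red assms(2) by (rule typing_rtranclp)
  then show ?thesis using tred_cbn_eq by blast
qed

lemma joinable_cbn_eq:
  assumes "joinable M N" "typing Sig \<Gamma> M \<tau>" "typing Sig \<Gamma> N \<tau>"
  shows "cbn_eq Sig \<Gamma> \<tau> M N"
proof -
  from assms(1) obtain P where P: "nred M P" "nred N P" unfolding joinable_def by blast
  have "cbn_eq Sig \<Gamma> \<tau> M P" "cbn_eq Sig \<Gamma> \<tau> N P"
    using nred_cbn_eq[OF P(1) assms(2)] nred_cbn_eq[OF P(2) assms(3)] .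
  then show ?thesis unfolding cbn_eq_def by (meson equivclp_sym equivclp_trans)
qed

lemma cbn_eq_imp_joinable: "cbn_eq Sig \<Gamma> \<tau> M N \<Longrightarrow> joinable M N"
proof (drule cbn_eq_joinable, elim exE conjE)
  fix P assume "(tred Sig \<Gamma> \<tau> cbn_red)\<^sup>*\<^sup>* M P" "(tred Sig \<Gamma> \<tau> cbn_red)\<^sup>*\<^sup>* N P"
  moreover have "nred X Y" if "(tred Sig \<Gamma> \<tau> cbn_red)\<^sup>*\<^sup>* X Y" for X Y
    using that by (rule mono_rtranclp[rule_format, rotated]) (simp add: tred_def)
  ultimately show "joinable M N" by (blast intro: joinableI)
qed

text \<open>Eta makes joinability extensional. Chaining the joins of \<open>M\<close>, the two
  expansions and \<open>N\<close> into one join relies on confluence.\<close>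

lemma joinable_ext:
  assumes "joinable (App (lift M) (Var 0)) (App (lift N) (Var 0))"
    and "typing Sig \<Gamma> M (\<sigma> \<rightarrow> \<rho>)" "typing Sig \<Gamma> N (\<sigma> \<rightarrow> \<rho>)"
  shows "joinable M N"
proof -
  let ?e = "\<lambda>M. Lam \<sigma> (App (lift M) (Var 0))"
  have t: "typing Sig \<Gamma> (?e M) (\<sigma> \<rightarrow> \<rho>)" "typing Sig \<Gamma> (?e N) (\<sigma> \<rightarrow> \<rho>)" using assms by auto
  have "joinable (?e M) (?e N)"
    using assms(1) unfolding joinable_def by (blast intro: nred_Lam)
  moreover have "joinable M (?e M)" "joinable (?e N) N"
    unfolding joinable_def by (blast intro: nred_eta)+
  ultimately have "cbn_eq Sig \<Gamma> (\<sigma> \<rightarrow> \<rho>) M (?e M)" "cbn_eq Sig \<Gamma> (\<sigma> \<rightarrow> \<rho>) (?e M) (?e N)" "cbn_eq Sig \<Gamma> (\<sigma> \<rightarrow> \<rho>) (?e N) N"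
    using t assms joinable_cbn_eq by blast+
  then have "cbn_eq Sig \<Gamma> (\<sigma> \<rightarrow> \<rho>) M N" unfolding cbn_eq_def by (meson equivclp_trans)
  then show ?thesis by (rule cbn_eq_imp_joinable)
qed

lemma cbv_root_cps:
  assumes "cbv_root M N" "cbv_typing Sig \<Gamma> M \<tau>" "cbv_typing Sig \<Gamma> N \<tau>"
  shows "joinable (cps R Sig \<Gamma> M) (cps R Sig \<Gamma> N)"
proof (rule joinable_ext)
  show "joinable (App (lift (cps R Sig \<Gamma> M)) (Var 0)) (App (lift (cps R Sig \<Gamma> N)) (Var 0))"
    using cbv_root_joinable[OF cbv_root_ren[OF assms(1), of Suc], of Sig "\<tau> # \<Gamma>" \<tau> R "Var 0"] assms(2,3)
    by (simp add: cps_lift[OF assms(2)] cps_lift[OF assms(3)])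
  show "typing (cps_sig R Sig) (cps_ctx R \<Gamma>) (cps R Sig \<Gamma> M) (cont_ty R \<tau> \<rightarrow> TConst R)"
    "typing (cps_sig R Sig) (cps_ctx R \<Gamma>) (cps R Sig \<Gamma> N) (cont_ty R \<tau> \<rightarrow> TConst R)"
    using typing_cps[OF assms(2)] typing_cps[OF assms(3)] by (simp_all add: cps_cty_def)
qed

lemma joinable_Lam: "joinable M N \<Longrightarrow> joinable (Lam \<sigma> M) (Lam \<sigma> N)"
  unfolding joinable_def using nred_Lam by blast

lemma joinable_App: "joinable M M' \<Longrightarrow> joinable N N' \<Longrightarrow> joinable (App M N) (App M' N')"
  unfolding joinable_def using nred_App by blast

lemma joinable_refl [simp]: "joinable M M"
  unfolding joinable_def by blast

lemma joinable_ren: "joinable M N \<Longrightarrow> joinable (ren f M) (ren f N)"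
  unfolding joinable_def ren_as_sub using nred_sub by blast

text \<open>The two conjuncts are proved together because \<open>cps\<close> of a box uses
  \<open>cps_val\<close> of its body, and \<open>cps_val\<close> of an abstraction uses
  \<open>cps\<close> of its body.\<close>

lemma cbv_red_cps:
  "compat cbv_root M N \<Longrightarrow> cbv_typing Sig \<Gamma> M \<tau> \<Longrightarrow> cbv_typing Sig \<Gamma> N \<tau> \<Longrightarrow>
    joinable (cps R Sig \<Gamma> M) (cps R Sig \<Gamma> N) \<and>
    (is_val M \<longrightarrow> is_val N \<longrightarrow> joinable (cps_val R Sig \<Gamma> M) (cps_val R Sig \<Gamma> N))"
proof (induction arbitrary: \<Gamma> \<tau> rule: compat.induct)
  case (root M N)
  show ?case
    using cbv_root_cps[OF root, of R] cbv_root_cps_val[OF root, of R] by (intro conjI impI)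
next
  case (lam M M' \<sigma>)
  from lam.prems obtain \<rho> where t: "cbv_typing Sig (\<sigma> # \<Gamma>) M \<rho>" "cbv_typing Sig (\<sigma> # \<Gamma>) M' \<rho>" by auto
  then have ty: "ty_of Sig (\<sigma> # \<Gamma>) M = \<rho>" "ty_of Sig (\<sigma> # \<Gamma>) M' = \<rho>"
    unfolding cbv_typing_def by (auto intro: ty_of_typing)
  have "joinable (cps R Sig (\<sigma> # \<Gamma>) M) (cps R Sig (\<sigma> # \<Gamma>) M')" using lam.IH[OF t] by blast
  then have val: "joinable (cps_val R Sig \<Gamma> (Lam \<sigma> M)) (cps_val R Sig \<Gamma> (Lam \<sigma> M'))"
    by (auto simp: ty intro!: joinable_Lam joinable_App joinable_ren)
  then have "joinable (cps R Sig \<Gamma> (Lam \<sigma> M)) (cps R Sig \<Gamma> (Lam \<sigma> M'))"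
    using ty by (auto simp del: cps_val.simps ren.simps intro!: joinable_Lam joinable_App joinable_ren)
  with val show ?case by blast
next
  case (appL M M' N)
  from appL.prems obtain \<sigma> \<sigma>' where t: "cbv_typing Sig \<Gamma> M (\<sigma> \<rightarrow> \<tau>)" "cbv_typing Sig \<Gamma> N \<sigma>"
    "cbv_typing Sig \<Gamma> M' (\<sigma>' \<rightarrow> \<tau>)" "cbv_typing Sig \<Gamma> N \<sigma>'" by auto
  then have "\<sigma>' = \<sigma>" using cbv_typing_unique by blast
  with t have t': "cbv_typing Sig \<Gamma> M' (\<sigma> \<rightarrow> \<tau>)" by simp
  then have ty: "ty_of Sig \<Gamma> M = \<sigma> \<rightarrow> \<tau>" "ty_of Sig \<Gamma> M' = \<sigma> \<rightarrow> \<tau>"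
    using t unfolding cbv_typing_def by (auto intro: ty_of_typing)
  from appL.IH[OF t(1) t'] show ?case by (auto simp: ty intro!: joinable_Lam joinable_App joinable_ren)
next
  case (appR N N' M)
  from appR.prems obtain \<sigma> \<sigma>' where t: "cbv_typing Sig \<Gamma> M (\<sigma> \<rightarrow> \<tau>)" "cbv_typing Sig \<Gamma> N \<sigma>"
    "cbv_typing Sig \<Gamma> M (\<sigma>' \<rightarrow> \<tau>)" "cbv_typing Sig \<Gamma> N' \<sigma>'" by auto
  from cbv_typing_unique[OF t(1,3)] t have "cbv_typing Sig \<Gamma> N' \<sigma>" by simp
  from appR.IH[OF t(2) this] show ?case by (auto intro!: joinable_Lam joinable_App joinable_ren)
next
  case (boxArg N N' ts Ps Qs B)
  from boxArg.prems(1) show ?case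
  proof (rule cbv_typing_CBox)
    fix ts1 t ts2 \<rho>
    assume a: "ts = ts1 @ t # ts2" "\<tau> = Nec \<rho>"
      "list_all2 (\<lambda>N \<sigma>. cbv_typing Sig \<Gamma> N (Nec \<sigma>)) Ps ts1" "cbv_typing Sig \<Gamma> N (Nec t)"
      "list_all2 (\<lambda>N \<sigma>. cbv_typing Sig \<Gamma> N (Nec \<sigma>)) Qs ts2" "cbv_typing Sig ts B \<rho>" "is_val B" "length ts1 = length Ps"
    have N': "cbv_typing Sig \<Gamma> N' (Nec t)" using boxArg.prems(2) a(1,8) by (auto simp: list_all2_append)
    note IH = boxArg.IH[OF a(4) N']
    have l: "length ts = length (Ps @ X # Qs)" for X using a(1,8) list_all2_lengthD[OF a(5)] by simp
    from IH obtain P where P: "nred (cps R Sig \<Gamma> N) P" "nred (cps R Sig \<Gamma> N') P" unfolding joinable_def by blast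
    let ?args = "\<lambda>P. box_args R Sig \<Gamma> ts1 Ps @ (cps_ty R (Nec t), P) # box_args R Sig \<Gamma> ts2 Qs"
    have args: "box_args R Sig \<Gamma> ts (Ps @ X # Qs) = ?args (cps R Sig \<Gamma> X)" for X using a(1,8) by simp
    have "list_all2 (\<lambda>p q. fst p = fst q \<and> nred (snd p) (snd q)) (?args X) (?args Y)" if "nred X Y" for X Y
      using that by (auto intro!: list_all2_appendI list.rel_refl)
    then have "nred (box_seq us D (?args X) \<theta> Ws K) (box_seq us D (?args Y) \<theta> Ws K)" if "nred X Y" for X Y us D \<theta> Ws K
      using that nred_box_seq by blast
    with P have "joinable (box_seq us D (?args (cps R Sig \<Gamma> N)) \<theta> Ws K) (box_seq us D (?args (cps R Sig \<Gamma> N')) \<theta> Ws K)" for us D \<theta> Ws K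
      by (blast intro: joinableI)
    then have "joinable (cps R Sig \<Gamma> (Box ts (Ps @ N # Qs) B)) (cps R Sig \<Gamma> (Box ts (Ps @ N' # Qs) B))"
      unfolding cps_Box_eq[OF l] args by (rule joinable_Lam)
    moreover have "joinable (cps_val R Sig \<Gamma> (Box ts (Ps @ N # Qs) B)) (cps_val R Sig \<Gamma> (Box ts (Ps @ N' # Qs) B))"
      if v: "is_val (Box ts (Ps @ N # Qs) B)" "is_val (Box ts (Ps @ N' # Qs) B)"
    proof -
      from v IH obtain P where P: "nred (cps_val R Sig \<Gamma> N) P" "nred (cps_val R Sig \<Gamma> N') P" unfolding joinable_def by auto
      let ?Q = "map (cps_val R Sig \<Gamma>) Ps @ P # map (cps_val R Sig \<Gamma>) Qs"
      have "nred (cps_val R Sig \<Gamma> (Box ts (Ps @ X # Qs) B)) (Box (cps_ctx R ts) ?Q (cps_val R Sig ts B))"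
        if "nred (cps_val R Sig \<Gamma> X) P" for X
        using that by (auto intro!: nred_Box list_all2_appendI list.rel_refl)
      with P show ?thesis by (blast intro: joinableI)
    qed
    ultimately show ?thesis by blast
  qed
next
  case (boxBody B B' ts Ns)
  from boxBody.prems obtain \<rho> where t: "cbv_typing Sig ts B \<rho>" "is_val B" "cbv_typing Sig ts B' \<rho>" "is_val B'"
    and l: "length ts = length Ns" by (auto dest: list_all2_lengthD)
  from boxBody.IH[OF t(1,3)] t obtain P where P: "nred (cps_val R Sig ts B) P" "nred (cps_val R Sig ts B') P"
    unfolding joinable_def by blast
  have ty: "ty_of Sig ts B = ty_of Sig ts B'"
    using t unfolding cbv_typing_def by (auto dest: ty_of_typing)
  have "nred (box_seq us C ps \<theta> Ws K) (box_seq us D ps \<theta> Ws K)" if "nred C D" for us C D ps \<theta> Ws K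
    by (rule nred_box_seq[OF _ that]) (auto intro: list.rel_refl)
  with P have "joinable (box_seq us (cps_val R Sig ts B) ps \<theta> Ws K) (box_seq us (cps_val R Sig ts B') ps \<theta> Ws K)" for us ps \<theta> Ws K
    by (blast intro: joinableI)
  then have "joinable (cps R Sig \<Gamma> (Box ts Ns B)) (cps R Sig \<Gamma> (Box ts Ns B'))"
    unfolding cps_Box_eq[OF l] ty by (rule joinable_Lam)
  moreover have "nred (Box us Ws C) (Box us Ws D)" if "nred C D" for us Ws C D
    by (rule nred_Box[OF _ that]) (auto intro: list.rel_refl)
  with P have "joinable (cps_val R Sig \<Gamma> (Box ts Ns B)) (cps_val R Sig \<Gamma> (Box ts Ns B'))"
    unfolding cps_val.simps by (blast intro: joinableI)
  ultimately show ?case by blast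
qed

lemma cps_sound:
  assumes "cbv_eq Sig \<Gamma> \<tau> M N"
  shows "cbn_eq (cps_sig R Sig) (cps_ctx R \<Gamma>) (cps_cty R \<tau>) (cps R Sig \<Gamma> M) (cps R Sig \<Gamma> N)"
  using assms unfolding cbv_eq_def
proof (induction rule: equivclp_induct)
  case base
  show ?case unfolding cbn_eq_def by (rule equivclp_refl)
next
  case (step N P)
  then have t: "cbv_typing Sig \<Gamma> N \<tau>" "cbv_typing Sig \<Gamma> P \<tau>" and "cbv_red N P \<or> cbv_red P N" by auto
  then have "joinable (cps R Sig \<Gamma> N) (cps R Sig \<Gamma> P)"
    using cbv_red_cps[of N P Sig \<Gamma> \<tau> R] cbv_red_cps[of P N Sig \<Gamma> \<tau> R]
    unfolding cbv_red_def joinable_def by blast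
  from joinable_cbn_eq[OF this typing_cps[OF t(1)] typing_cps[OF t(2)]] step.IH
  show ?case unfolding cbn_eq_def by (meson equivclp_trans)
qed


section \<open>Completeness\<close>

text \<open>The decodings obtained along the two reductions are decodings of the same term
  \<open>P\<close>, hence identical, and each equals its source term.\<close>

lemma cps_complete:
  assumes "cbv_typing Sig \<Gamma> M \<tau>" "cbv_typing Sig \<Gamma> N \<tau>"
    and "joinable (cps R Sig \<Gamma> M) (cps R Sig \<Gamma> N)"
  shows "cbv_eq Sig \<Gamma> \<tau> M N"
proof -
  from assms(3) obtain P where P: "nred (cps R Sig \<Gamma> M) P" "nred (cps R Sig \<Gamma> N) P"
    unfolding joinable_def by blast
  have dec: "\<exists>Q'. dT R Sig \<Gamma> Some P Q' \<tau> \<and> eqv Sig \<Gamma> \<tau> Q Q'"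
    if t: "cbv_typing Sig \<Gamma> Q \<tau>" and r: "nred (cps R Sig \<Gamma> Q) P" for Q
  proof -
    from decode_cps[of Sig \<Gamma> Q \<tau> R] t obtain Q1 where Q1: "dT R Sig \<Gamma> Some (cps R Sig \<Gamma> Q) Q1 \<tau>" "eqv Sig \<Gamma> \<tau> Q1 Q"
      unfolding cbv_typing_def by blast
    from decode_steps[OF r Q1(1)] Q1(2) veq_sym veq_trans show ?thesis by blast
  qed
  from dec[OF assms(1) P(1)] dec[OF assms(2) P(2)] obtain M' N' where
    "dT R Sig \<Gamma> Some P M' \<tau>" "eqv Sig \<Gamma> \<tau> M M'" "dT R Sig \<Gamma> Some P N' \<tau>" "eqv Sig \<Gamma> \<tau> N N'" by blast
  moreover from decode_unique(4)[OF this(1,3)] have "M' = N'" ..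
  ultimately have "eqv Sig \<Gamma> \<tau> M N" using veq_sym veq_trans by blast
  then show ?thesis by (simp add: cbv_eq_veq)
qed

theorem theorem2:
  fixes R :: 'p and Sig :: "'c \<Rightarrow> 'p ty" and \<Gamma> :: "'p ty list" and \<tau> :: "'p ty"
    and M N :: "('p, 'c) tm"
  assumes "cbv_typing Sig \<Gamma> M \<tau>" and "cbv_typing Sig \<Gamma> N \<tau>"
  shows "cbv_eq Sig \<Gamma> \<tau> M N \<longleftrightarrow>
    cbn_eq (cps_ty R \<circ> Sig) (map (cps_ty R) \<Gamma>) (cps_cty R \<tau>)
      (cps R Sig \<Gamma> M) (cps R Sig \<Gamma> N)"
proof
  assume "cbv_eq Sig \<Gamma> \<tau> M N"
  then show "cbn_eq (cps_ty R \<circ> Sig) (map (cps_ty R) \<Gamma>) (cps_cty R \<tau>) (cps R Sig \<Gamma> M) (cps R Sig \<Gamma> N)"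
    by (rule cps_sound)
next
  assume "cbn_eq (cps_ty R \<circ> Sig) (map (cps_ty R) \<Gamma>) (cps_cty R \<tau>) (cps R Sig \<Gamma> M) (cps R Sig \<Gamma> N)"
  then have "joinable (cps R Sig \<Gamma> M) (cps R Sig \<Gamma> N)" by (rule cbn_eq_imp_joinable)
  with assms show "cbv_eq Sig \<Gamma> \<tau> M N" by (rule cps_complete)
qed

end
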